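(* The restriction of the 2-adjunction $\mathsf{Par}\dashv\mathsf{Total}:\mathfrak{SplitRestCat}\to\mathfrak{StableCat}$ to its fixed objects is the Cockett-Lack 2-equivalence of $\mathfrak{SplitRestCat}$ with the full subcategory $\mathfrak{StableCat}_{\mathrm{mono}}$ of $\mathfrak{StableCat}$ given by the stably structured categories $(\mathcal C,\mathcal S)$ with $\mathcal S$ a class of monomorphisms in $\mathcal C$. That is: the counit $\varepsilon_{\mathcal X}$ is an isomorphism for every split restriction category $\mathcal X$; the unit $\eta_{(\mathcal C,\mathcal S)}$ is an isomorphism if and only if $\mathcal S$ is a class of monomorphisms in $\mathcal C$; and $\mathsf{Par}$, $\mathsf{Total}$ restrict to a 2-equivalence between $\mathfrak{StableCat}_{\mathrm{mono}}$ and $\mathfrak{SplitRestCat}$.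
   Context: The 2-category $\mathfrak{StableCat}$ (very large): objects are stably structured categories, i.e. pairs $(\mathcal C,\mathcal S)$ with $\mathcal C$ a category and $\mathcal S$ a class of morphisms of $\mathcal C$ that contains all isomorphisms, is closed under composition, and is such that pullbacks of $\mathcal S$-morphisms along arbitrary morphisms exist in $\mathcal C$ and belong to $\mathcal S$; 1-cells $F:(\mathcal C,\mathcal S)\to(\mathcal D,\mathcal T)$ are functors with $F(\mathcal S)\subseteq\mathcal T$ which preserve pullbacks along $\mathcal S$-morphisms; 2-cells are natural transformations whose naturality squares involving $\mathcal S$-morphisms are pullback squares. Restriction categories: a restriction structure on a category assigns to each $f:A\to B$ a morphism $\bar f:A\to A$ such that (R1) $f\cdot\bar f=f$; (R2) $\bar f\cdot\bar g=\bar g\cdot\bar f$ if $\mathrm{dom}f=\mathrm{dom}g$; (R3) $\overline{g\cdot\bar f}=\bar g\cdot\bar f$ if $\mathrm{dom}f=\mathrm{dom}g$; (R4) $\bar g\cdot f=f\cdot\overline{g\cdot f}$ if $\mathrm{cod}f=\mathrm{dom}g$. It is split if every $e$ with $\bar e=e$ splits ($e=m\cdot r$, $r\cdot m=1$ for some $m,r$). A morphism $f$ is total if $\bar f=1$; $i$ is a restricted isomorphism if there is a (necessarily unique) $i^-$ with $i^-\cdot i=\bar i$, $i\cdot i^-=\overline{i^-}$. $\mathfrak{SplitRestCat}$ (very large) is the 2-category of split restriction categories, restriction-preserving functors, and natural transformations with total components. The 2-functor $\mathsf{Total}$ sends $\mathcal X$ to $(\mathsf{Total}(\mathcal X),\mathsf{ReIso}(\mathcal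 X))$, where $\mathsf{Total}(\mathcal X)$ is the subcategory of total morphisms (all objects) and $\mathsf{ReIso}(\mathcal X)$ is the class of total restricted isomorphisms; on 1-cells it restricts functors, and it keeps 2-cells. The 2-functor $\mathsf{Par}$: an $\mathcal S$-span $(s,f):A\to B$ is a pair $s:D\to A$ in $\mathcal S$, $f:D\to B$ in $\mathcal C$; a morphism $x:(s,f)\to(\tilde s,\tilde f)$ is a $\mathcal C$-morphism with $\tilde s\cdot x=s$, $\tilde f\cdot x=f$; isomorphic spans are identified; they form the category $\mathsf{Span}(\mathcal C,\mathcal S)$ (with the objects of $\mathcal C$) under $(t,g)\cdot(s,f)=(s\cdot t',g\cdot f')$, where $f\cdot t'=t\cdot f'$ is a pullback square. An $\mathcal S$-cospan $\langle f,s\rangle:A\to B$ is a pair $f:A\to D$ in $\mathcal C$, $s:B\to D$ in $\mathcal S$; a morphism $v:\langle f,s\rangle\to\langle g,t\rangle$ is a $\mathcal C$-morphism with $v\cdot f=g$, $v\cdot s=t$; with pullback squares $f\cdot s'=s\cdot f'$ and $g\cdot t'=t\cdot g'$, its conjugate $v^\star$ is the unique morphism with $t'\cdot v^\star=s'$, $g'\cdot v^\star=f'$. $\mathcal S^\star$ is the class of all existing pullbacks in $\mathcal C$ of conjugates $v^\star$ of $\mathcal S$-cospan morphisms $v$ with $v\in\mathcal S$. $\sim_{\mathrm z^\star}$ is the least equivalence relation on $\mathcal S$-spans such that $(s,f)\sim_{\mathrm z^\star}(\tilde s,\tilde f)$ whenever there is a morphism $x:(s,f)\to(\tilde s,\tilde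 f)$ with $x\in\mathcal S^\star$ (a congruence). $\mathsf{Par}(\mathcal C,\mathcal S)$ is the quotient of $\mathsf{Span}(\mathcal C,\mathcal S)$ by $\sim_{\mathrm z^\star}$, with morphisms $[s,f]$ and restriction $\overline{[s,f]}=[s,s]$. On 1-cells $\mathsf{Par}(F)[s,f]=[Fs,Ff]$; a 2-cell $\alpha:F\Rightarrow G$ is sent to the transformation with components $[1_{FA},\alpha_A]$. The 2-adjunction $\mathsf{Par}\dashv\mathsf{Total}$ has unit $\eta_{(\mathcal C,\mathcal S)}:(\mathcal C,\mathcal S)\to(\mathsf{Total}(\mathsf{Par}(\mathcal C,\mathcal S)),\mathsf{ReIso}(\mathsf{Par}(\mathcal C,\mathcal S)))$, $f\mapsto[1,f]$, and counit $\varepsilon_{\mathcal X}:\mathsf{Par}(\mathsf{Total}(\mathcal X),\mathsf{ReIso}(\mathcal X))\to\mathcal X$, $[s,f]\mapsto f\cdot s^-$. Fixed objects of the adjunction are the objects at which the unit, respectively the counit, is an isomorphism. The Cockett-Lack 2-equivalence is the one given by $\mathcal X\mapsto(\mathsf{Total}(\mathcal X),\mathsf{ReIso}(\mathcal X))$ and, for $\mathcal S$ a class of monomorphisms, by $(\mathcal C,\mathcal S)\mapsto\mathsf{Span}(\mathcal C,\mathcal S)$, which is then isomorphic to $\mathsf{Par}(\mathcal C,\mathcal S)$. *)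

theory Defs
  imports Main "HOL-Library.FuncSet"
begin

section \<open>Categories and pullbacks\<close>

text \<open>All structure maps are \<^const>\<open>undefined\<close> outside their domains, so that equality of categories,
  functors and transformations is the intended one.\<close>

record ('o, 'm) cat =
  Obj :: "'o set"
  Arr :: "'m set"
  Dom :: "'m \<Rightarrow> 'o"
  Cod :: "'m \<Rightarrow> 'o"
  Idt :: "'o \<Rightarrow> 'm"
  Cmp :: "'m \<Rightarrow> 'm \<Rightarrow> 'm" (infixr "\<cdot>\<index>" 75)

definition hom :: "('o, 'm) cat \<Rightarrow> 'o \<Rightarrow> 'o \<Rightarrow> 'm set" where
  "hom C A B = {f \<in> Arr C. Dom C f = A \<and> Cod C f = B}"

definition category :: "('o, 'm) cat \<Rightarrow> bool" where
  "category C \<longleftrightarrow>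
     Dom C \<in> Arr C \<rightarrow>\<^sub>E Obj C \<and> Cod C \<in> Arr C \<rightarrow>\<^sub>E Obj C \<and>
     Idt C \<in> extensional (Obj C) \<and> (\<forall>A\<in>Obj C. Idt C A \<in> hom C A A) \<and>
     (\<forall>g f. if f \<in> Arr C \<and> g \<in> Arr C \<and> Cod C f = Dom C g
            then g \<cdot>\<^bsub>C\<^esub> f \<in> hom C (Dom C f) (Cod C g)
            else g \<cdot>\<^bsub>C\<^esub> f = undefined) \<and>
     (\<forall>f\<in>Arr C. f \<cdot>\<^bsub>C\<^esub> Idt C (Dom C f) = f \<and> Idt C (Cod C f) \<cdot>\<^bsub>C\<^esub> f = f) \<and>
     (\<forall>f\<in>Arr C. \<forall>g\<in>Arr C. \<forall>h\<in>Arr C. Cod C f = Dom C g \<and> Cod C g = Dom C h \<longrightarrow>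
        h \<cdot>\<^bsub>C\<^esub> (g \<cdot>\<^bsub>C\<^esub> f) = (h \<cdot>\<^bsub>C\<^esub> g) \<cdot>\<^bsub>C\<^esub> f)"

definition iso_arr :: "('o, 'm) cat \<Rightarrow> 'm \<Rightarrow> bool" where
  "iso_arr C f \<longleftrightarrow> f \<in> Arr C \<and>
     (\<exists>g\<in>hom C (Cod C f) (Dom C f).
        g \<cdot>\<^bsub>C\<^esub> f = Idt C (Dom C f) \<and> f \<cdot>\<^bsub>C\<^esub> g = Idt C (Cod C f))"

definition mono_arr :: "('o, 'm) cat \<Rightarrow> 'm \<Rightarrow> bool" where
  "mono_arr C m \<longleftrightarrow> m \<in> Arr C \<and>
     (\<forall>a\<in>Arr C. \<forall>b\<in>Arr C. Dom C a = Dom C b \<and> Cod C a = Dom C m \<and> Cod C b = Dom C m \<and>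
        m \<cdot>\<^bsub>C\<^esub> a = m \<cdot>\<^bsub>C\<^esub> b \<longrightarrow> a = b)"

text \<open>\<open>pullback C f s s' f'\<close>: the square \<open>f \<cdot> s' = s \<cdot> f'\<close> is a pullback, so \<open>s'\<close> is a pullback of \<open>s\<close> along \<open>f\<close>.\<close>

definition pullback :: "('o, 'm) cat \<Rightarrow> 'm \<Rightarrow> 'm \<Rightarrow> 'm \<Rightarrow> 'm \<Rightarrow> bool" where
  "pullback C f s s' f' \<longleftrightarrow>
     f \<in> Arr C \<and> s \<in> Arr C \<and> s' \<in> Arr C \<and> f' \<in> Arr C \<and>
     Cod C f = Cod C s \<and> Dom C s' = Dom C f' \<and> Cod C s' = Dom C f \<and> Cod C f' = Dom C s \<and>
     f \<cdot>\<^bsub>C\<^esub> s' = s \<cdot>\<^bsub>C\<^esub> f' \<and>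
     (\<forall>a\<in>Arr C. \<forall>b\<in>Arr C. Dom C a = Dom C b \<and> Cod C a = Dom C f \<and> Cod C b = Dom C s \<and>
        f \<cdot>\<^bsub>C\<^esub> a = s \<cdot>\<^bsub>C\<^esub> b \<longrightarrow>
        (\<exists>!u. u \<in> hom C (Dom C a) (Dom C s') \<and> s' \<cdot>\<^bsub>C\<^esub> u = a \<and> f' \<cdot>\<^bsub>C\<^esub> u = b))"

definition is_functor :: "('o, 'm) cat \<Rightarrow> ('p, 'n) cat \<Rightarrow> ('o \<Rightarrow> 'p) \<Rightarrow> ('m \<Rightarrow> 'n) \<Rightarrow> bool" where
  "is_functor C D Fo Fa \<longleftrightarrow> category C \<and> category D \<and>
     Fo \<in> Obj C \<rightarrow>\<^sub>E Obj D \<and> Fa \<in> Arr C \<rightarrow>\<^sub>E Arr D \<and>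
     (\<forall>f\<in>Arr C. Dom D (Fa f) = Fo (Dom C f) \<and> Cod D (Fa f) = Fo (Cod C f)) \<and>
     (\<forall>A\<in>Obj C. Fa (Idt C A) = Idt D (Fo A)) \<and>
     (\<forall>f\<in>Arr C. \<forall>g\<in>Arr C. Cod C f = Dom C g \<longrightarrow> Fa (g \<cdot>\<^bsub>C\<^esub> f) = Fa g \<cdot>\<^bsub>D\<^esub> Fa f)"

section \<open>Strict 2-categories\<close>

record ('a, 'b, 'c) twocat =
  Cells0 :: "'a set"
  Cells1 :: "'b set"
  Cells2 :: "'c set"
  src1 :: "'b \<Rightarrow> 'a"
  tgt1 :: "'b \<Rightarrow> 'a"
  one1 :: "'a \<Rightarrow> 'b"
  comp1 :: "'b \<Rightarrow> 'b \<Rightarrow> 'b"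
  src2 :: "'c \<Rightarrow> 'b"
  tgt2 :: "'c \<Rightarrow> 'b"
  one2 :: "'b \<Rightarrow> 'c"
  vcomp :: "'c \<Rightarrow> 'c \<Rightarrow> 'c"
  hcomp :: "'c \<Rightarrow> 'c \<Rightarrow> 'c"

definition composable1 :: "('a, 'b, 'c) twocat \<Rightarrow> 'b \<Rightarrow> 'b \<Rightarrow> bool" where
  "composable1 K g f \<longleftrightarrow> f \<in> Cells1 K \<and> g \<in> Cells1 K \<and> tgt1 K f = src1 K g"

definition vcomposable :: "('a, 'b, 'c) twocat \<Rightarrow> 'c \<Rightarrow> 'c \<Rightarrow> bool" where
  "vcomposable K \<beta> \<alpha> \<longleftrightarrow> \<alpha> \<in> Cells2 K \<and> \<beta> \<in> Cells2 K \<and> tgt2 K \<alpha> = src2 K \<beta>"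

definition hcomposable :: "('a, 'b, 'c) twocat \<Rightarrow> 'c \<Rightarrow> 'c \<Rightarrow> bool" where
  "hcomposable K \<beta> \<alpha> \<longleftrightarrow> \<alpha> \<in> Cells2 K \<and> \<beta> \<in> Cells2 K \<and>
     tgt1 K (src2 K \<alpha>) = src1 K (src2 K \<beta>)"

definition two_category :: "('a, 'b, 'c) twocat \<Rightarrow> bool" where
  "two_category K \<longleftrightarrow>
     (\<forall>f\<in>Cells1 K. src1 K f \<in> Cells0 K \<and> tgt1 K f \<in> Cells0 K \<and>
        comp1 K f (one1 K (src1 K f)) = f \<and> comp1 K (one1 K (tgt1 K f)) f = f) \<and>
     (\<forall>A\<in>Cells0 K. one1 K A \<in> Cells1 K \<and> src1 K (one1 K A) = A \<and> tgt1 K (one1 K A) = A) \<and>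
     (\<forall>g f. composable1 K g f \<longrightarrow> comp1 K g f \<in> Cells1 K \<and>
        src1 K (comp1 K g f) = src1 K f \<and> tgt1 K (comp1 K g f) = tgt1 K g) \<and>
     (\<forall>h g f. composable1 K h g \<and> composable1 K g f \<longrightarrow>
        comp1 K h (comp1 K g f) = comp1 K (comp1 K h g) f) \<and>
     (\<forall>\<alpha>\<in>Cells2 K. src2 K \<alpha> \<in> Cells1 K \<and> tgt2 K \<alpha> \<in> Cells1 K \<and>
        src1 K (src2 K \<alpha>) = src1 K (tgt2 K \<alpha>) \<and> tgt1 K (src2 K \<alpha>) = tgt1 K (tgt2 K \<alpha>) \<and>
        vcomp K \<alpha> (one2 K (src2 K \<alpha>)) = \<alpha> \<and> vcomp K (one2 K (tgt2 K \<alpha>)) \<alpha> = \<alpha> \<and>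
        hcomp K \<alpha> (one2 K (one1 K (src1 K (src2 K \<alpha>)))) = \<alpha> \<and>
        hcomp K (one2 K (one1 K (tgt1 K (src2 K \<alpha>)))) \<alpha> = \<alpha>) \<and>
     (\<forall>f\<in>Cells1 K. one2 K f \<in> Cells2 K \<and> src2 K (one2 K f) = f \<and> tgt2 K (one2 K f) = f) \<and>
     (\<forall>\<beta> \<alpha>. vcomposable K \<beta> \<alpha> \<longrightarrow> vcomp K \<beta> \<alpha> \<in> Cells2 K \<and>
        src2 K (vcomp K \<beta> \<alpha>) = src2 K \<alpha> \<and> tgt2 K (vcomp K \<beta> \<alpha>) = tgt2 K \<beta>) \<and>
     (\<forall>\<gamma> \<beta> \<alpha>. vcomposable K \<gamma> \<beta> \<and> vcomposable K \<beta> \<alpha> \<longrightarrow>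
        vcomp K \<gamma> (vcomp K \<beta> \<alpha>) = vcomp K (vcomp K \<gamma> \<beta>) \<alpha>) \<and>
     (\<forall>\<beta> \<alpha>. hcomposable K \<beta> \<alpha> \<longrightarrow> hcomp K \<beta> \<alpha> \<in> Cells2 K \<and>
        src2 K (hcomp K \<beta> \<alpha>) = comp1 K (src2 K \<beta>) (src2 K \<alpha>) \<and>
        tgt2 K (hcomp K \<beta> \<alpha>) = comp1 K (tgt2 K \<beta>) (tgt2 K \<alpha>)) \<and>
     (\<forall>\<gamma> \<beta> \<alpha>. hcomposable K \<gamma> \<beta> \<and> hcomposable K \<beta> \<alpha> \<longrightarrow>
        hcomp K \<gamma> (hcomp K \<beta> \<alpha>) = hcomp K (hcomp K \<gamma> \<beta>) \<alpha>) \<and>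
     (\<forall>g f. composable1 K g f \<longrightarrow> hcomp K (one2 K g) (one2 K f) = one2 K (comp1 K g f)) \<and>
     (\<forall>\<beta>' \<beta> \<alpha>' \<alpha>. vcomposable K \<beta>' \<beta> \<and> vcomposable K \<alpha>' \<alpha> \<and> hcomposable K \<beta> \<alpha> \<longrightarrow>
        hcomp K (vcomp K \<beta>' \<beta>) (vcomp K \<alpha>' \<alpha>) = vcomp K (hcomp K \<beta>' \<alpha>') (hcomp K \<beta> \<alpha>))"

definition full_sub :: "('a, 'b, 'c) twocat \<Rightarrow> 'a set \<Rightarrow> ('a, 'b, 'c) twocat" where
  "full_sub K P = K\<lparr>
     Cells0 := Cells0 K \<inter> P,
     Cells1 := {f \<in> Cells1 K. src1 K f \<in> P \<and> tgt1 K f \<in> P},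
     Cells2 := {\<alpha> \<in> Cells2 K. src1 K (src2 K \<alpha>) \<in> P \<and> tgt1 K (src2 K \<alpha>) \<in> P}\<rparr>"

definition iso1 :: "('a, 'b, 'c) twocat \<Rightarrow> 'b \<Rightarrow> bool" where
  "iso1 K f \<longleftrightarrow> f \<in> Cells1 K \<and>
     (\<exists>g\<in>Cells1 K. src1 K g = tgt1 K f \<and> tgt1 K g = src1 K f \<and>
        comp1 K g f = one1 K (src1 K f) \<and> comp1 K f g = one1 K (tgt1 K f))"

record ('a, 'b, 'c, 'd, 'e, 'f) twofun =
  on0 :: "'a \<Rightarrow> 'd"
  on1 :: "'b \<Rightarrow> 'e"
  on2 :: "'c \<Rightarrow> 'f"

definition two_functor ::
  "('a, 'b, 'c) twocat \<Rightarrow> ('d, 'e, 'f) twocat \<Rightarrow> ('a, 'b, 'c, 'd, 'e, 'f) twofun \<Rightarrow> bool" where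
  "two_functor K L F \<longleftrightarrow> two_category K \<and> two_category L \<and>
     (\<forall>A\<in>Cells0 K. on0 F A \<in> Cells0 L \<and> on1 F (one1 K A) = one1 L (on0 F A)) \<and>
     (\<forall>f\<in>Cells1 K. on1 F f \<in> Cells1 L \<and>
        src1 L (on1 F f) = on0 F (src1 K f) \<and> tgt1 L (on1 F f) = on0 F (tgt1 K f) \<and>
        on2 F (one2 K f) = one2 L (on1 F f)) \<and>
     (\<forall>\<alpha>\<in>Cells2 K. on2 F \<alpha> \<in> Cells2 L \<and>
        src2 L (on2 F \<alpha>) = on1 F (src2 K \<alpha>) \<and> tgt2 L (on2 F \<alpha>) = on1 F (tgt2 K \<alpha>)) \<and>
     (\<forall>g f. composable1 K g f \<longrightarrow> on1 F (comp1 K g f) = comp1 L (on1 F g) (on1 F f)) \<and>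
     (\<forall>\<beta> \<alpha>. vcomposable K \<beta> \<alpha> \<longrightarrow> on2 F (vcomp K \<beta> \<alpha>) = vcomp L (on2 F \<beta>) (on2 F \<alpha>)) \<and>
     (\<forall>\<beta> \<alpha>. hcomposable K \<beta> \<alpha> \<longrightarrow> on2 F (hcomp K \<beta> \<alpha>) = hcomp L (on2 F \<beta>) (on2 F \<alpha>))"

definition id_twofun :: "('a, 'b, 'c, 'a, 'b, 'c) twofun" where
  "id_twofun = \<lparr>on0 = id, on1 = id, on2 = id\<rparr>"

definition comp_twofun ::
  "('d, 'e, 'f, 'g, 'h, 'i) twofun \<Rightarrow> ('a, 'b, 'c, 'd, 'e, 'f) twofun \<Rightarrow>
   ('a, 'b, 'c, 'g, 'h, 'i) twofun" where
  "comp_twofun G F = \<lparr>on0 = on0 G \<circ> on0 F, on1 = on1 G \<circ> on1 F, on2 = on2 G \<circ> on2 F\<rparr>"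

definition two_natural ::
  "('a, 'b, 'c) twocat \<Rightarrow> ('d, 'e, 'f) twocat \<Rightarrow> ('a, 'b, 'c, 'd, 'e, 'f) twofun \<Rightarrow>
   ('a, 'b, 'c, 'd, 'e, 'f) twofun \<Rightarrow> ('a \<Rightarrow> 'e) \<Rightarrow> bool" where
  "two_natural K L F G \<theta> \<longleftrightarrow> two_functor K L F \<and> two_functor K L G \<and>
     (\<forall>A\<in>Cells0 K. \<theta> A \<in> Cells1 L \<and> src1 L (\<theta> A) = on0 F A \<and> tgt1 L (\<theta> A) = on0 G A) \<and>
     (\<forall>f\<in>Cells1 K.
        comp1 L (on1 G f) (\<theta> (src1 K f)) = comp1 L (\<theta> (tgt1 K f)) (on1 F f)) \<and>
     (\<forall>\<alpha>\<in>Cells2 K.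
        hcomp L (on2 G \<alpha>) (one2 L (\<theta> (src1 K (src2 K \<alpha>)))) =
        hcomp L (one2 L (\<theta> (tgt1 K (src2 K \<alpha>)))) (on2 F \<alpha>))"

definition two_natural_iso ::
  "('a, 'b, 'c) twocat \<Rightarrow> ('d, 'e, 'f) twocat \<Rightarrow> ('a, 'b, 'c, 'd, 'e, 'f) twofun \<Rightarrow>
   ('a, 'b, 'c, 'd, 'e, 'f) twofun \<Rightarrow> ('a \<Rightarrow> 'e) \<Rightarrow> bool" where
  "two_natural_iso K L F G \<theta> \<longleftrightarrow> two_natural K L F G \<theta> \<and> (\<forall>A\<in>Cells0 K. iso1 L (\<theta> A))"

definition two_adjunction ::
  "('a, 'b, 'c) twocat \<Rightarrow> ('d, 'e, 'f) twocat \<Rightarrow> ('a, 'b, 'c, 'd, 'e, 'f) twofun \<Rightarrow>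
   ('d, 'e, 'f, 'a, 'b, 'c) twofun \<Rightarrow> ('a \<Rightarrow> 'b) \<Rightarrow> ('d \<Rightarrow> 'e) \<Rightarrow> bool" where
  "two_adjunction K L F G \<eta> \<epsilon> \<longleftrightarrow>
     two_functor K L F \<and> two_functor L K G \<and>
     two_natural K K id_twofun (comp_twofun G F) \<eta> \<and>
     two_natural L L (comp_twofun F G) id_twofun \<epsilon> \<and>
     (\<forall>A\<in>Cells0 K. comp1 L (\<epsilon> (on0 F A)) (on1 F (\<eta> A)) = one1 L (on0 F A)) \<and>
     (\<forall>X\<in>Cells0 L. comp1 K (on1 G (\<epsilon> X)) (\<eta> (on0 G X)) = one1 K (on0 G X))"

definition two_equivalence ::
  "('a, 'b, 'c) twocat \<Rightarrow> ('d, 'e, 'f) twocat \<Rightarrow> ('a, 'b, 'c, 'd, 'e, 'f) twofun \<Rightarrow>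
   ('d, 'e, 'f, 'a, 'b, 'c) twofun \<Rightarrow> ('a \<Rightarrow> 'b) \<Rightarrow> ('d \<Rightarrow> 'e) \<Rightarrow> bool" where
  "two_equivalence K L F G \<eta> \<epsilon> \<longleftrightarrow>
     two_functor K L F \<and> two_functor L K G \<and>
     two_natural_iso K K id_twofun (comp_twofun G F) \<eta> \<and>
     two_natural_iso L L (comp_twofun F G) id_twofun \<epsilon>"

section \<open>2-categories of structured categories\<close>

text \<open>A structured category is a pair of a category and some structure on it. The 1-cells and 2-cells
  carry their source and target.\<close>

record ('o, 'm, 's) onecell =
  Src :: "('o, 'm) cat \<times> 's"
  Tgt :: "('o, 'm) cat \<times> 's"
  OMap :: "'o \<Rightarrow> 'o"
  AMap :: "'m \<Rightarrow> 'm"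

record ('o, 'm, 's) twocell =
  Src2 :: "('o, 'm, 's) onecell"
  Tgt2 :: "('o, 'm, 's) onecell"
  Cpt :: "'o \<Rightarrow> 'm"

type_synonym ('o, 'm, 's) struct_2cat =
  "(('o, 'm) cat \<times> 's, ('o, 'm, 's) onecell, ('o, 'm, 's) twocell) twocat"

definition functor_cell :: "('o, 'm, 's) onecell \<Rightarrow> bool" where
  "functor_cell F \<longleftrightarrow> is_functor (fst (Src F)) (fst (Tgt F)) (OMap F) (AMap F)"

definition nat_cell :: "('o, 'm, 's) twocell \<Rightarrow> bool" where
  "nat_cell \<alpha> \<longleftrightarrow>
     (let F = Src2 \<alpha>; G = Tgt2 \<alpha>; C = fst (Src F); D = fst (Tgt F) in
        functor_cell F \<and> functor_cell G \<and> Src G = Src F \<and> Tgt G = Tgt F \<and>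
        Cpt \<alpha> \<in> extensional (Obj C) \<and>
        (\<forall>A\<in>Obj C. Cpt \<alpha> A \<in> hom D (OMap F A) (OMap G A)) \<and>
        (\<forall>f\<in>Arr C. Cpt \<alpha> (Cod C f) \<cdot>\<^bsub>D\<^esub> AMap F f = AMap G f \<cdot>\<^bsub>D\<^esub> Cpt \<alpha> (Dom C f)))"

definition id_cell :: "('o, 'm) cat \<times> 's \<Rightarrow> ('o, 'm, 's) onecell" where
  "id_cell K = \<lparr>Src = K, Tgt = K, OMap = (\<lambda>A\<in>Obj (fst K). A), AMap = (\<lambda>f\<in>Arr (fst K). f)\<rparr>"

definition comp_cell ::
  "('o, 'm, 's) onecell \<Rightarrow> ('o, 'm, 's) onecell \<Rightarrow> ('o, 'm, 's) onecell" where
  "comp_cell G F = \<lparr>Src = Src F, Tgt = Tgt G,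
     OMap = compose (Obj (fst (Src F))) (OMap G) (OMap F),
     AMap = compose (Arr (fst (Src F))) (AMap G) (AMap F)\<rparr>"

definition id_nat :: "('o, 'm, 's) onecell \<Rightarrow> ('o, 'm, 's) twocell" where
  "id_nat F = \<lparr>Src2 = F, Tgt2 = F, Cpt = (\<lambda>A\<in>Obj (fst (Src F)). Idt (fst (Tgt F)) (OMap F A))\<rparr>"

definition vcomp_nat ::
  "('o, 'm, 's) twocell \<Rightarrow> ('o, 'm, 's) twocell \<Rightarrow> ('o, 'm, 's) twocell" where
  "vcomp_nat \<beta> \<alpha> = \<lparr>Src2 = Src2 \<alpha>, Tgt2 = Tgt2 \<beta>,
     Cpt = (\<lambda>A\<in>Obj (fst (Src (Src2 \<alpha>))). Cpt \<beta> A \<cdot>\<^bsub>fst (Tgt (Src2 \<alpha>))\<^esub> Cpt \<alpha> A)\<rparr>"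

definition hcomp_nat ::
  "('o, 'm, 's) twocell \<Rightarrow> ('o, 'm, 's) twocell \<Rightarrow> ('o, 'm, 's) twocell" where
  "hcomp_nat \<beta> \<alpha> =
     \<lparr>Src2 = comp_cell (Src2 \<beta>) (Src2 \<alpha>), Tgt2 = comp_cell (Tgt2 \<beta>) (Tgt2 \<alpha>),
      Cpt = (\<lambda>A\<in>Obj (fst (Src (Src2 \<alpha>))).
        Cpt \<beta> (OMap (Tgt2 \<alpha>) A) \<cdot>\<^bsub>fst (Tgt (Src2 \<beta>))\<^esub> AMap (Src2 \<beta>) (Cpt \<alpha> A))\<rparr>"

definition struct_twocat ::
  "(('o, 'm) cat \<times> 's) set \<Rightarrow> ('o, 'm, 's) onecell set \<Rightarrow> ('o, 'm, 's) twocell set \<Rightarrow>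
   ('o, 'm, 's) struct_2cat" where
  "struct_twocat Ks Fs As =
     \<lparr>Cells0 = Ks, Cells1 = Fs, Cells2 = As,
      src1 = Src, tgt1 = Tgt, one1 = id_cell, comp1 = comp_cell,
      src2 = Src2, tgt2 = Tgt2, one2 = id_nat, vcomp = vcomp_nat, hcomp = hcomp_nat\<rparr>"

subsection \<open>Stably structured categories\<close>

definition stable_cat :: "('o, 'm) cat \<times> 'm set \<Rightarrow> bool" where
  "stable_cat K \<longleftrightarrow>
     (let C = fst K; S = snd K in
        category C \<and> S \<subseteq> Arr C \<and> (\<forall>f. iso_arr C f \<longrightarrow> f \<in> S) \<and>
        (\<forall>s\<in>S. \<forall>t\<in>S. Cod C s = Dom C t \<longrightarrow> t \<cdot>\<^bsub>C\<^esub> s \<in> S) \<and>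
        (\<forall>s\<in>S. \<forall>f\<in>Arr C. Cod C f = Cod C s \<longrightarrow> (\<exists>s' f'. pullback C f s s' f')) \<and>
        (\<forall>s\<in>S. \<forall>f s' f'. pullback C f s s' f' \<longrightarrow> s' \<in> S))"

definition stable_functor :: "('o, 'm, 'm set) onecell \<Rightarrow> bool" where
  "stable_functor F \<longleftrightarrow>
     stable_cat (Src F) \<and> stable_cat (Tgt F) \<and> functor_cell F \<and>
     AMap F ` snd (Src F) \<subseteq> snd (Tgt F) \<and>
     (\<forall>s\<in>snd (Src F). \<forall>f s' f'. pullback (fst (Src F)) f s s' f' \<longrightarrow>
        pullback (fst (Tgt F)) (AMap F f) (AMap F s) (AMap F s') (AMap F f'))"

definition stable_nat :: "('o, 'm, 'm set) twocell \<Rightarrow> bool" where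
  "stable_nat \<alpha> \<longleftrightarrow>
     stable_functor (Src2 \<alpha>) \<and> stable_functor (Tgt2 \<alpha>) \<and> nat_cell \<alpha> \<and>
     (let F = Src2 \<alpha>; G = Tgt2 \<alpha>; C = fst (Src F); D = fst (Tgt F) in
        \<forall>s\<in>snd (Src F).
          pullback D (Cpt \<alpha> (Cod C s)) (AMap G s) (AMap F s) (Cpt \<alpha> (Dom C s)))"

definition StableCat :: "('o, 'm, 'm set) struct_2cat" where
  "StableCat = struct_twocat {K. stable_cat K} {F. stable_functor F} {\<alpha>. stable_nat \<alpha>}"

definition StableCat_mono :: "('o, 'm, 'm set) struct_2cat" where
  "StableCat_mono = full_sub StableCat {(C, S). \<forall>s\<in>S. mono_arr C s}"

subsection \<open>Split restriction categories\<close>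

definition restriction_cat :: "('o, 'm) cat \<times> ('m \<Rightarrow> 'm) \<Rightarrow> bool" where
  "restriction_cat X \<longleftrightarrow>
     (let C = fst X; r = snd X in
        category C \<and> r \<in> extensional (Arr C) \<and>
        (\<forall>f\<in>Arr C. r f \<in> hom C (Dom C f) (Dom C f)) \<and>
        (\<forall>f\<in>Arr C. f \<cdot>\<^bsub>C\<^esub> r f = f) \<and>
        (\<forall>f\<in>Arr C. \<forall>g\<in>Arr C. Dom C f = Dom C g \<longrightarrow> r f \<cdot>\<^bsub>C\<^esub> r g = r g \<cdot>\<^bsub>C\<^esub> r f) \<and>
        (\<forall>f\<in>Arr C. \<forall>g\<in>Arr C. Dom C f = Dom C g \<longrightarrow> r (g \<cdot>\<^bsub>C\<^esub> r f) = r g \<cdot>\<^bsub>C\<^esub> r f) \<and>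
        (\<forall>f\<in>Arr C. \<forall>g\<in>Arr C. Cod C f = Dom C g \<longrightarrow>
           r g \<cdot>\<^bsub>C\<^esub> f = f \<cdot>\<^bsub>C\<^esub> r (g \<cdot>\<^bsub>C\<^esub> f)))"

definition split_restriction_cat :: "('o, 'm) cat \<times> ('m \<Rightarrow> 'm) \<Rightarrow> bool" where
  "split_restriction_cat X \<longleftrightarrow> restriction_cat X \<and>
     (let C = fst X in \<forall>e\<in>Arr C. snd X e = e \<longrightarrow>
        (\<exists>m\<in>Arr C. \<exists>q\<in>Arr C. Cod C q = Dom C m \<and> Cod C m = Dom C q \<and>
           e = m \<cdot>\<^bsub>C\<^esub> q \<and> q \<cdot>\<^bsub>C\<^esub> m = Idt C (Dom C m)))"

definition total_arr :: "('o, 'm) cat \<times> ('m \<Rightarrow> 'm) \<Rightarrow> 'm \<Rightarrow> bool" where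
  "total_arr X f \<longleftrightarrow> f \<in> Arr (fst X) \<and> snd X f = Idt (fst X) (Dom (fst X) f)"

definition restricted_inverse :: "('o, 'm) cat \<times> ('m \<Rightarrow> 'm) \<Rightarrow> 'm \<Rightarrow> 'm \<Rightarrow> bool" where
  "restricted_inverse X i j \<longleftrightarrow>
     (let C = fst X in i \<in> Arr C \<and> j \<in> hom C (Cod C i) (Dom C i) \<and>
        j \<cdot>\<^bsub>C\<^esub> i = snd X i \<and> i \<cdot>\<^bsub>C\<^esub> j = snd X j)"

definition restricted_iso :: "('o, 'm) cat \<times> ('m \<Rightarrow> 'm) \<Rightarrow> 'm \<Rightarrow> bool" where
  "restricted_iso X i \<longleftrightarrow> (\<exists>j. restricted_inverse X i j)"

definition rinv :: "('o, 'm) cat \<times> ('m \<Rightarrow> 'm) \<Rightarrow> 'm \<Rightarrow> 'm" where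
  "rinv X i = (THE j. restricted_inverse X i j)"

definition restriction_functor :: "('o, 'm, 'm \<Rightarrow> 'm) onecell \<Rightarrow> bool" where
  "restriction_functor F \<longleftrightarrow>
     split_restriction_cat (Src F) \<and> split_restriction_cat (Tgt F) \<and> functor_cell F \<and>
     (\<forall>f\<in>Arr (fst (Src F)). AMap F (snd (Src F) f) = snd (Tgt F) (AMap F f))"

definition total_nat :: "('o, 'm, 'm \<Rightarrow> 'm) twocell \<Rightarrow> bool" where
  "total_nat \<alpha> \<longleftrightarrow>
     restriction_functor (Src2 \<alpha>) \<and> restriction_functor (Tgt2 \<alpha>) \<and> nat_cell \<alpha> \<and>
     (\<forall>A\<in>Obj (fst (Src (Src2 \<alpha>))). total_arr (Tgt (Src2 \<alpha>)) (Cpt \<alpha> A))"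

definition SplitRestCat :: "('o, 'm, 'm \<Rightarrow> 'm) struct_2cat" where
  "SplitRestCat =
     struct_twocat {X. split_restriction_cat X} {F. restriction_functor F} {\<alpha>. total_nat \<alpha>}"

section \<open>The 2-functor Total\<close>

definition total_cat :: "('o, 'm) cat \<times> ('m \<Rightarrow> 'm) \<Rightarrow> ('o, 'm) cat" where
  "total_cat X =
     (let C = fst X; T = {f. total_arr X f} in
        \<lparr>Obj = Obj C, Arr = T, Dom = restrict (Dom C) T, Cod = restrict (Cod C) T, Idt = Idt C,
         Cmp = (\<lambda>g f. if f \<in> T \<and> g \<in> T \<and> Cod C f = Dom C g then g \<cdot>\<^bsub>C\<^esub> f else undefined)\<rparr>)"

definition Total0 :: "('o, 'm) cat \<times> ('m \<Rightarrow> 'm) \<Rightarrow> ('o, 'm) cat \<times> 'm set" where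
  "Total0 X = (total_cat X, {f. total_arr X f \<and> restricted_iso X f})"

definition Total1 :: "('o, 'm, 'm \<Rightarrow> 'm) onecell \<Rightarrow> ('o, 'm, 'm set) onecell" where
  "Total1 F = \<lparr>Src = Total0 (Src F), Tgt = Total0 (Tgt F), OMap = OMap F,
     AMap = restrict (AMap F) {f. total_arr (Src F) f}\<rparr>"

definition Total2 :: "('o, 'm, 'm \<Rightarrow> 'm) twocell \<Rightarrow> ('o, 'm, 'm set) twocell" where
  "Total2 \<alpha> = \<lparr>Src2 = Total1 (Src2 \<alpha>), Tgt2 = Total1 (Tgt2 \<alpha>), Cpt = Cpt \<alpha>\<rparr>"

type_synonym ('o, 'm) total_twofun =
  "(('o, 'm) cat \<times> ('m \<Rightarrow> 'm), ('o, 'm, 'm \<Rightarrow> 'm) onecell, ('o, 'm, 'm \<Rightarrow> 'm) twocell,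
    ('o, 'm) cat \<times> 'm set, ('o, 'm, 'm set) onecell, ('o, 'm, 'm set) twocell) twofun"

definition TotalF :: "('o, 'm) total_twofun" where
  "TotalF = \<lparr>on0 = Total0, on1 = Total1, on2 = Total2\<rparr>"

section \<open>Spans\<close>

text \<open>A span \<open>(s, f)\<close> goes from \<open>Cod s\<close> to \<open>Cod f\<close>; its endpoints are determined by its legs.\<close>

definition spans :: "('o, 'm) cat \<times> 'm set \<Rightarrow> ('m \<times> 'm) set" where
  "spans K = {(s, f). s \<in> snd K \<and> f \<in> Arr (fst K) \<and> Dom (fst K) s = Dom (fst K) f}"

definition span_mor :: "('o, 'm) cat \<times> 'm set \<Rightarrow> 'm \<times> 'm \<Rightarrow> 'm \<Rightarrow> 'm \<times> 'm \<Rightarrow> bool" where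
  "span_mor K p x q \<longleftrightarrow>
     p \<in> spans K \<and> q \<in> spans K \<and>
     x \<in> hom (fst K) (Dom (fst K) (fst p)) (Dom (fst K) (fst q)) \<and>
     fst q \<cdot>\<^bsub>fst K\<^esub> x = fst p \<and> snd q \<cdot>\<^bsub>fst K\<^esub> x = snd p"

definition span_iso :: "('o, 'm) cat \<times> 'm set \<Rightarrow> 'm \<times> 'm \<Rightarrow> 'm \<times> 'm \<Rightarrow> bool" where
  "span_iso K p q \<longleftrightarrow> (\<exists>x. span_mor K p x q \<and> iso_arr (fst K) x)"

text \<open>\<open>cospan_mor K f s v g t\<close>: \<open>v\<close> is a morphism from the cospan \<open>\<langle>f, s\<rangle>\<close> to the cospan \<open>\<langle>g, t\<rangle>\<close>.
  A conjugate is taken with respect to any choice of pullbacks of the two cospans.\<close>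

definition cospan_mor :: "('o, 'm) cat \<times> 'm set \<Rightarrow> 'm \<Rightarrow> 'm \<Rightarrow> 'm \<Rightarrow> 'm \<Rightarrow> 'm \<Rightarrow> bool" where
  "cospan_mor K f s v g t \<longleftrightarrow>
     (let C = fst K in
        f \<in> Arr C \<and> s \<in> snd K \<and> Cod C f = Cod C s \<and>
        g \<in> Arr C \<and> t \<in> snd K \<and> Cod C g = Cod C t \<and>
        v \<in> hom C (Cod C s) (Cod C t) \<and> v \<cdot>\<^bsub>C\<^esub> f = g \<and> v \<cdot>\<^bsub>C\<^esub> s = t)"

definition conjugate :: "('o, 'm) cat \<times> 'm set \<Rightarrow> 'm \<Rightarrow> 'm \<Rightarrow> bool" where
  "conjugate K v u \<longleftrightarrow>
     (let C = fst K in \<exists>f s g t s' f' t' g'.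
        cospan_mor K f s v g t \<and> pullback C f s s' f' \<and> pullback C g t t' g' \<and>
        u \<in> hom C (Dom C s') (Dom C t') \<and> t' \<cdot>\<^bsub>C\<^esub> u = s' \<and> g' \<cdot>\<^bsub>C\<^esub> u = f')"

definition Sstar :: "('o, 'm) cat \<times> 'm set \<Rightarrow> 'm set" where
  "Sstar K = {x. \<exists>v\<in>snd K. \<exists>u h k. conjugate K v u \<and> pullback (fst K) h u x k}"

inductive zeq :: "('o, 'm) cat \<times> 'm set \<Rightarrow> 'm \<times> 'm \<Rightarrow> 'm \<times> 'm \<Rightarrow> bool" for K where
  base: "span_mor K p x q \<Longrightarrow> x \<in> Sstar K \<Longrightarrow> zeq K p q"
| refl: "p \<in> spans K \<Longrightarrow> zeq K p p"
| sym: "zeq K p q \<Longrightarrow> zeq K q p"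
| trans: "zeq K p q \<Longrightarrow> zeq K q r \<Longrightarrow> zeq K p r"

section \<open>Quotients of the category of spans\<close>

text \<open>The following constructions are parameterised by an equivalence relation \<open>R K\<close> on the spans of
  each \<open>K\<close>: \<^const>\<open>span_iso\<close> gives Span, and \<^const>\<open>zeq\<close> (which contains
  \<^const>\<open>span_iso\<close>, so that one may pass to the quotient in one step) gives Par.

  An equivalence class of spans has type \<^typ>\<open>('m \<times> 'm) set\<close>. For Par to be a 2-functor between
  2-categories over the same type \<open>'m\<close> of morphisms, classes are coded as elements of \<open>'m\<close>, by
  applying an injection \<^typ>\<open>'m \<times> 'm \<Rightarrow> 'm\<close> to a chosen member. When \<open>'m\<close> is infinite such an
  injection exists, and distinct classes receive distinct codes.\<close>

type_synonym ('o, 'm) span_rel =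
  "('o, 'm) cat \<times> 'm set \<Rightarrow> 'm \<times> 'm \<Rightarrow> 'm \<times> 'm \<Rightarrow> bool"

definition pair_code :: "'m \<times> 'm \<Rightarrow> 'm" where
  "pair_code = (SOME c. inj c)"

definition class_code :: "('m \<times> 'm) set \<Rightarrow> 'm" where
  "class_code c = pair_code (SOME p. p \<in> c)"

text \<open>\<open>span_arr R K (s, f)\<close> is the morphism \<open>[s, f]\<close>, and \<open>span_rep R K m\<close> is a span that
  represents the morphism \<open>m\<close>.\<close>

definition span_arr :: "('o, 'm) span_rel \<Rightarrow> ('o, 'm) cat \<times> 'm set \<Rightarrow> 'm \<times> 'm \<Rightarrow> 'm" where
  "span_arr R K p = class_code {q. R K p q}"

definition span_rep :: "('o, 'm) span_rel \<Rightarrow> ('o, 'm) cat \<times> 'm set \<Rightarrow> 'm \<Rightarrow> 'm \<times> 'm" where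
  "span_rep R K m = (SOME p. p \<in> spans K \<and> span_arr R K p = m)"

definition span_comp :: "('o, 'm) cat \<Rightarrow> 'm \<times> 'm \<Rightarrow> 'm \<times> 'm \<Rightarrow> 'm \<times> 'm" where
  "span_comp C q p =
     (case p of (s, f) \<Rightarrow> case q of (t, g) \<Rightarrow>
        case (SOME (t', f'). pullback C f t t' f') of (t', f') \<Rightarrow> (s \<cdot>\<^bsub>C\<^esub> t', g \<cdot>\<^bsub>C\<^esub> f'))"

definition span_cat :: "('o, 'm) span_rel \<Rightarrow> ('o, 'm) cat \<times> 'm set \<Rightarrow> ('o, 'm) cat" where
  "span_cat R K =
     (let C = fst K; M = span_arr R K ` spans K; rep = span_rep R K;
          dm = (\<lambda>m. Cod C (fst (rep m))); cd = (\<lambda>m. Cod C (snd (rep m))) in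
        \<lparr>Obj = Obj C, Arr = M, Dom = restrict dm M, Cod = restrict cd M,
         Idt = (\<lambda>A\<in>Obj C. span_arr R K (Idt C A, Idt C A)),
         Cmp = (\<lambda>n m. if m \<in> M \<and> n \<in> M \<and> cd m = dm n
                       then span_arr R K (span_comp C (rep n) (rep m)) else undefined)\<rparr>)"

definition SpanQ0 ::
  "('o, 'm) span_rel \<Rightarrow> ('o, 'm) cat \<times> 'm set \<Rightarrow> ('o, 'm) cat \<times> ('m \<Rightarrow> 'm)" where
  "SpanQ0 R K = (span_cat R K, \<lambda>m\<in>Arr (span_cat R K).
     case span_rep R K m of (s, f) \<Rightarrow> span_arr R K (s, s))"

definition SpanQ1 ::
  "('o, 'm) span_rel \<Rightarrow> ('o, 'm, 'm set) onecell \<Rightarrow> ('o, 'm, 'm \<Rightarrow> 'm) onecell" where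
  "SpanQ1 R F = \<lparr>Src = SpanQ0 R (Src F), Tgt = SpanQ0 R (Tgt F), OMap = OMap F,
     AMap = (\<lambda>m\<in>Arr (span_cat R (Src F)).
       case span_rep R (Src F) m of (s, f) \<Rightarrow> span_arr R (Tgt F) (AMap F s, AMap F f))\<rparr>"

definition SpanQ2 ::
  "('o, 'm) span_rel \<Rightarrow> ('o, 'm, 'm set) twocell \<Rightarrow> ('o, 'm, 'm \<Rightarrow> 'm) twocell" where
  "SpanQ2 R \<alpha> = \<lparr>Src2 = SpanQ1 R (Src2 \<alpha>), Tgt2 = SpanQ1 R (Tgt2 \<alpha>),
     Cpt = (\<lambda>A\<in>Obj (fst (Src (Src2 \<alpha>))).
       span_arr R (Tgt (Src2 \<alpha>)) (Idt (fst (Tgt (Src2 \<alpha>))) (OMap (Src2 \<alpha>) A), Cpt \<alpha> A))\<rparr>"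

type_synonym ('o, 'm) span_twofun =
  "(('o, 'm) cat \<times> 'm set, ('o, 'm, 'm set) onecell, ('o, 'm, 'm set) twocell,
    ('o, 'm) cat \<times> ('m \<Rightarrow> 'm), ('o, 'm, 'm \<Rightarrow> 'm) onecell, ('o, 'm, 'm \<Rightarrow> 'm) twocell) twofun"

definition SpanQF :: "('o, 'm) span_rel \<Rightarrow> ('o, 'm) span_twofun" where
  "SpanQF R = \<lparr>on0 = SpanQ0 R, on1 = SpanQ1 R, on2 = SpanQ2 R\<rparr>"

definition ParF :: "('o, 'm) span_twofun" where
  "ParF = SpanQF zeq"

definition SpanF :: "('o, 'm) span_twofun" where
  "SpanF = SpanQF span_iso"

section \<open>Unit, counit and the comparison of Span with Par\<close>

definition par_unit :: "('o, 'm) cat \<times> 'm set \<Rightarrow> ('o, 'm, 'm set) onecell" where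
  "par_unit K = \<lparr>Src = K, Tgt = on0 TotalF (on0 ParF K), OMap = (\<lambda>A\<in>Obj (fst K). A),
     AMap = (\<lambda>f\<in>Arr (fst K). span_arr zeq K (Idt (fst K) (Dom (fst K) f), f))\<rparr>"

definition par_counit :: "('o, 'm) cat \<times> ('m \<Rightarrow> 'm) \<Rightarrow> ('o, 'm, 'm \<Rightarrow> 'm) onecell" where
  "par_counit X = \<lparr>Src = on0 ParF (on0 TotalF X), Tgt = X, OMap = (\<lambda>A\<in>Obj (fst X). A),
     AMap = (\<lambda>m\<in>Arr (fst (on0 ParF (on0 TotalF X))).
       case span_rep zeq (on0 TotalF X) m of (s, f) \<Rightarrow> f \<cdot>\<^bsub>fst X\<^esub> rinv X s)\<rparr>"

definition span_to_par :: "('o, 'm) cat \<times> 'm set \<Rightarrow> ('o, 'm, 'm \<Rightarrow> 'm) onecell" where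
  "span_to_par K = \<lparr>Src = on0 SpanF K, Tgt = on0 ParF K, OMap = (\<lambda>A\<in>Obj (fst K). A),
     AMap = (\<lambda>m\<in>Arr (fst (on0 SpanF K)). span_arr zeq K (span_rep span_iso K m))\<rparr>"

end

theory Submission
  imports Defs
begin

text \<open>If the class \<open>S\<close> consists of monomorphisms, conjugates of \<open>S\<close>-morphisms are isomorphisms, so that
  \<open>S\<^sup>\<star>\<close> is the class of isomorphisms and Par coincides with Span. The unit then hits exactly the total
  maps of Par, and the restricted isomorphisms among them come from \<open>S\<close>. Conversely, if
  \<open>s \<cdot> a = s \<cdot> b\<close> for some \<open>s\<close> in \<open>S\<close>, both \<open>(1, a)\<close> and \<open>(1, b)\<close> map by conjugates of
  \<open>s\<close> to the same span, a pullback of \<open>s\<close> along \<open>s \<cdot> a\<close>; the unit thus identifies \<open>a\<close> and \<open>b\<close>,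
  and can be an isomorphism only if \<open>s\<close> is monic. The counit is bijective because every \<open>h\<close> is
  \<open>(h \<cdot> s) \<cdot> s\<^sup>-\<close> for a splitting \<open>s \<cdot> s\<^sup>-\<close> of its restriction, and \<open>h \<cdot> s\<close> is total.\<close>

section \<open>Categories, pullbacks and functors\<close>

text \<open>Two devices carry the argument. A span with monic left leg is traded for a set of pairs
  of arrows, its graph; composition of relations then replaces the choice of pullbacks, and two
  arrows of Par are equal as soon as their graphs are. On the other side, a total restricted
  isomorphism \<open>s\<close> is handled together with its restricted inverse \<open>j\<close>, so
  that a pullback of \<open>s\<close> along a total \<open>f\<close> is described by the equation
  \<open>rs j' = rs (j f)\<close>. Restriction functors and total transformations preserve such
  equations, which is why Total lands in \<open>StableCat\<close>, even in its monic part. Par is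
  defined for every stably structured category, but its 2-functoriality, the unit and the counit are
  treated over monic \<open>S\<close>. There \<open>zeq\<close> and \<open>span_iso\<close> are the
  same relation and yield literally the same cells, so facts about Par are proved for Span. For
  general \<open>S\<close> the unit is inspected as a map of arrows, and its injectivity is what
  forces \<open>S\<close> to be monic.\<close>

lemma category_simps [simp]:
  assumes "category C"
  shows "f \<in> Arr C \<Longrightarrow> Dom C f \<in> Obj C"
    and "f \<in> Arr C \<Longrightarrow> Cod C f \<in> Obj C"
    and "A \<in> Obj C \<Longrightarrow> Idt C A \<in> Arr C"
    and "A \<in> Obj C \<Longrightarrow> Dom C (Idt C A) = A"
    and "A \<in> Obj C \<Longrightarrow> Cod C (Idt C A) = A"
    and "f \<in> Arr C \<Longrightarrow> g \<in> Arr C \<Longrightarrow> Cod C f = Dom C g \<Longrightarrow> g \<cdot>\<^bsub>C\<^esub> f \<in> Arr C"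
    and "f \<in> Arr C \<Longrightarrow> g \<in> Arr C \<Longrightarrow> Cod C f = Dom C g \<Longrightarrow> Dom C (g \<cdot>\<^bsub>C\<^esub> f) = Dom C f"
    and "f \<in> Arr C \<Longrightarrow> g \<in> Arr C \<Longrightarrow> Cod C f = Dom C g \<Longrightarrow> Cod C (g \<cdot>\<^bsub>C\<^esub> f) = Cod C g"
    and "f \<in> Arr C \<Longrightarrow> Dom C f = A \<Longrightarrow> f \<cdot>\<^bsub>C\<^esub> Idt C A = f"
    and "f \<in> Arr C \<Longrightarrow> Cod C f = A \<Longrightarrow> Idt C A \<cdot>\<^bsub>C\<^esub> f = f"
  using assms unfolding category_def hom_def
  by (auto simp: PiE_iff split: if_splits)

lemma category_assoc:
  assumes "category C" "f \<in> Arr C" "g \<in> Arr C" "h \<in> Arr C"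
    "Cod C f = Dom C g" "Cod C g = Dom C h"
  shows "(h \<cdot>\<^bsub>C\<^esub> g) \<cdot>\<^bsub>C\<^esub> f = h \<cdot>\<^bsub>C\<^esub> (g \<cdot>\<^bsub>C\<^esub> f)"
  using assms unfolding category_def by (metis (no_types, lifting))

lemma category_extensional:
  assumes "category C"
  shows "Dom C \<in> extensional (Arr C)" "Cod C \<in> extensional (Arr C)" "Idt C \<in> extensional (Obj C)"
  using assms unfolding category_def by (auto simp: PiE_iff)

lemma categoryI:
  assumes "Dom C \<in> extensional (Arr C)" "Cod C \<in> extensional (Arr C)" "Idt C \<in> extensional (Obj C)"
    and "\<And>f. f \<in> Arr C \<Longrightarrow> Dom C f \<in> Obj C" "\<And>f. f \<in> Arr C \<Longrightarrow> Cod C f \<in> Obj C"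
    and "\<And>A. A \<in> Obj C \<Longrightarrow> Idt C A \<in> Arr C"
    and "\<And>A. A \<in> Obj C \<Longrightarrow> Dom C (Idt C A) = A" "\<And>A. A \<in> Obj C \<Longrightarrow> Cod C (Idt C A) = A"
    and "\<And>f g. \<not> (f \<in> Arr C \<and> g \<in> Arr C \<and> Cod C f = Dom C g) \<Longrightarrow> g \<cdot>\<^bsub>C\<^esub> f = undefined"
    and "\<And>f g. \<lbrakk>f \<in> Arr C; g \<in> Arr C; Cod C f = Dom C g\<rbrakk> \<Longrightarrow>
      g \<cdot>\<^bsub>C\<^esub> f \<in> Arr C \<and> Dom C (g \<cdot>\<^bsub>C\<^esub> f) = Dom C f \<and> Cod C (g \<cdot>\<^bsub>C\<^esub> f) = Cod C g"
    and "\<And>f. f \<in> Arr C \<Longrightarrow> f \<cdot>\<^bsub>C\<^esub> Idt C (Dom C f) = f"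
    and "\<And>f. f \<in> Arr C \<Longrightarrow> Idt C (Cod C f) \<cdot>\<^bsub>C\<^esub> f = f"
    and "\<And>f g h. \<lbrakk>f \<in> Arr C; g \<in> Arr C; h \<in> Arr C; Cod C f = Dom C g; Cod C g = Dom C h\<rbrakk> \<Longrightarrow>
      h \<cdot>\<^bsub>C\<^esub> (g \<cdot>\<^bsub>C\<^esub> f) = (h \<cdot>\<^bsub>C\<^esub> g) \<cdot>\<^bsub>C\<^esub> f"
  shows "category C"
  unfolding category_def hom_def using assms by (auto simp: PiE_iff)

lemma mono_arrD:
  assumes "mono_arr C m" "a \<in> Arr C" "b \<in> Arr C" "Dom C a = Dom C b"
    "Cod C a = Dom C m" "Cod C b = Dom C m" "m \<cdot>\<^bsub>C\<^esub> a = m \<cdot>\<^bsub>C\<^esub> b"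
  shows "a = b"
  using assms unfolding mono_arr_def by blast

section \<open>Isomorphisms and the calculus of pullback squares\<close>

lemma iso_arrI:
  assumes "f \<in> Arr C" "g \<in> Arr C" "Dom C g = Cod C f" "Cod C g = Dom C f"
    "g \<cdot>\<^bsub>C\<^esub> f = Idt C (Dom C f)" "f \<cdot>\<^bsub>C\<^esub> g = Idt C (Cod C f)"
  shows "iso_arr C f"
  using assms unfolding iso_arr_def hom_def by auto

lemma iso_arrE:
  assumes "iso_arr C f"
  obtains g where "f \<in> Arr C" "g \<in> Arr C" "Dom C g = Cod C f" "Cod C g = Dom C f"
    "g \<cdot>\<^bsub>C\<^esub> f = Idt C (Dom C f)" "f \<cdot>\<^bsub>C\<^esub> g = Idt C (Cod C f)"
  using assms unfolding iso_arr_def hom_def by auto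

lemma iso_arr_Idt: "category C \<Longrightarrow> A \<in> Obj C \<Longrightarrow> iso_arr C (Idt C A)"
  by (rule iso_arrI[where g = "Idt C A"]) auto

lemma pullbackD:
  assumes "pullback C f s s' f'"
  shows "f \<in> Arr C" "s \<in> Arr C" "s' \<in> Arr C" "f' \<in> Arr C"
    "Cod C s = Cod C f" "Dom C f' = Dom C s'" "Cod C s' = Dom C f" "Cod C f' = Dom C s"
    "f \<cdot>\<^bsub>C\<^esub> s' = s \<cdot>\<^bsub>C\<^esub> f'"
  using assms unfolding pullback_def by auto

lemma pullback_lift:
  assumes "pullback C f s s' f'" "a \<in> Arr C" "b \<in> Arr C" "Dom C a = Dom C b"
    "Cod C a = Dom C f" "Cod C b = Dom C s" "f \<cdot>\<^bsub>C\<^esub> a = s \<cdot>\<^bsub>C\<^esub> b"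
  obtains u where "u \<in> Arr C" "Dom C u = Dom C a" "Cod C u = Dom C s'"
    "s' \<cdot>\<^bsub>C\<^esub> u = a" "f' \<cdot>\<^bsub>C\<^esub> u = b"
  using assms unfolding pullback_def hom_def by (smt (verit) mem_Collect_eq)

text \<open>Both arrows mediate the cone with legs \<open>s' v\<close> and \<open>f' v\<close>, so
  the uniqueness half of the universal property identifies them.\<close>

lemma pullback_joint_mono:
  assumes "category C" "pullback C f s s' f'" "u \<in> Arr C" "v \<in> Arr C" "Dom C u = Dom C v"
    "Cod C u = Dom C s'" "Cod C v = Dom C s'"
    "s' \<cdot>\<^bsub>C\<^esub> u = s' \<cdot>\<^bsub>C\<^esub> v" "f' \<cdot>\<^bsub>C\<^esub> u = f' \<cdot>\<^bsub>C\<^esub> v"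
  shows "u = v"
proof -
  note [simp] = assms(1) pullbackD(1-8)[OF assms(2)]
  let ?a = "s' \<cdot>\<^bsub>C\<^esub> v" and ?b = "f' \<cdot>\<^bsub>C\<^esub> v"
  have eq: "f \<cdot>\<^bsub>C\<^esub> ?a = s \<cdot>\<^bsub>C\<^esub> ?b"
    using assms pullbackD[OF assms(2)] by (simp flip: category_assoc)
  have univ: "\<And>a b. a \<in> Arr C \<Longrightarrow> b \<in> Arr C \<Longrightarrow>
      Dom C a = Dom C b \<and> Cod C a = Dom C f \<and> Cod C b = Dom C s \<and> f \<cdot>\<^bsub>C\<^esub> a = s \<cdot>\<^bsub>C\<^esub> b \<Longrightarrow>
      \<exists>!w. w \<in> hom C (Dom C a) (Dom C s') \<and> s' \<cdot>\<^bsub>C\<^esub> w = a \<and> f' \<cdot>\<^bsub>C\<^esub> w = b"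
    using assms(2) unfolding pullback_def by blast
  have "\<exists>!w. w \<in> hom C (Dom C ?a) (Dom C s') \<and> s' \<cdot>\<^bsub>C\<^esub> w = ?a \<and> f' \<cdot>\<^bsub>C\<^esub> w = ?b"
    by (rule univ) (use assms(3-7) eq in simp_all)
  moreover have "u \<in> hom C (Dom C ?a) (Dom C s')" "v \<in> hom C (Dom C ?a) (Dom C s')"
    using assms(3-7) by (simp_all add: hom_def)
  ultimately show ?thesis using assms(8,9) by blast
qed

lemma pullback_comm_assoc:
  assumes "category C" "pullback C f s s' f'" "w \<in> Arr C" "Cod C w = Dom C s'"
  shows "f \<cdot>\<^bsub>C\<^esub> (s' \<cdot>\<^bsub>C\<^esub> w) = s \<cdot>\<^bsub>C\<^esub> (f' \<cdot>\<^bsub>C\<^esub> w)"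
  using assms pullbackD[OF assms(2)] by (simp flip: category_assoc)

text \<open>Uniqueness is asked as joint monicity of \<open>s'\<close> and \<open>f'\<close> instead
  of a unique existence statement, so that the two halves of the universal property become separate
  goals. Two mediators of one cone have the same composites with both projections, hence this form
  suffices.\<close>

lemma pullbackI:
  assumes "f \<in> Arr C" "s \<in> Arr C" "s' \<in> Arr C" "f' \<in> Arr C"
    "Cod C s = Cod C f" "Dom C f' = Dom C s'" "Cod C s' = Dom C f" "Cod C f' = Dom C s"
    "f \<cdot>\<^bsub>C\<^esub> s' = s \<cdot>\<^bsub>C\<^esub> f'"
    and "\<And>a b. \<lbrakk>a \<in> Arr C; b \<in> Arr C; Dom C a = Dom C b; Cod C a = Dom C f; Cod C b = Dom C s;
        f \<cdot>\<^bsub>C\<^esub> a = s \<cdot>\<^bsub>C\<^esub> b\<rbrakk> \<Longrightarrow>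
      \<exists>u\<in>Arr C. Dom C u = Dom C a \<and> Cod C u = Dom C s' \<and> s' \<cdot>\<^bsub>C\<^esub> u = a \<and> f' \<cdot>\<^bsub>C\<^esub> u = b"
    and "\<And>u v. \<lbrakk>u \<in> Arr C; v \<in> Arr C; Dom C u = Dom C v; Cod C u = Dom C s'; Cod C v = Dom C s';
        s' \<cdot>\<^bsub>C\<^esub> u = s' \<cdot>\<^bsub>C\<^esub> v; f' \<cdot>\<^bsub>C\<^esub> u = f' \<cdot>\<^bsub>C\<^esub> v\<rbrakk> \<Longrightarrow> u = v"
  shows "pullback C f s s' f'"
  unfolding pullback_def hom_def
proof (intro conjI ballI impI)
  fix a b assume "a \<in> Arr C" "b \<in> Arr C"
    "Dom C a = Dom C b \<and> Cod C a = Dom C f \<and> Cod C b = Dom C s \<and> f \<cdot>\<^bsub>C\<^esub> a = s \<cdot>\<^bsub>C\<^esub> b"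
  then obtain u where "u \<in> Arr C" "Dom C u = Dom C a" "Cod C u = Dom C s'"
    "s' \<cdot>\<^bsub>C\<^esub> u = a" "f' \<cdot>\<^bsub>C\<^esub> u = b"
    using assms(10) by blast
  then show "\<exists>!u. u \<in> {f \<in> Arr C. Dom C f = Dom C a \<and> Cod C f = Dom C s'} \<and>
      s' \<cdot>\<^bsub>C\<^esub> u = a \<and> f' \<cdot>\<^bsub>C\<^esub> u = b"
    by (intro ex1I[of _ u]) (auto intro!: assms(11))
qed (use assms in simp_all)

lemma pullback_Idt_left:
  assumes "category C" "s \<in> Arr C"
  shows "pullback C (Idt C (Cod C s)) s s (Idt C (Dom C s))"
  using assms by (intro pullbackI) auto

lemma pullback_Idt_right:
  assumes "category C" "f \<in> Arr C"
  shows "pullback C f (Idt C (Cod C f)) (Idt C (Dom C f)) f"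
  using assms by (intro pullbackI) auto

text \<open>A monomorphism has a trivial kernel pair. Among spans this square computes the composite
  of \<open>[1, s]\<close> followed by \<open>[s, 1]\<close> and makes it an identity.\<close>

lemma pullback_mono:
  assumes "category C" "mono_arr C s"
  shows "pullback C s s (Idt C (Dom C s)) (Idt C (Dom C s))"
proof -
  have s: "s \<in> Arr C" using assms by (simp add: mono_arr_def)
  show ?thesis
  proof (rule pullbackI)
    fix a b
    assume "a \<in> Arr C" "b \<in> Arr C" "Dom C a = Dom C b" "Cod C a = Dom C s" "Cod C b = Dom C s"
      "s \<cdot>\<^bsub>C\<^esub> a = s \<cdot>\<^bsub>C\<^esub> b"
    moreover from this have "a = b" by (intro mono_arrD[OF assms(2), of a b])
    ultimately show "\<exists>u\<in>Arr C. Dom C u = Dom C a \<and> Cod C u = Dom C (Idt C (Dom C s)) \<and>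
        Idt C (Dom C s) \<cdot>\<^bsub>C\<^esub> u = a \<and> Idt C (Dom C s) \<cdot>\<^bsub>C\<^esub> u = b"
      using s assms(1) by (intro bexI[of _ a]) auto
  qed (use s assms(1) in auto)
qed

text \<open>A cone over the outer rectangle is lifted in two stages, through the square of
  \<open>f\<close> and then through that of \<open>g\<close>. Vertical and horizontal composites of
  stable transformations are stable by this pasting.\<close>

lemma pullback_paste:
  assumes [simp]: "category C" and 1: "pullback C f s s' f'" and 2: "pullback C g s' s'' g'"
  shows "pullback C (f \<cdot>\<^bsub>C\<^esub> g) s s'' (f' \<cdot>\<^bsub>C\<^esub> g')"
proof -
  have [simp]: "Cod C g = Dom C f"
    using pullbackD(7)[OF 1] pullbackD(5)[OF 2] by simp
  note [simp] = pullbackD(1-8)[OF 1] pullbackD(1-4,6-8)[OF 2] category_assoc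
  show ?thesis
  proof (rule pullbackI)
    show "(f \<cdot>\<^bsub>C\<^esub> g) \<cdot>\<^bsub>C\<^esub> s'' = s \<cdot>\<^bsub>C\<^esub> (f' \<cdot>\<^bsub>C\<^esub> g')"
      using pullbackD(9)[OF 2] by (simp add: pullback_comm_assoc[OF _ 1])
  next
    fix a b
    assume [simp]: "a \<in> Arr C" "b \<in> Arr C" "Dom C a = Dom C b" "Cod C a = Dom C (f \<cdot>\<^bsub>C\<^esub> g)"
      "Cod C b = Dom C s" and eq: "(f \<cdot>\<^bsub>C\<^esub> g) \<cdot>\<^bsub>C\<^esub> a = s \<cdot>\<^bsub>C\<^esub> b"
    obtain v where [simp]: "v \<in> Arr C" "Dom C v = Dom C (g \<cdot>\<^bsub>C\<^esub> a)" "Cod C v = Dom C s'"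
      and v: "s' \<cdot>\<^bsub>C\<^esub> v = g \<cdot>\<^bsub>C\<^esub> a" "f' \<cdot>\<^bsub>C\<^esub> v = b"
      by (rule pullback_lift[OF 1, of "g \<cdot>\<^bsub>C\<^esub> a" b]) (use eq in auto)
    obtain u where "u \<in> Arr C" "Dom C u = Dom C a" "Cod C u = Dom C s''"
      "s'' \<cdot>\<^bsub>C\<^esub> u = a" "g' \<cdot>\<^bsub>C\<^esub> u = v"
      by (rule pullback_lift[OF 2, of a v]) (use v in auto)
    with v show "\<exists>u\<in>Arr C. Dom C u = Dom C a \<and> Cod C u = Dom C s'' \<and> s'' \<cdot>\<^bsub>C\<^esub> u = a \<and>
        (f' \<cdot>\<^bsub>C\<^esub> g') \<cdot>\<^bsub>C\<^esub> u = b"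
      by (intro bexI[of _ u]) auto
  next
    fix u v
    assume [simp]: "u \<in> Arr C" "v \<in> Arr C" "Dom C u = Dom C v" "Cod C u = Dom C s''" "Cod C v = Dom C s''"
      and eq: "s'' \<cdot>\<^bsub>C\<^esub> u = s'' \<cdot>\<^bsub>C\<^esub> v" "(f' \<cdot>\<^bsub>C\<^esub> g') \<cdot>\<^bsub>C\<^esub> u = (f' \<cdot>\<^bsub>C\<^esub> g') \<cdot>\<^bsub>C\<^esub> v"
    have "g \<cdot>\<^bsub>C\<^esub> (s'' \<cdot>\<^bsub>C\<^esub> w) = s' \<cdot>\<^bsub>C\<^esub> (g' \<cdot>\<^bsub>C\<^esub> w)"
      if "w \<in> Arr C" "Cod C w = Dom C s''" for w
      using that by (simp add: pullback_comm_assoc[OF _ 2])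
    then have "s' \<cdot>\<^bsub>C\<^esub> (g' \<cdot>\<^bsub>C\<^esub> u) = s' \<cdot>\<^bsub>C\<^esub> (g' \<cdot>\<^bsub>C\<^esub> v)"
      using eq by (metis \<open>u \<in> Arr C\<close> \<open>v \<in> Arr C\<close> \<open>Cod C u = Dom C s''\<close> \<open>Cod C v = Dom C s''\<close>)
    then have "g' \<cdot>\<^bsub>C\<^esub> u = g' \<cdot>\<^bsub>C\<^esub> v"
      by (rule pullback_joint_mono[OF assms(1) 1, rotated -2]) (use eq in simp_all)
    then show "u = v" by (rule pullback_joint_mono[OF assms(1) 2, rotated -1]) (use eq in simp_all)
  qed auto
qed

text \<open>Each pair of projections is a cone for the other square. The comparison and its inverse
  are returned with all their equations, because a retraction is later transported along
  them.\<close>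

lemma pullback_unique_iso:
  assumes [simp]: "category C" and 1: "pullback C f s s1 f1" and 2: "pullback C f s s2 f2"
  obtains i k where "i \<in> Arr C" "Dom C i = Dom C s1" "Cod C i = Dom C s2"
    "k \<in> Arr C" "Dom C k = Dom C s2" "Cod C k = Dom C s1"
    "k \<cdot>\<^bsub>C\<^esub> i = Idt C (Dom C s1)" "i \<cdot>\<^bsub>C\<^esub> k = Idt C (Dom C s2)"
    "s2 \<cdot>\<^bsub>C\<^esub> i = s1" "f2 \<cdot>\<^bsub>C\<^esub> i = f1" "s1 \<cdot>\<^bsub>C\<^esub> k = s2" "f1 \<cdot>\<^bsub>C\<^esub> k = f2"
proof -
  note [simp] = pullbackD(1-8)[OF 1] pullbackD(1-8)[OF 2] category_assoc
  obtain i where i [simp]: "i \<in> Arr C" "Dom C i = Dom C s1" "Cod C i = Dom C s2"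
    "s2 \<cdot>\<^bsub>C\<^esub> i = s1" "f2 \<cdot>\<^bsub>C\<^esub> i = f1"
    by (rule pullback_lift[OF 2, of s1 f1]) (use pullbackD(9)[OF 1] in auto)
  obtain k where k [simp]: "k \<in> Arr C" "Dom C k = Dom C s2" "Cod C k = Dom C s1"
    "s1 \<cdot>\<^bsub>C\<^esub> k = s2" "f1 \<cdot>\<^bsub>C\<^esub> k = f2"
    by (rule pullback_lift[OF 1, of s2 f2]) (use pullbackD(9)[OF 2] in auto)
  have "s1 \<cdot>\<^bsub>C\<^esub> (k \<cdot>\<^bsub>C\<^esub> i) = s1" "f1 \<cdot>\<^bsub>C\<^esub> (k \<cdot>\<^bsub>C\<^esub> i) = f1"
    "s2 \<cdot>\<^bsub>C\<^esub> (i \<cdot>\<^bsub>C\<^esub> k) = s2" "f2 \<cdot>\<^bsub>C\<^esub> (i \<cdot>\<^bsub>C\<^esub> k) = f2"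
    by (simp_all del: category_assoc add: category_assoc[symmetric])
  then have "k \<cdot>\<^bsub>C\<^esub> i = Idt C (Dom C s1)" "i \<cdot>\<^bsub>C\<^esub> k = Idt C (Dom C s2)"
    using pullback_joint_mono[OF assms(1) 1, of "k \<cdot>\<^bsub>C\<^esub> i" "Idt C (Dom C s1)"]
      pullback_joint_mono[OF assms(1) 2, of "i \<cdot>\<^bsub>C\<^esub> k" "Idt C (Dom C s2)"] by simp_all
  then show thesis by (intro that[of i k]) auto
qed

section \<open>Functors, and transport of pullbacks along invertible functors\<close>

lemma is_functor_simps:
  assumes "is_functor C D Fo Fa"
  shows "category C" "category D" "A \<in> Obj C \<Longrightarrow> Fo A \<in> Obj D"
    "f \<in> Arr C \<Longrightarrow> Fa f \<in> Arr D" "f \<in> Arr C \<Longrightarrow> Dom D (Fa f) = Fo (Dom C f)"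
    "f \<in> Arr C \<Longrightarrow> Cod D (Fa f) = Fo (Cod C f)" "A \<in> Obj C \<Longrightarrow> Fa (Idt C A) = Idt D (Fo A)"
    "f \<in> Arr C \<Longrightarrow> g \<in> Arr C \<Longrightarrow> Cod C f = Dom C g \<Longrightarrow> Fa (g \<cdot>\<^bsub>C\<^esub> f) = Fa g \<cdot>\<^bsub>D\<^esub> Fa f"
    "Fo \<in> extensional (Obj C)" "Fa \<in> extensional (Arr C)"
  using assms unfolding is_functor_def by (auto simp: PiE_iff)

lemma is_functorI:
  assumes "category C" "category D" "Fo \<in> extensional (Obj C)" "Fa \<in> extensional (Arr C)"
    "\<And>A. A \<in> Obj C \<Longrightarrow> Fo A \<in> Obj D" "\<And>f. f \<in> Arr C \<Longrightarrow> Fa f \<in> Arr D"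
    "\<And>f. f \<in> Arr C \<Longrightarrow> Dom D (Fa f) = Fo (Dom C f)"
    "\<And>f. f \<in> Arr C \<Longrightarrow> Cod D (Fa f) = Fo (Cod C f)"
    "\<And>A. A \<in> Obj C \<Longrightarrow> Fa (Idt C A) = Idt D (Fo A)"
    "\<And>f g. f \<in> Arr C \<Longrightarrow> g \<in> Arr C \<Longrightarrow> Cod C f = Dom C g \<Longrightarrow>
      Fa (g \<cdot>\<^bsub>C\<^esub> f) = Fa g \<cdot>\<^bsub>D\<^esub> Fa f"
  shows "is_functor C D Fo Fa"
  using assms unfolding is_functor_def by (auto simp: PiE_iff)

lemma is_functor_iso_arr:
  assumes F: "is_functor C D Fo Fa" and f: "iso_arr C f"
  shows "iso_arr D (Fa f)"
proof -
  obtain g where g: "f \<in> Arr C" "g \<in> Arr C" "Dom C g = Cod C f" "Cod C g = Dom C f"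
    "g \<cdot>\<^bsub>C\<^esub> f = Idt C (Dom C f)" "f \<cdot>\<^bsub>C\<^esub> g = Idt C (Cod C f)"
    using f by (rule iso_arrE)
  note F = is_functor_simps[OF F]
  show ?thesis
    by (rule iso_arrI[where g = "Fa g"]) (use g F(1) in \<open>simp_all add: F(3-7) flip: F(8)\<close>)
qed

text \<open>A cone in \<open>D\<close> is carried to \<open>C\<close> by \<open>Ga\<close>, lifted
  there and carried back by \<open>Fa\<close>; an isomorphism of categories therefore preserves
  pullbacks.\<close>

lemma is_functor_inverse_pullback:
  assumes F: "is_functor C D Fo Fa" and G: "is_functor D C Go Ga"
    and GF: "\<And>f. f \<in> Arr C \<Longrightarrow> Ga (Fa f) = f" and FG: "\<And>g. g \<in> Arr D \<Longrightarrow> Fa (Ga g) = g"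
    and p: "pullback C f s s' f'"
  shows "pullback D (Fa f) (Fa s) (Fa s') (Fa f')"
proof -
  note F = is_functor_simps[OF F] and G = is_functor_simps[OF G]
  note [simp] = F(1,2,3-7) G(3-7) GF FG pullbackD(1-8)[OF p]
  \<comment> \<open>The hypotheses make the arrow maps mutually inverse. Objects are recovered as
    domains of identities, so the object maps are inverse as well.\<close>
  have Go: "Go (Fo A) = A" if "A \<in> Obj C" for A
  proof -
    have "Dom C (Ga (Fa (Idt C A))) = Go (Fo A)" using that by (simp del: F(7) GF)
    then show ?thesis using that by (simp del: F(7))
  qed
  have Fo: "Fo (Go A) = A" if "A \<in> Obj D" for A
  proof -
    have "Dom D (Fa (Ga (Idt D A))) = Fo (Go A)" using that by (simp del: G(7) FG)
    then show ?thesis using that by (simp del: G(7))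
  qed
  note [simp] = Go Fo
  have comp: "Fa g \<cdot>\<^bsub>D\<^esub> a = Fa (g \<cdot>\<^bsub>C\<^esub> Ga a)"
    if "g \<in> Arr C" "a \<in> Arr D" "Cod D a = Fo (Dom C g)" for g a
    using that by (simp add: F(8))
  have inj: "x = y" if "Fa x = Fa y" "x \<in> Arr C" "y \<in> Arr C" for x y
    using that GF by metis
  have inj': "x = y" if "Ga x = Ga y" "x \<in> Arr D" "y \<in> Arr D" for x y
    using that FG by metis
  show ?thesis
  proof (rule pullbackI)
    show "Fa f \<cdot>\<^bsub>D\<^esub> Fa s' = Fa s \<cdot>\<^bsub>D\<^esub> Fa f'"
      using pullbackD(9)[OF p] by (simp flip: F(8))
  next
    fix a b
    assume ab [simp]: "a \<in> Arr D" "b \<in> Arr D" "Dom D a = Dom D b" "Cod D a = Dom D (Fa f)"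
      "Cod D b = Dom D (Fa s)" and eq: "Fa f \<cdot>\<^bsub>D\<^esub> a = Fa s \<cdot>\<^bsub>D\<^esub> b"
    obtain u where [simp]: "u \<in> Arr C" "Dom C u = Dom C (Ga a)" "Cod C u = Dom C s'"
      and u: "s' \<cdot>\<^bsub>C\<^esub> u = Ga a" "f' \<cdot>\<^bsub>C\<^esub> u = Ga b"
      by (rule pullback_lift[OF p, of "Ga a" "Ga b"]) (use eq in \<open>auto simp: comp intro!: inj\<close>)
    show "\<exists>u\<in>Arr D. Dom D u = Dom D a \<and> Cod D u = Dom D (Fa s') \<and>
        Fa s' \<cdot>\<^bsub>D\<^esub> u = a \<and> Fa f' \<cdot>\<^bsub>D\<^esub> u = b"
      by (rule bexI[of _ "Fa u"]) (use u in \<open>simp_all flip: F(8)\<close>)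
  next
    fix u v
    assume [simp]: "u \<in> Arr D" "v \<in> Arr D" "Dom D u = Dom D v" "Cod D u = Dom D (Fa s')"
      "Cod D v = Dom D (Fa s')" and eq: "Fa s' \<cdot>\<^bsub>D\<^esub> u = Fa s' \<cdot>\<^bsub>D\<^esub> v" "Fa f' \<cdot>\<^bsub>D\<^esub> u = Fa f' \<cdot>\<^bsub>D\<^esub> v"
    have "s' \<cdot>\<^bsub>C\<^esub> Ga u = s' \<cdot>\<^bsub>C\<^esub> Ga v" "f' \<cdot>\<^bsub>C\<^esub> Ga u = f' \<cdot>\<^bsub>C\<^esub> Ga v"
      by (rule inj; use eq in \<open>simp add: F(8)\<close>)+
    then have "Ga u = Ga v"
      by (rule pullback_joint_mono[OF F(1) p, rotated -2]) simp_all
    then show "u = v" by (rule inj') auto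
  qed auto
qed

section \<open>2-categories of structured categories\<close>

abbreviation "SrcC F \<equiv> fst (Src F)"
abbreviation "TgtC F \<equiv> fst (Tgt F)"

lemma functor_cell_simps [simp]:
  assumes "functor_cell F"
  shows "category (SrcC F)" "category (TgtC F)"
    "A \<in> Obj (SrcC F) \<Longrightarrow> OMap F A \<in> Obj (TgtC F)"
    "f \<in> Arr (SrcC F) \<Longrightarrow> AMap F f \<in> Arr (TgtC F)"
    "f \<in> Arr (SrcC F) \<Longrightarrow> Dom (TgtC F) (AMap F f) = OMap F (Dom (SrcC F) f)"
    "f \<in> Arr (SrcC F) \<Longrightarrow> Cod (TgtC F) (AMap F f) = OMap F (Cod (SrcC F) f)"
    "A \<in> Obj (SrcC F) \<Longrightarrow> AMap F (Idt (SrcC F) A) = Idt (TgtC F) (OMap F A)"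
    "f \<in> Arr (SrcC F) \<Longrightarrow> g \<in> Arr (SrcC F) \<Longrightarrow>
      Cod (SrcC F) f = Dom (SrcC F) g \<Longrightarrow>
      AMap F (g \<cdot>\<^bsub>SrcC F\<^esub> f) = AMap F g \<cdot>\<^bsub>TgtC F\<^esub> AMap F f"
    "OMap F \<in> extensional (Obj (SrcC F))" "AMap F \<in> extensional (Arr (SrcC F))"
  using assms unfolding functor_cell_def by (simp_all add: is_functor_simps)

lemma functor_cellI:
  assumes "category (SrcC F)" "category (TgtC F)"
    "OMap F \<in> extensional (Obj (SrcC F))" "AMap F \<in> extensional (Arr (SrcC F))"
    "\<And>A. A \<in> Obj (SrcC F) \<Longrightarrow> OMap F A \<in> Obj (TgtC F)"
    "\<And>f. f \<in> Arr (SrcC F) \<Longrightarrow> AMap F f \<in> Arr (TgtC F)"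
    "\<And>f. f \<in> Arr (SrcC F) \<Longrightarrow> Dom (TgtC F) (AMap F f) = OMap F (Dom (SrcC F) f)"
    "\<And>f. f \<in> Arr (SrcC F) \<Longrightarrow> Cod (TgtC F) (AMap F f) = OMap F (Cod (SrcC F) f)"
    "\<And>A. A \<in> Obj (SrcC F) \<Longrightarrow> AMap F (Idt (SrcC F) A) = Idt (TgtC F) (OMap F A)"
    "\<And>f g. f \<in> Arr (SrcC F) \<Longrightarrow> g \<in> Arr (SrcC F) \<Longrightarrow>
      Cod (SrcC F) f = Dom (SrcC F) g \<Longrightarrow>
      AMap F (g \<cdot>\<^bsub>SrcC F\<^esub> f) = AMap F g \<cdot>\<^bsub>TgtC F\<^esub> AMap F f"
  shows "functor_cell F"
  unfolding functor_cell_def by (rule is_functorI) (use assms in auto)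

lemma onecell_eqI:
  fixes F G :: "('o, 'm, 's) onecell"
  assumes "functor_cell F" "functor_cell G" "Src F = Src G" "Tgt F = Tgt G"
    "\<And>A. A \<in> Obj (SrcC F) \<Longrightarrow> OMap F A = OMap G A"
    "\<And>f. f \<in> Arr (SrcC F) \<Longrightarrow> AMap F f = AMap G f"
  shows "F = G"
proof -
  have "OMap F = OMap G"
    by (rule extensionalityI[where A = "Obj (SrcC F)"])
      (use assms functor_cell_simps(9)[of F] functor_cell_simps(9)[of G] in auto)
  moreover have "AMap F = AMap G"
    by (rule extensionalityI[where A = "Arr (SrcC F)"])
      (use assms functor_cell_simps(10)[of F] functor_cell_simps(10)[of G] in auto)
  ultimately show ?thesis using assms(3,4) by (intro onecell.equality) auto
qed

text \<open>Typing facts about the target 1-cell are phrased over the source and target categories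
  of the source 1-cell. This fixes one normal form for the simplifier, which would otherwise meet
  \<open>Src (Tgt2 \<alpha>)\<close> and \<open>Src (Src2 \<alpha>)\<close> as different
  terms.\<close>

lemma nat_cell_simps:
  assumes "nat_cell \<alpha>"
  shows "functor_cell (Src2 \<alpha>)" "functor_cell (Tgt2 \<alpha>)"
    "Src (Tgt2 \<alpha>) = Src (Src2 \<alpha>)" "Tgt (Tgt2 \<alpha>) = Tgt (Src2 \<alpha>)"
    "Cpt \<alpha> \<in> extensional (Obj (SrcC (Src2 \<alpha>)))"
    "A \<in> Obj (SrcC (Src2 \<alpha>)) \<Longrightarrow> Cpt \<alpha> A \<in> Arr (TgtC (Src2 \<alpha>))"
    "A \<in> Obj (SrcC (Src2 \<alpha>)) \<Longrightarrow> Dom (TgtC (Src2 \<alpha>)) (Cpt \<alpha> A) = OMap (Src2 \<alpha>) A"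
    "A \<in> Obj (SrcC (Src2 \<alpha>)) \<Longrightarrow> Cod (TgtC (Src2 \<alpha>)) (Cpt \<alpha> A) = OMap (Tgt2 \<alpha>) A"
    "A \<in> Obj (SrcC (Src2 \<alpha>)) \<Longrightarrow> OMap (Tgt2 \<alpha>) A \<in> Obj (TgtC (Src2 \<alpha>))"
    "f \<in> Arr (SrcC (Src2 \<alpha>)) \<Longrightarrow> AMap (Tgt2 \<alpha>) f \<in> Arr (TgtC (Src2 \<alpha>))"
    "f \<in> Arr (SrcC (Src2 \<alpha>)) \<Longrightarrow>
      Dom (TgtC (Src2 \<alpha>)) (AMap (Tgt2 \<alpha>) f) = OMap (Tgt2 \<alpha>) (Dom (SrcC (Src2 \<alpha>)) f)"
    "f \<in> Arr (SrcC (Src2 \<alpha>)) \<Longrightarrow>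
      Cod (TgtC (Src2 \<alpha>)) (AMap (Tgt2 \<alpha>) f) = OMap (Tgt2 \<alpha>) (Cod (SrcC (Src2 \<alpha>)) f)"
proof -
  show *: "functor_cell (Src2 \<alpha>)" "functor_cell (Tgt2 \<alpha>)"
    "Src (Tgt2 \<alpha>) = Src (Src2 \<alpha>)" "Tgt (Tgt2 \<alpha>) = Tgt (Src2 \<alpha>)"
    "Cpt \<alpha> \<in> extensional (Obj (SrcC (Src2 \<alpha>)))"
    "A \<in> Obj (SrcC (Src2 \<alpha>)) \<Longrightarrow> Cpt \<alpha> A \<in> Arr (TgtC (Src2 \<alpha>))"
    "A \<in> Obj (SrcC (Src2 \<alpha>)) \<Longrightarrow> Dom (TgtC (Src2 \<alpha>)) (Cpt \<alpha> A) = OMap (Src2 \<alpha>) A"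
    "A \<in> Obj (SrcC (Src2 \<alpha>)) \<Longrightarrow> Cod (TgtC (Src2 \<alpha>)) (Cpt \<alpha> A) = OMap (Tgt2 \<alpha>) A"
    using assms unfolding nat_cell_def Let_def hom_def by auto
  show "A \<in> Obj (SrcC (Src2 \<alpha>)) \<Longrightarrow> OMap (Tgt2 \<alpha>) A \<in> Obj (TgtC (Src2 \<alpha>))"
    "f \<in> Arr (SrcC (Src2 \<alpha>)) \<Longrightarrow> AMap (Tgt2 \<alpha>) f \<in> Arr (TgtC (Src2 \<alpha>))"
    "f \<in> Arr (SrcC (Src2 \<alpha>)) \<Longrightarrow>
      Dom (TgtC (Src2 \<alpha>)) (AMap (Tgt2 \<alpha>) f) = OMap (Tgt2 \<alpha>) (Dom (SrcC (Src2 \<alpha>)) f)"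
    "f \<in> Arr (SrcC (Src2 \<alpha>)) \<Longrightarrow>
      Cod (TgtC (Src2 \<alpha>)) (AMap (Tgt2 \<alpha>) f) = OMap (Tgt2 \<alpha>) (Cod (SrcC (Src2 \<alpha>)) f)"
    using functor_cell_simps(3-6)[OF *(2)] by (auto simp: *(3,4))
qed

lemma nat_cell_natural:
  assumes "nat_cell \<alpha>" "f \<in> Arr (SrcC (Src2 \<alpha>))"
  shows "Cpt \<alpha> (Cod (SrcC (Src2 \<alpha>)) f) \<cdot>\<^bsub>TgtC (Src2 \<alpha>)\<^esub> AMap (Src2 \<alpha>) f =
    AMap (Tgt2 \<alpha>) f \<cdot>\<^bsub>TgtC (Src2 \<alpha>)\<^esub> Cpt \<alpha> (Dom (SrcC (Src2 \<alpha>)) f)"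
  using assms unfolding nat_cell_def Let_def by auto

lemma nat_cellI:
  assumes "functor_cell (Src2 \<alpha>)" "functor_cell (Tgt2 \<alpha>)"
    "Src (Tgt2 \<alpha>) = Src (Src2 \<alpha>)" "Tgt (Tgt2 \<alpha>) = Tgt (Src2 \<alpha>)"
    "Cpt \<alpha> \<in> extensional (Obj (SrcC (Src2 \<alpha>)))"
    "\<And>A. A \<in> Obj (SrcC (Src2 \<alpha>)) \<Longrightarrow> Cpt \<alpha> A \<in> Arr (TgtC (Src2 \<alpha>))"
    "\<And>A. A \<in> Obj (SrcC (Src2 \<alpha>)) \<Longrightarrow> Dom (TgtC (Src2 \<alpha>)) (Cpt \<alpha> A) = OMap (Src2 \<alpha>) A"
    "\<And>A. A \<in> Obj (SrcC (Src2 \<alpha>)) \<Longrightarrow> Cod (TgtC (Src2 \<alpha>)) (Cpt \<alpha> A) = OMap (Tgt2 \<alpha>) A"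
    "\<And>f. f \<in> Arr (SrcC (Src2 \<alpha>)) \<Longrightarrow>
      Cpt \<alpha> (Cod (SrcC (Src2 \<alpha>)) f) \<cdot>\<^bsub>TgtC (Src2 \<alpha>)\<^esub> AMap (Src2 \<alpha>) f =
      AMap (Tgt2 \<alpha>) f \<cdot>\<^bsub>TgtC (Src2 \<alpha>)\<^esub> Cpt \<alpha> (Dom (SrcC (Src2 \<alpha>)) f)"
  shows "nat_cell \<alpha>"
  unfolding nat_cell_def Let_def hom_def using assms by simp

lemma twocell_eqI:
  fixes \<alpha> \<beta> :: "('o, 'm, 's) twocell"
  assumes "nat_cell \<alpha>" "nat_cell \<beta>" "Src2 \<alpha> = Src2 \<beta>" "Tgt2 \<alpha> = Tgt2 \<beta>"
    "\<And>A. A \<in> Obj (SrcC (Src2 \<alpha>)) \<Longrightarrow> Cpt \<alpha> A = Cpt \<beta> A"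
  shows "\<alpha> = \<beta>"
proof -
  have "Cpt \<alpha> = Cpt \<beta>"
    by (rule extensionalityI[where A = "Obj (SrcC (Src2 \<alpha>))"])
      (use assms nat_cell_simps(5)[of \<alpha>] nat_cell_simps(5)[of \<beta>] in auto)
  then show ?thesis using assms(3,4) by (intro twocell.equality) auto
qed

section \<open>Identities and composites of 1-cells and 2-cells\<close>

lemma id_cell_simps [simp]:
  "Src (id_cell K) = K" "Tgt (id_cell K) = K"
  "A \<in> Obj (fst K) \<Longrightarrow> OMap (id_cell K) A = A"
  "f \<in> Arr (fst K) \<Longrightarrow> AMap (id_cell K) f = f"
  by (simp_all add: id_cell_def)

lemma comp_cell_simps [simp]:
  "Src (comp_cell G F) = Src F" "Tgt (comp_cell G F) = Tgt G"
  "A \<in> Obj (SrcC F) \<Longrightarrow> OMap (comp_cell G F) A = OMap G (OMap F A)"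
  "f \<in> Arr (SrcC F) \<Longrightarrow> AMap (comp_cell G F) f = AMap G (AMap F f)"
  by (simp_all add: comp_cell_def compose_def)

lemma id_nat_simps [simp]:
  "Src2 (id_nat F) = F" "Tgt2 (id_nat F) = F"
  "A \<in> Obj (SrcC F) \<Longrightarrow> Cpt (id_nat F) A = Idt (TgtC F) (OMap F A)"
  by (simp_all add: id_nat_def)

lemma vcomp_nat_simps [simp]:
  "Src2 (vcomp_nat \<beta> \<alpha>) = Src2 \<alpha>" "Tgt2 (vcomp_nat \<beta> \<alpha>) = Tgt2 \<beta>"
  "A \<in> Obj (SrcC (Src2 \<alpha>)) \<Longrightarrow>
    Cpt (vcomp_nat \<beta> \<alpha>) A = Cpt \<beta> A \<cdot>\<^bsub>TgtC (Src2 \<alpha>)\<^esub> Cpt \<alpha> A"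
  by (simp_all add: vcomp_nat_def)

lemma hcomp_nat_simps [simp]:
  "Src2 (hcomp_nat \<beta> \<alpha>) = comp_cell (Src2 \<beta>) (Src2 \<alpha>)"
  "Tgt2 (hcomp_nat \<beta> \<alpha>) = comp_cell (Tgt2 \<beta>) (Tgt2 \<alpha>)"
  "A \<in> Obj (SrcC (Src2 \<alpha>)) \<Longrightarrow> Cpt (hcomp_nat \<beta> \<alpha>) A =
    Cpt \<beta> (OMap (Tgt2 \<alpha>) A) \<cdot>\<^bsub>TgtC (Src2 \<beta>)\<^esub> AMap (Src2 \<beta>) (Cpt \<alpha> A)"
  by (simp_all add: hcomp_nat_def)

lemma functor_cell_id: "category (fst K) \<Longrightarrow> functor_cell (id_cell K)"
  by (rule functor_cellI) (auto simp: id_cell_def)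

lemma functor_cell_comp:
  assumes "functor_cell F" "functor_cell G" "Tgt F = Src G"
  shows "functor_cell (comp_cell G F)"
proof (rule functor_cellI)
  note [simp] = functor_cell_simps[OF assms(1), unfolded assms(3)] assms
  show "OMap (comp_cell G F) \<in> extensional (Obj (SrcC (comp_cell G F)))"
    "AMap (comp_cell G F) \<in> extensional (Arr (SrcC (comp_cell G F)))"
    by (simp_all add: comp_cell_def)
qed (use functor_cell_simps[OF assms(1), unfolded assms(3)] assms(2) in auto)

lemma nat_cell_id: "functor_cell F \<Longrightarrow> nat_cell (id_nat F)"
  by (rule nat_cellI) (auto simp: id_nat_def)

lemma nat_cell_vcomp:
  assumes a: "nat_cell \<alpha>" and b: "nat_cell \<beta>" and eq: "Tgt2 \<alpha> = Src2 \<beta>"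
  shows "nat_cell (vcomp_nat \<beta> \<alpha>)"
proof (rule nat_cellI)
  note [simp] = nat_cell_simps[OF a, unfolded eq] nat_cell_simps[OF b, folded eq, unfolded nat_cell_simps(3,4)[OF a], unfolded eq]
  note na = nat_cell_natural[OF a, unfolded eq] and nb = nat_cell_natural[OF b]
  let ?\<gamma> = "vcomp_nat \<beta> \<alpha>"
  show "Cpt ?\<gamma> \<in> extensional (Obj (SrcC (Src2 ?\<gamma>)))"
    by (simp add: vcomp_nat_def)
  fix f assume "f \<in> Arr (SrcC (Src2 ?\<gamma>))"
  then show "Cpt ?\<gamma> (Cod (SrcC (Src2 ?\<gamma>)) f) \<cdot>\<^bsub>TgtC (Src2 ?\<gamma>)\<^esub> AMap (Src2 ?\<gamma>) f =
      AMap (Tgt2 ?\<gamma>) f \<cdot>\<^bsub>TgtC (Src2 ?\<gamma>)\<^esub> Cpt ?\<gamma> (Dom (SrcC (Src2 ?\<gamma>)) f)"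
    using na[of f] nb[of f] functor_cell_simps(1,2)[of "Src2 \<alpha>"]
    by (simp add: category_assoc) (simp flip: category_assoc)
qed (use a b eq nat_cell_simps[OF a] nat_cell_simps[OF b] in auto)

lemma nat_cell_hcomp:
  assumes a: "nat_cell \<alpha>" and b: "nat_cell \<beta>" and eq: "Src (Src2 \<beta>) = Tgt (Src2 \<alpha>)"
  shows "nat_cell (hcomp_nat \<beta> \<alpha>)"
proof (rule nat_cellI)
  let ?\<gamma> = "hcomp_nat \<beta> \<alpha>"
  note A = nat_cell_simps[OF a] and B = nat_cell_simps[OF b, unfolded eq]
  note [simp] = A B functor_cell_simps[OF B(1), unfolded eq]
  show "functor_cell (Src2 ?\<gamma>)" "functor_cell (Tgt2 ?\<gamma>)"
    using eq by (auto intro!: functor_cell_comp)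
  show "Cpt ?\<gamma> \<in> extensional (Obj (SrcC (Src2 ?\<gamma>)))"
    by (simp add: hcomp_nat_def)
  fix f assume f [simp]: "f \<in> Arr (SrcC (Src2 ?\<gamma>))"
  note [simp] = f[simplified]
  \<comment> \<open>The naturality square of the composite is the image under
    \<open>Src2 \<beta>\<close> of the square of \<open>\<alpha>\<close> at \<open>f\<close>, pasted
    to the square of \<open>\<beta>\<close> at \<open>AMap (Tgt2 \<alpha>) f\<close>.\<close>
  have "AMap (Src2 \<beta>) (Cpt \<alpha> (Cod (SrcC (Src2 \<alpha>)) f)) \<cdot>\<^bsub>TgtC (Src2 \<beta>)\<^esub> AMap (Src2 \<beta>) (AMap (Src2 \<alpha>) f)
     = AMap (Src2 \<beta>) (AMap (Tgt2 \<alpha>) f) \<cdot>\<^bsub>TgtC (Src2 \<beta>)\<^esub> AMap (Src2 \<beta>) (Cpt \<alpha> (Dom (SrcC (Src2 \<alpha>)) f))"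
    using arg_cong[OF nat_cell_natural[OF a, of f], of "AMap (Src2 \<beta>)"] by simp
  moreover have "Cpt \<beta> (OMap (Tgt2 \<alpha>) (Cod (SrcC (Src2 \<alpha>)) f)) \<cdot>\<^bsub>TgtC (Src2 \<beta>)\<^esub> AMap (Src2 \<beta>) (AMap (Tgt2 \<alpha>) f)
     = AMap (Tgt2 \<beta>) (AMap (Tgt2 \<alpha>) f) \<cdot>\<^bsub>TgtC (Src2 \<beta>)\<^esub> Cpt \<beta> (OMap (Tgt2 \<alpha>) (Dom (SrcC (Src2 \<alpha>)) f))"
    using nat_cell_natural[OF b, of "AMap (Tgt2 \<alpha>) f"] by (simp add: eq)
  ultimately show "Cpt ?\<gamma> (Cod (SrcC (Src2 ?\<gamma>)) f) \<cdot>\<^bsub>TgtC (Src2 ?\<gamma>)\<^esub> AMap (Src2 ?\<gamma>) f =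
      AMap (Tgt2 ?\<gamma>) f \<cdot>\<^bsub>TgtC (Src2 ?\<gamma>)\<^esub> Cpt ?\<gamma> (Dom (SrcC (Src2 ?\<gamma>)) f)"
    by (simp add: category_assoc) (simp flip: category_assoc)
qed (use nat_cell_simps[OF a] nat_cell_simps[OF b, unfolded eq]
     functor_cell_simps[OF nat_cell_simps(1)[OF b], unfolded eq] in auto)

text \<open>2-naturality is stated with horizontal composites in which one factor is the identity
  2-cell of a 1-cell. One of the two factors of each component is then an identity, and a whiskered
  2-cell is left.\<close>

lemma hcomp_nat_whisker:
  assumes "nat_cell \<alpha>" "functor_cell F" "A \<in> Obj (SrcC (Src2 \<alpha>))" "Src F = Tgt (Src2 \<alpha>)"
  shows "Cpt (hcomp_nat (id_nat F) \<alpha>) A = AMap F (Cpt \<alpha> A)"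
  using nat_cell_simps[OF assms(1)] functor_cell_simps[OF assms(2), unfolded assms(4)] assms(2-)
  by simp

lemma hcomp_whisker_nat:
  assumes "nat_cell \<alpha>" "functor_cell F" "A \<in> Obj (SrcC F)" "Tgt F = Src (Src2 \<alpha>)"
  shows "Cpt (hcomp_nat \<alpha> (id_nat F)) A = Cpt \<alpha> (OMap F A)"
  using nat_cell_simps[OF assms(1)] functor_cell_simps[OF assms(2), unfolded assms(4)] assms(2-)
  by simp

lemma struct_twocat_simps [simp]:
  "Cells0 (struct_twocat Ks Fs As) = Ks" "Cells1 (struct_twocat Ks Fs As) = Fs"
  "Cells2 (struct_twocat Ks Fs As) = As" "src1 (struct_twocat Ks Fs As) = Src"
  "tgt1 (struct_twocat Ks Fs As) = Tgt" "one1 (struct_twocat Ks Fs As) = id_cell"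
  "comp1 (struct_twocat Ks Fs As) = comp_cell" "src2 (struct_twocat Ks Fs As) = Src2"
  "tgt2 (struct_twocat Ks Fs As) = Tgt2" "one2 (struct_twocat Ks Fs As) = id_nat"
  "vcomp (struct_twocat Ks Fs As) = vcomp_nat" "hcomp (struct_twocat Ks Fs As) = hcomp_nat"
  by (simp_all add: struct_twocat_def)

text \<open>The equational axioms hold for arbitrary functors and natural transformations between
  structured categories. An instance therefore has to supply the typing of its cells and their
  closure under identities and composites, and nothing else.\<close>

lemma two_category_struct:
  assumes K: "\<And>K. K \<in> Ks \<Longrightarrow> category (fst K)" "\<And>K. K \<in> Ks \<Longrightarrow> id_cell K \<in> Fs"
    and F: "\<And>F. F \<in> Fs \<Longrightarrow> functor_cell F" "\<And>F. F \<in> Fs \<Longrightarrow> Src F \<in> Ks" "\<And>F. F \<in> Fs \<Longrightarrow> Tgt F \<in> Ks"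
      "\<And>F G. F \<in> Fs \<Longrightarrow> G \<in> Fs \<Longrightarrow> Tgt F = Src G \<Longrightarrow> comp_cell G F \<in> Fs"
      "\<And>F. F \<in> Fs \<Longrightarrow> id_nat F \<in> As"
    and A: "\<And>\<alpha>. \<alpha> \<in> As \<Longrightarrow> nat_cell \<alpha>" "\<And>\<alpha>. \<alpha> \<in> As \<Longrightarrow> Src2 \<alpha> \<in> Fs" "\<And>\<alpha>. \<alpha> \<in> As \<Longrightarrow> Tgt2 \<alpha> \<in> Fs"
      "\<And>\<alpha> \<beta>. \<alpha> \<in> As \<Longrightarrow> \<beta> \<in> As \<Longrightarrow> Tgt2 \<alpha> = Src2 \<beta> \<Longrightarrow> vcomp_nat \<beta> \<alpha> \<in> As"
      "\<And>\<alpha> \<beta>. \<alpha> \<in> As \<Longrightarrow> \<beta> \<in> As \<Longrightarrow> Tgt (Src2 \<alpha>) = Src (Src2 \<beta>) \<Longrightarrow> hcomp_nat \<beta> \<alpha> \<in> As"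
  shows "two_category (struct_twocat Ks Fs As)"
proof -
  have unit1: "comp_cell f (id_cell (Src f)) = f" "comp_cell (id_cell (Tgt f)) f = f"
    if "functor_cell f" for f :: "('a, 'b, 'c) onecell"
    by (rule onecell_eqI; use that in \<open>auto intro!: functor_cell_comp functor_cell_id\<close>)+
  have assoc1: "comp_cell h (comp_cell g f) = comp_cell (comp_cell h g) f"
    if "functor_cell f" "functor_cell g" "functor_cell h" "Tgt f = Src g" "Tgt g = Src h"
    for f g h :: "('a, 'b, 'c) onecell"
    by (rule onecell_eqI; use that functor_cell_simps[OF that(1)] in \<open>auto intro!: functor_cell_comp\<close>)
  have unit2: "vcomp_nat \<alpha> (id_nat (Src2 \<alpha>)) = \<alpha>" "vcomp_nat (id_nat (Tgt2 \<alpha>)) \<alpha> = \<alpha>"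
    if "nat_cell \<alpha>" for \<alpha> :: "('a, 'b, 'c) twocell"
    by (rule twocell_eqI; use that nat_cell_simps[OF that] in
        \<open>auto intro!: nat_cell_vcomp nat_cell_id\<close>)+
  have hunit: "hcomp_nat \<alpha> (id_nat (id_cell (Src (Src2 \<alpha>)))) = \<alpha>"
    "hcomp_nat (id_nat (id_cell (Tgt (Src2 \<alpha>)))) \<alpha> = \<alpha>"
    if "nat_cell \<alpha>" for \<alpha> :: "('a, 'b, 'c) twocell"
    by (rule twocell_eqI; use that nat_cell_simps[OF that] unit1[of "Src2 \<alpha>"] unit1[of "Tgt2 \<alpha>"] in
        \<open>auto intro!: nat_cell_hcomp nat_cell_id functor_cell_id\<close>)+
  have assoc2: "vcomp_nat \<gamma> (vcomp_nat \<beta> \<alpha>) = vcomp_nat (vcomp_nat \<gamma> \<beta>) \<alpha>"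
    if a: "nat_cell \<alpha>" and b: "nat_cell \<beta>" and c: "nat_cell \<gamma>"
      and eq: "Tgt2 \<alpha> = Src2 \<beta>" "Tgt2 \<beta> = Src2 \<gamma>"
    for \<alpha> \<beta> \<gamma> :: "('a, 'b, 'c) twocell"
  proof (rule twocell_eqI)
    note A = nat_cell_simps[OF a, unfolded eq] and B = nat_cell_simps[OF b, unfolded eq]
      and C = nat_cell_simps[OF c, unfolded eq]
    show "nat_cell (vcomp_nat \<gamma> (vcomp_nat \<beta> \<alpha>))" "nat_cell (vcomp_nat (vcomp_nat \<gamma> \<beta>) \<alpha>)"
      using that by (auto intro!: nat_cell_vcomp)
    fix X assume "X \<in> Obj (SrcC (Src2 (vcomp_nat \<gamma> (vcomp_nat \<beta> \<alpha>))))"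
    then show "Cpt (vcomp_nat \<gamma> (vcomp_nat \<beta> \<alpha>)) X = Cpt (vcomp_nat (vcomp_nat \<gamma> \<beta>) \<alpha>) X"
      using A B C by (simp add: category_assoc functor_cell_simps(2)[OF A(1)])
  qed auto
  have assoch: "hcomp_nat \<gamma> (hcomp_nat \<beta> \<alpha>) = hcomp_nat (hcomp_nat \<gamma> \<beta>) \<alpha>"
    if a: "nat_cell \<alpha>" and b: "nat_cell \<beta>" and c: "nat_cell \<gamma>"
      and eq: "Src (Src2 \<beta>) = Tgt (Src2 \<alpha>)" "Src (Src2 \<gamma>) = Tgt (Src2 \<beta>)"
    for \<alpha> \<beta> \<gamma> :: "('a, 'b, 'c) twocell"
  proof (rule twocell_eqI)
    note A = nat_cell_simps[OF a] and B = nat_cell_simps[OF b, unfolded eq]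
      and C = nat_cell_simps[OF c, unfolded eq]
    note [simp] = A B C functor_cell_simps[OF B(1), unfolded eq] functor_cell_simps[OF C(1), unfolded eq]
      functor_cell_simps[OF B(2)] eq
    show "nat_cell (hcomp_nat \<gamma> (hcomp_nat \<beta> \<alpha>))" "nat_cell (hcomp_nat (hcomp_nat \<gamma> \<beta>) \<alpha>)"
      using that by (auto intro!: nat_cell_hcomp)
    show "Src2 (hcomp_nat \<gamma> (hcomp_nat \<beta> \<alpha>)) = Src2 (hcomp_nat (hcomp_nat \<gamma> \<beta>) \<alpha>)"
      "Tgt2 (hcomp_nat \<gamma> (hcomp_nat \<beta> \<alpha>)) = Tgt2 (hcomp_nat (hcomp_nat \<gamma> \<beta>) \<alpha>)"
      by (auto intro!: assoc1)
    fix X assume "X \<in> Obj (SrcC (Src2 (hcomp_nat \<gamma> (hcomp_nat \<beta> \<alpha>))))"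
    then show "Cpt (hcomp_nat \<gamma> (hcomp_nat \<beta> \<alpha>)) X = Cpt (hcomp_nat (hcomp_nat \<gamma> \<beta>) \<alpha>) X"
      by (simp add: category_assoc)
  qed
  have hid: "hcomp_nat (id_nat g) (id_nat f) = id_nat (comp_cell g f)"
    if "functor_cell f" "functor_cell g" "Src g = Tgt f" for f g :: "('a, 'b, 'c) onecell"
    by (rule twocell_eqI; use that functor_cell_simps[OF that(2), unfolded that(3)] in
        \<open>auto intro!: nat_cell_hcomp nat_cell_id functor_cell_comp\<close>)
  have interchange: "hcomp_nat (vcomp_nat \<beta>' \<beta>) (vcomp_nat \<alpha>' \<alpha>) =
      vcomp_nat (hcomp_nat \<beta>' \<alpha>') (hcomp_nat \<beta> \<alpha>)"
    if a: "nat_cell \<alpha>" and a': "nat_cell \<alpha>'" and b: "nat_cell \<beta>" and b': "nat_cell \<beta>'"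
      and eq: "Src2 \<alpha>' = Tgt2 \<alpha>" "Src2 \<beta>' = Tgt2 \<beta>" "Src (Src2 \<beta>) = Tgt (Src2 \<alpha>)"
    for \<alpha> \<alpha>' \<beta> \<beta>' :: "('a, 'b, 'c) twocell"
  proof (rule twocell_eqI)
    note A = nat_cell_simps[OF a] and B = nat_cell_simps[OF b, unfolded eq]
    note A' = nat_cell_simps[OF a', unfolded eq A(3,4)] and B' = nat_cell_simps[OF b', unfolded eq B(3,4)]
    note [simp] = A B A' B' functor_cell_simps[OF B(1), unfolded eq]
      functor_cell_simps[OF B(2), unfolded B(3)] eq
    show "nat_cell (hcomp_nat (vcomp_nat \<beta>' \<beta>) (vcomp_nat \<alpha>' \<alpha>))"
      "nat_cell (vcomp_nat (hcomp_nat \<beta>' \<alpha>') (hcomp_nat \<beta> \<alpha>))"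
      using that by (auto intro!: nat_cell_hcomp nat_cell_vcomp)
    fix X assume "X \<in> Obj (SrcC (Src2 (hcomp_nat (vcomp_nat \<beta>' \<beta>) (vcomp_nat \<alpha>' \<alpha>))))"
    then have [simp]: "X \<in> Obj (SrcC (Src2 \<alpha>))" by simp
    \<comment> \<open>Interchange is naturality of \<open>\<beta>\<close> at the component of
      \<open>\<alpha>'\<close>, which swaps the two middle factors of the fourfold
      composite.\<close>
    have "Cpt \<beta> (OMap (Tgt2 \<alpha>') X) \<cdot>\<^bsub>TgtC (Src2 \<beta>)\<^esub> AMap (Src2 \<beta>) (Cpt \<alpha>' X)
      = AMap (Tgt2 \<beta>) (Cpt \<alpha>' X) \<cdot>\<^bsub>TgtC (Src2 \<beta>)\<^esub> Cpt \<beta> (OMap (Tgt2 \<alpha>) X)"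
      using nat_cell_natural[OF b, of "Cpt \<alpha>' X"] by simp
    moreover have "Cpt \<beta> (OMap (Tgt2 \<alpha>') X) \<cdot>\<^bsub>TgtC (Src2 \<beta>)\<^esub>
        (AMap (Src2 \<beta>) (Cpt \<alpha>' X) \<cdot>\<^bsub>TgtC (Src2 \<beta>)\<^esub> AMap (Src2 \<beta>) (Cpt \<alpha> X))
      = (Cpt \<beta> (OMap (Tgt2 \<alpha>') X) \<cdot>\<^bsub>TgtC (Src2 \<beta>)\<^esub>
        AMap (Src2 \<beta>) (Cpt \<alpha>' X)) \<cdot>\<^bsub>TgtC (Src2 \<beta>)\<^esub> AMap (Src2 \<beta>) (Cpt \<alpha> X)"
      by (simp add: category_assoc)
    ultimately show "Cpt (hcomp_nat (vcomp_nat \<beta>' \<beta>) (vcomp_nat \<alpha>' \<alpha>)) X =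
        Cpt (vcomp_nat (hcomp_nat \<beta>' \<alpha>') (hcomp_nat \<beta> \<alpha>)) X"
      by (simp add: category_assoc)
  qed auto
  have tgt: "Src (Tgt2 \<alpha>) = Src (Src2 \<alpha>)" "Tgt (Tgt2 \<alpha>) = Tgt (Src2 \<alpha>)" if "\<alpha> \<in> As" for \<alpha>
    using nat_cell_simps(3,4)[OF A(1)[OF that]] by auto
  show ?thesis
    unfolding two_category_def composable1_def vcomposable_def hcomposable_def struct_twocat_simps
    using K F A
    by (intro conjI allI ballI impI)
      (auto simp: tgt intro!: unit1 assoc1 unit2 hunit assoc2 assoch hid interchange)
qed

text \<open>Full sub-2-categories of structured 2-categories have the same shape again, so that
  \<open>two_category_struct\<close> covers \<open>StableCat_mono\<close> too.\<close>

lemma full_sub_struct: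
  "full_sub (struct_twocat Ks Fs As) P = struct_twocat (Ks \<inter> P) {f \<in> Fs. Src f \<in> P \<and> Tgt f \<in> P}
     {\<alpha> \<in> As. Src (Src2 \<alpha>) \<in> P \<and> Tgt (Src2 \<alpha>) \<in> P}"
  by (simp add: full_sub_def struct_twocat_def)

section \<open>Generic constructions of 2-functors and 2-natural transformations\<close>

lemma two_functor_id:
  assumes "two_category K"
  shows "two_functor K K id_twofun"
  using assms by (simp add: two_functor_def id_twofun_def)

lemma two_functor_comp:
  assumes "two_functor K L F" "two_functor L M G"
  shows "two_functor K M (comp_twofun G F)"
proof -
  have "two_category K" using assms by (simp add: two_functor_def)
  then have "\<And>\<alpha>. \<alpha> \<in> Cells2 K \<Longrightarrow> src2 K \<alpha> \<in> Cells1 K" unfolding two_category_def by blast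
  then show ?thesis
    using assms unfolding two_functor_def comp_twofun_def composable1_def vcomposable_def hcomposable_def
    by simp
qed

text \<open>The laws evaluate the three maps at cells of \<open>K\<close> and at composites of
  these, which are cells again. This carries 2-functoriality from Span to Par, since
  \<open>ParF\<close> and \<open>SpanF\<close> agree on the cells of \<open>StableCat_mono\<close>
  but not as functions on the whole types.\<close>

lemma two_functor_cong:
  assumes F: "two_functor K L F"
    and "\<And>A. A \<in> Cells0 K \<Longrightarrow> on0 F' A = on0 F A" "\<And>f. f \<in> Cells1 K \<Longrightarrow> on1 F' f = on1 F f"
      "\<And>\<alpha>. \<alpha> \<in> Cells2 K \<Longrightarrow> on2 F' \<alpha> = on2 F \<alpha>"
  shows "two_functor K L F'"
proof -
  have "two_category K" using F by (simp add: two_functor_def)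
  then have
    "\<And>f. f \<in> Cells1 K \<Longrightarrow> src1 K f \<in> Cells0 K \<and> tgt1 K f \<in> Cells0 K"
    "\<And>A. A \<in> Cells0 K \<Longrightarrow> one1 K A \<in> Cells1 K"
    "\<And>f. f \<in> Cells1 K \<Longrightarrow> one2 K f \<in> Cells2 K"
    "\<And>\<alpha>. \<alpha> \<in> Cells2 K \<Longrightarrow> src2 K \<alpha> \<in> Cells1 K \<and> tgt2 K \<alpha> \<in> Cells1 K"
    "\<And>f g. composable1 K g f \<Longrightarrow> comp1 K g f \<in> Cells1 K"
    "\<And>f g. vcomposable K g f \<Longrightarrow> vcomp K g f \<in> Cells2 K"
    "\<And>f g. hcomposable K g f \<Longrightarrow> hcomp K g f \<in> Cells2 K"
    unfolding two_category_def by simp_all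
  then show ?thesis
    using F assms(2-) unfolding two_functor_def
    by (simp add: composable1_def vcomposable_def hcomposable_def)
qed

text \<open>For 2-functors with the same values on cells the identity 1-cells form a 2-natural
  isomorphism, by the unit laws for \<open>comp1\<close> and \<open>hcomp\<close>. The comparison of
  Span with Par turns out to be of this kind.\<close>

lemma two_natural_iso_one1:
  assumes F: "two_functor K L F"
    and 0: "\<And>A. A \<in> Cells0 K \<Longrightarrow> on0 F' A = on0 F A" and 1: "\<And>f. f \<in> Cells1 K \<Longrightarrow> on1 F' f = on1 F f"
    and 2: "\<And>\<alpha>. \<alpha> \<in> Cells2 K \<Longrightarrow> on2 F' \<alpha> = on2 F \<alpha>"
    and \<theta>: "\<And>A. A \<in> Cells0 K \<Longrightarrow> \<theta> A = one1 L (on0 F A)"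
  shows "two_natural_iso K L F F' \<theta>"
proof -
  have K: "two_category K" and L: "two_category L" using F by (simp_all add: two_functor_def)
  have K1: "\<And>f. f \<in> Cells1 K \<Longrightarrow> src1 K f \<in> Cells0 K \<and> tgt1 K f \<in> Cells0 K"
    "\<And>\<alpha>. \<alpha> \<in> Cells2 K \<Longrightarrow> src2 K \<alpha> \<in> Cells1 K"
    using K unfolding two_category_def by simp_all
  have F0: "\<And>A. A \<in> Cells0 K \<Longrightarrow> on0 F A \<in> Cells0 L"
    and F1: "\<And>f. f \<in> Cells1 K \<Longrightarrow> on1 F f \<in> Cells1 L \<and>
      src1 L (on1 F f) = on0 F (src1 K f) \<and> tgt1 L (on1 F f) = on0 F (tgt1 K f)"
    and F2: "\<And>\<alpha>. \<alpha> \<in> Cells2 K \<Longrightarrow> on2 F \<alpha> \<in> Cells2 L \<and> src2 L (on2 F \<alpha>) = on1 F (src2 K \<alpha>)"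
    using F unfolding two_functor_def by simp_all
  have L0: "\<And>A. A \<in> Cells0 L \<Longrightarrow> one1 L A \<in> Cells1 L \<and> src1 L (one1 L A) = A \<and> tgt1 L (one1 L A) = A"
    and L1: "\<And>f. f \<in> Cells1 L \<Longrightarrow> comp1 L f (one1 L (src1 L f)) = f"
      "\<And>f. f \<in> Cells1 L \<Longrightarrow> comp1 L (one1 L (tgt1 L f)) f = f"
    using L unfolding two_category_def by simp_all
  have L2: "\<And>\<alpha>. \<alpha> \<in> Cells2 L \<Longrightarrow> hcomp L \<alpha> (one2 L (one1 L (src1 L (src2 L \<alpha>)))) = \<alpha>"
      "\<And>\<alpha>. \<alpha> \<in> Cells2 L \<Longrightarrow> hcomp L (one2 L (one1 L (tgt1 L (src2 L \<alpha>)))) \<alpha> = \<alpha>"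
    using L unfolding two_category_def by meson+
  have "comp1 L (on1 F' f) (\<theta> (src1 K f)) = comp1 L (\<theta> (tgt1 K f)) (on1 F f)"
    if "f \<in> Cells1 K" for f
    using that L1[of "on1 F f"] F1[of f] by (simp add: 1 \<theta> K1)
  moreover have "hcomp L (on2 F' \<alpha>) (one2 L (\<theta> (src1 K (src2 K \<alpha>)))) =
        hcomp L (one2 L (\<theta> (tgt1 K (src2 K \<alpha>)))) (on2 F \<alpha>)" if "\<alpha> \<in> Cells2 K" for \<alpha>
    using that L2[of "on2 F \<alpha>"] F2[of \<alpha>] F1[of "src2 K \<alpha>"] by (simp add: 2 \<theta> K1)
  moreover have "iso1 L (\<theta> A)" if "A \<in> Cells0 K" for A
    unfolding iso1_def using that L0[OF F0[OF that]] L1(1)[of "one1 L (on0 F A)"]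
    by (auto simp: \<theta> intro!: bexI[of _ "one1 L (on0 F A)"])
  ultimately show ?thesis
    unfolding two_natural_iso_def two_natural_def
    using F two_functor_cong[OF F 0 1 2] L0 F0 by (simp add: 0 \<theta>)
qed

text \<open>Cells are determined by their values, so the equations between composite cells reduce to
  pointwise ones. In the whiskered case \<open>cpt\<close>, the 1-cell \<open>\<theta>\<close> acts
  on an object on one side and on the component, an arrow, on the other.\<close>

lemma two_natural_structI:
  assumes F: "two_functor (struct_twocat Ks Fs As) (struct_twocat Ks' Fs' As') F"
    and G: "two_functor (struct_twocat Ks Fs As) (struct_twocat Ks' Fs' As') G"
    and cells: "\<And>F. F \<in> Fs' \<Longrightarrow> functor_cell F" "\<And>\<alpha>. \<alpha> \<in> As' \<Longrightarrow> nat_cell \<alpha>"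
    and \<theta>: "\<And>K. K \<in> Ks \<Longrightarrow> \<theta> K \<in> Fs'" "\<And>K. K \<in> Ks \<Longrightarrow> Src (\<theta> K) = on0 F K"
      "\<And>K. K \<in> Ks \<Longrightarrow> Tgt (\<theta> K) = on0 G K"
    and obj: "\<And>f A. f \<in> Fs \<Longrightarrow> A \<in> Obj (fst (on0 F (Src f))) \<Longrightarrow>
      OMap (on1 G f) (OMap (\<theta> (Src f)) A) = OMap (\<theta> (Tgt f)) (OMap (on1 F f) A)"
    and arr: "\<And>f a. f \<in> Fs \<Longrightarrow> a \<in> Arr (fst (on0 F (Src f))) \<Longrightarrow>
      AMap (on1 G f) (AMap (\<theta> (Src f)) a) = AMap (\<theta> (Tgt f)) (AMap (on1 F f) a)"
    and cpt: "\<And>\<alpha> A. \<alpha> \<in> As \<Longrightarrow> A \<in> Obj (fst (on0 F (Src (Src2 \<alpha>)))) \<Longrightarrow>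
      Cpt (on2 G \<alpha>) (OMap (\<theta> (Src (Src2 \<alpha>))) A) = AMap (\<theta> (Tgt (Src2 \<alpha>))) (Cpt (on2 F \<alpha>) A)"
  shows "two_natural (struct_twocat Ks Fs As) (struct_twocat Ks' Fs' As') F G \<theta>"
proof -
  let ?K = "struct_twocat Ks Fs As"
  have K: "two_category ?K" using F by (simp add: two_functor_def)
  have K1: "Src f \<in> Ks" "Tgt f \<in> Ks" if "f \<in> Fs" for f
    using K that unfolding two_category_def by auto
  have K2: "Src2 \<alpha> \<in> Fs" "Tgt2 \<alpha> \<in> Fs" "Src (Tgt2 \<alpha>) = Src (Src2 \<alpha>)" "Tgt (Tgt2 \<alpha>) = Tgt (Src2 \<alpha>)"
    if "\<alpha> \<in> As" for \<alpha>
    using K that unfolding two_category_def by auto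
  have F1: "on1 F f \<in> Fs'" "Src (on1 F f) = on0 F (Src f)" "Tgt (on1 F f) = on0 F (Tgt f)"
    and G1: "on1 G f \<in> Fs'" "Src (on1 G f) = on0 G (Src f)" "Tgt (on1 G f) = on0 G (Tgt f)"
    if "f \<in> Fs" for f
    using F G that unfolding two_functor_def by auto
  have F2: "on2 F \<alpha> \<in> As'" "Src2 (on2 F \<alpha>) = on1 F (Src2 \<alpha>)" "Tgt2 (on2 F \<alpha>) = on1 F (Tgt2 \<alpha>)"
    and G2: "on2 G \<alpha> \<in> As'" "Src2 (on2 G \<alpha>) = on1 G (Src2 \<alpha>)" "Tgt2 (on2 G \<alpha>) = on1 G (Tgt2 \<alpha>)"
    if "\<alpha> \<in> As" for \<alpha>
    using F G that unfolding two_functor_def by auto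
  have nat1: "comp_cell (on1 G f) (\<theta> (Src f)) = comp_cell (\<theta> (Tgt f)) (on1 F f)" if "f \<in> Fs" for f
  proof -
    note c = F1[OF that] G1[OF that] \<theta>[OF K1(1)[OF that]] \<theta>[OF K1(2)[OF that]]
    note d = c cells(1)[OF c(1)] cells(1)[OF c(4)] cells(1)[OF c(7)] cells(1)[OF c(10)]
    show ?thesis
      by (rule onecell_eqI) (use d obj[OF that] arr[OF that] in \<open>auto intro!: functor_cell_comp\<close>)
  qed
  have "hcomp_nat (on2 G \<alpha>) (id_nat (\<theta> (Src (Src2 \<alpha>)))) = hcomp_nat (id_nat (\<theta> (Tgt (Src2 \<alpha>)))) (on2 F \<alpha>)"
    if \<alpha>: "\<alpha> \<in> As" for \<alpha>
  proof -
    note a = K2[OF \<alpha>]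
    note b = K1[OF a(1)]
    note c = F1[OF a(1)] G1[OF a(1)] F2[OF \<alpha>] G2[OF \<alpha>] \<theta>[OF b(1)] \<theta>[OF b(2)]
    note d = c cells(1)[OF c(13)] cells(1)[OF c(16)] cells(2)[OF c(7)] cells(2)[OF c(10)]
    show ?thesis
    proof (rule twocell_eqI)
      show "nat_cell (hcomp_nat (on2 G \<alpha>) (id_nat (\<theta> (Src (Src2 \<alpha>)))))"
        "nat_cell (hcomp_nat (id_nat (\<theta> (Tgt (Src2 \<alpha>)))) (on2 F \<alpha>))"
        using d by (auto intro!: nat_cell_hcomp nat_cell_id)
      fix A assume "A \<in> Obj (SrcC (Src2 (hcomp_nat (on2 G \<alpha>) (id_nat (\<theta> (Src (Src2 \<alpha>)))))))"
      then have A: "A \<in> Obj (fst (on0 F (Src (Src2 \<alpha>))))" using d by simp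
      have "Cpt (hcomp_nat (on2 G \<alpha>) (id_nat (\<theta> (Src (Src2 \<alpha>))))) A = Cpt (on2 G \<alpha>) (OMap (\<theta> (Src (Src2 \<alpha>))) A)"
        by (rule hcomp_whisker_nat) (use d A in auto)
      moreover have "Cpt (hcomp_nat (id_nat (\<theta> (Tgt (Src2 \<alpha>)))) (on2 F \<alpha>)) A = AMap (\<theta> (Tgt (Src2 \<alpha>))) (Cpt (on2 F \<alpha>) A)"
        by (rule hcomp_nat_whisker) (use d A in auto)
      ultimately show "Cpt (hcomp_nat (on2 G \<alpha>) (id_nat (\<theta> (Src (Src2 \<alpha>))))) A =
          Cpt (hcomp_nat (id_nat (\<theta> (Tgt (Src2 \<alpha>)))) (on2 F \<alpha>)) A"
        using cpt[OF \<alpha> A] by simp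
    qed (use d nat1[OF a(1)] nat1[OF a(2)] a in auto)
  qed
  with nat1 F G \<theta> show ?thesis by (simp add: two_natural_def)
qed

subsection \<open>Isomorphisms that are the identity on objects\<close>

text \<open>Unit and counit fix every object, so invertibility amounts to bijectivity on arrows. The
  predicate speaks of the underlying categories; whether the inverse respects \<open>S\<close> or
  restrictions is a separate matter.\<close>

definition iso_cell :: "('o, 'm, 's) onecell \<Rightarrow> bool" where
  "iso_cell F \<longleftrightarrow> functor_cell F \<and> Obj (TgtC F) = Obj (SrcC F) \<and>
     (\<forall>A\<in>Obj (SrcC F). OMap F A = A) \<and>
     bij_betw (AMap F) (Arr (SrcC F)) (Arr (TgtC F))"

definition inverse_cell :: "('o, 'm, 's) onecell \<Rightarrow> ('o, 'm, 's) onecell" where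
  "inverse_cell F = \<lparr>Src = Tgt F, Tgt = Src F, OMap = (\<lambda>A\<in>Obj (TgtC F). A),
     AMap = restrict (inv_into (Arr (SrcC F)) (AMap F)) (Arr (TgtC F))\<rparr>"

lemma inverse_cell_simps:
  assumes "iso_cell F"
  shows "functor_cell F" "Src (inverse_cell F) = Tgt F" "Tgt (inverse_cell F) = Src F"
    "f \<in> Arr (SrcC F) \<Longrightarrow> AMap (inverse_cell F) (AMap F f) = f"
    "g \<in> Arr (TgtC F) \<Longrightarrow> AMap F (AMap (inverse_cell F) g) = g"
    "g \<in> Arr (TgtC F) \<Longrightarrow> AMap (inverse_cell F) g \<in> Arr (SrcC F)"
    "A \<in> Obj (SrcC F) \<Longrightarrow> OMap F A = A"
    "Obj (TgtC F) = Obj (SrcC F)"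
  using assms unfolding iso_cell_def
  by (auto simp: inverse_cell_def bij_betw_inv_into_left bij_betw_inv_into_right
      bij_betw_def intro: inv_into_into)

lemma functor_cell_inverse:
  assumes F: "iso_cell F"
  shows "functor_cell (inverse_cell F)"
proof (rule functor_cellI)
  let ?G = "inverse_cell F" and ?C = "SrcC F" and ?D = "TgtC F"
  note [simp] = inverse_cell_simps[OF F]
  show "OMap ?G \<in> extensional (Obj (SrcC ?G))" "AMap ?G \<in> extensional (Arr (SrcC ?G))"
    by (auto simp: inverse_cell_def)
  have O [simp]: "OMap ?G A = A" if "A \<in> Obj ?C" for A
    using that inverse_cell_simps(8)[OF F] by (simp add: inverse_cell_def)
  \<comment> \<open>The equations for the inverse on identities and composites are verified after
    applying \<open>F\<close>, which is injective on arrows.\<close>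
  have inj: "x = y" if "AMap F x = AMap F y" "x \<in> Arr ?C" "y \<in> Arr ?C" for x y
    using that inverse_cell_simps(4)[OF F] by metis
  have DC: "Dom ?C (AMap ?G g) = Dom ?D g" "Cod ?C (AMap ?G g) = Cod ?D g" if "g \<in> Arr ?D" for g
    using functor_cell_simps(5,6)[of F "AMap ?G g"] that by auto
  show "Dom (TgtC ?G) (AMap ?G g) = OMap ?G (Dom (SrcC ?G) g)"
    "Cod (TgtC ?G) (AMap ?G g) = OMap ?G (Cod (SrcC ?G) g)" if "g \<in> Arr (SrcC ?G)" for g
    using DC that functor_cell_simps(2)[of F] category_simps(1,2)[of ?D g] by auto
  show "AMap ?G (Idt (SrcC ?G) A) = Idt (TgtC ?G) (OMap ?G A)"
    if "A \<in> Obj (SrcC ?G)" for A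
    by (rule inj) (use that in auto)
  show "AMap ?G (g \<cdot>\<^bsub>SrcC ?G\<^esub> f) = AMap ?G g \<cdot>\<^bsub>TgtC ?G\<^esub> AMap ?G f"
    if "f \<in> Arr (SrcC ?G)" "g \<in> Arr (SrcC ?G)"
      "Cod (SrcC ?G) f = Dom (SrcC ?G) g" for f g
    by (rule inj) (use that DC in auto)
qed (use inverse_cell_simps[OF F] in \<open>auto simp: inverse_cell_def\<close>)

lemma inverse_cell_comp:
  assumes F: "iso_cell F"
  shows "comp_cell (inverse_cell F) F = id_cell (Src F)" "comp_cell F (inverse_cell F) = id_cell (Tgt F)"
proof -
  note [simp] = inverse_cell_simps[OF F] functor_cell_inverse[OF F]
  have O [simp]: "OMap (inverse_cell F) A = A" if "A \<in> Obj (SrcC F)" for A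
    using that inverse_cell_simps(8)[OF F] by (simp add: inverse_cell_def)
  show "comp_cell (inverse_cell F) F = id_cell (Src F)"
    by (rule onecell_eqI) (auto intro!: functor_cell_comp functor_cell_id)
  show "comp_cell F (inverse_cell F) = id_cell (Tgt F)"
    by (rule onecell_eqI) (auto intro!: functor_cell_comp functor_cell_id)
qed

lemma iso1_struct:
  assumes "iso_cell F" "F \<in> Fs" "inverse_cell F \<in> Fs"
  shows "iso1 (struct_twocat Ks Fs As) F"
  unfolding iso1_def
  using assms inverse_cell_comp[OF assms(1)] inverse_cell_simps(2,3)[OF assms(1)] by auto

lemma inverse_cell_pullback:
  assumes F: "iso_cell F" and p: "pullback (SrcC F) f s s' f'"
  shows "pullback (TgtC F) (AMap F f) (AMap F s) (AMap F s') (AMap F f')"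
  by (rule is_functor_inverse_pullback[of _ _ "OMap F" _ "OMap (inverse_cell F)" "AMap (inverse_cell F)"])
    (use inverse_cell_simps[OF F] functor_cell_inverse[OF F] p in \<open>auto simp: functor_cell_def\<close>)

lemma iso_cell_inverse:
  assumes F: "iso_cell F"
  shows "iso_cell (inverse_cell F)"
  unfolding iso_cell_def
proof (intro conjI)
  note [simp] = inverse_cell_simps[OF F] functor_cell_inverse[OF F]
  show "bij_betw (AMap (inverse_cell F)) (Arr (SrcC (inverse_cell F))) (Arr (TgtC (inverse_cell F)))"
    by (rule bij_betw_byWitness[where f' = "AMap F"]) auto
qed (use inverse_cell_simps[OF F] functor_cell_inverse[OF F] in \<open>auto simp: inverse_cell_def\<close>)

section \<open>Stably structured categories\<close>

lemma stable_catD: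
  assumes "stable_cat K"
  shows "category (fst K)" "s \<in> snd K \<Longrightarrow> s \<in> Arr (fst K)" "iso_arr (fst K) f \<Longrightarrow> f \<in> snd K"
    "s \<in> snd K \<Longrightarrow> t \<in> snd K \<Longrightarrow> Cod (fst K) s = Dom (fst K) t \<Longrightarrow> t \<cdot>\<^bsub>fst K\<^esub> s \<in> snd K"
    "s \<in> snd K \<Longrightarrow> f \<in> Arr (fst K) \<Longrightarrow> Cod (fst K) f = Cod (fst K) s \<Longrightarrow>
      \<exists>s' f'. pullback (fst K) f s s' f'"
    "s \<in> snd K \<Longrightarrow> pullback (fst K) f s s' f' \<Longrightarrow> s' \<in> snd K"
  using assms unfolding stable_cat_def Let_def by blast+

lemma stable_functorD:
  assumes "stable_functor F"
  shows "stable_cat (Src F)" "stable_cat (Tgt F)" "functor_cell F"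
    "s \<in> snd (Src F) \<Longrightarrow> AMap F s \<in> snd (Tgt F)"
    "s \<in> snd (Src F) \<Longrightarrow> pullback (SrcC F) f s s' f' \<Longrightarrow>
      pullback (TgtC F) (AMap F f) (AMap F s) (AMap F s') (AMap F f')"
  using assms unfolding stable_functor_def by blast+

lemma stable_natD:
  assumes "stable_nat \<alpha>"
  shows "stable_functor (Src2 \<alpha>)" "stable_functor (Tgt2 \<alpha>)" "nat_cell \<alpha>"
    "s \<in> snd (Src (Src2 \<alpha>)) \<Longrightarrow> pullback (TgtC (Src2 \<alpha>)) (Cpt \<alpha> (Cod (SrcC (Src2 \<alpha>)) s))
      (AMap (Tgt2 \<alpha>) s) (AMap (Src2 \<alpha>) s) (Cpt \<alpha> (Dom (SrcC (Src2 \<alpha>)) s))"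
  using assms unfolding stable_nat_def Let_def by blast+

section \<open>Closure of stable functors and stable transformations under identities and
  composites\<close>

lemma stable_functor_id:
  assumes K: "stable_cat K"
  shows "stable_functor (id_cell K)"
  unfolding stable_functor_def
  using K stable_catD[OF K] by (auto intro: functor_cell_id simp: pullbackD)

lemma stable_functor_comp:
  assumes F: "stable_functor F" and G: "stable_functor G" and eq: "Tgt F = Src G"
  shows "stable_functor (comp_cell G F)"
  unfolding stable_functor_def
proof (intro conjI ballI allI impI)
  note F = stable_functorD[OF F] and G = stable_functorD[OF G]
  show "functor_cell (comp_cell G F)"
    using F(3) G(3) eq by (rule functor_cell_comp)
  show "AMap (comp_cell G F) ` snd (Src (comp_cell G F)) \<subseteq> snd (Tgt (comp_cell G F))"
    using F G(4) eq stable_catD(2)[OF F(1)] by auto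
  fix s f s' f'
  assume s: "s \<in> snd (Src (comp_cell G F))" and p: "pullback (SrcC (comp_cell G F)) f s s' f'"
  have "pullback (TgtC G) (AMap G (AMap F f)) (AMap G (AMap F s)) (AMap G (AMap F s')) (AMap G (AMap F f'))"
    by (rule G(5)) (use s p F(4,5) eq in auto)
  then show "pullback (TgtC (comp_cell G F)) (AMap (comp_cell G F) f)
     (AMap (comp_cell G F) s) (AMap (comp_cell G F) s') (AMap (comp_cell G F) f')"
    using p by (simp add: pullbackD(1-4)[OF p[simplified]])
qed (use stable_functorD[OF F] stable_functorD[OF G] in simp_all)

lemma stable_nat_id:
  assumes F: "stable_functor F"
  shows "stable_nat (id_nat F)"
  unfolding stable_nat_def Let_def
proof (intro conjI ballI)
  note F' = stable_functorD[OF F]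
  show "nat_cell (id_nat F)" using F'(3) by (rule nat_cell_id)
  fix s assume "s \<in> snd (Src (Src2 (id_nat F)))"
  then have s: "s \<in> Arr (SrcC F)" using stable_catD(2)[OF F'(1)] by simp
  show "pullback (TgtC (Src2 (id_nat F))) (Cpt (id_nat F) (Cod (SrcC (Src2 (id_nat F))) s))
      (AMap (Tgt2 (id_nat F)) s) (AMap (Src2 (id_nat F)) s)
      (Cpt (id_nat F) (Dom (SrcC (Src2 (id_nat F))) s))"
    using pullback_Idt_left[of "TgtC F" "AMap F s"] F'(3) s by simp
qed (use F in simp_all)

lemma stable_nat_vcomp:
  assumes a: "stable_nat \<alpha>" and b: "stable_nat \<beta>" and eq: "Tgt2 \<alpha> = Src2 \<beta>"
  shows "stable_nat (vcomp_nat \<beta> \<alpha>)"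
  unfolding stable_nat_def Let_def
proof (intro conjI ballI)
  note A = stable_natD[OF a] and B = stable_natD[OF b]
  note nA = nat_cell_simps[OF A(3)]
  show "nat_cell (vcomp_nat \<beta> \<alpha>)" using A(3) B(3) eq by (rule nat_cell_vcomp)
  fix s assume "s \<in> snd (Src (Src2 (vcomp_nat \<beta> \<alpha>)))"
  then have s: "s \<in> snd (Src (Src2 \<alpha>))" by simp
  have sA: "s \<in> Arr (SrcC (Src2 \<alpha>))"
    using s stable_catD(2)[OF stable_functorD(1)[OF A(1)]] by simp
  have "pullback (TgtC (Src2 \<alpha>)) (Cpt \<beta> (Cod (SrcC (Src2 \<alpha>)) s))
      (AMap (Tgt2 \<beta>) s) (AMap (Tgt2 \<alpha>) s) (Cpt \<beta> (Dom (SrcC (Src2 \<alpha>)) s))"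
    using B(4)[of s] s nA(3,4) eq by simp
  from pullback_paste[OF _ this A(4)[OF s]] sA
  show "pullback (TgtC (Src2 (vcomp_nat \<beta> \<alpha>)))
      (Cpt (vcomp_nat \<beta> \<alpha>) (Cod (SrcC (Src2 (vcomp_nat \<beta> \<alpha>))) s))
      (AMap (Tgt2 (vcomp_nat \<beta> \<alpha>)) s) (AMap (Src2 (vcomp_nat \<beta> \<alpha>)) s)
      (Cpt (vcomp_nat \<beta> \<alpha>) (Dom (SrcC (Src2 (vcomp_nat \<beta> \<alpha>))) s))"
    using nA(1) by simp
qed (use stable_natD[OF a] stable_natD[OF b] in simp_all)

lemma stable_nat_hcomp:
  assumes a: "stable_nat \<alpha>" and b: "stable_nat \<beta>" and eq: "Tgt (Src2 \<alpha>) = Src (Src2 \<beta>)"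
  shows "stable_nat (hcomp_nat \<beta> \<alpha>)"
  unfolding stable_nat_def Let_def
proof (intro conjI ballI)
  note A = stable_natD[OF a] and B = stable_natD[OF b]
  note nA = nat_cell_simps[OF A(3)] and nB = nat_cell_simps[OF B(3)]
  show "nat_cell (hcomp_nat \<beta> \<alpha>)" using A(3) B(3) eq[symmetric] by (rule nat_cell_hcomp)
  show "stable_functor (Src2 (hcomp_nat \<beta> \<alpha>))" "stable_functor (Tgt2 (hcomp_nat \<beta> \<alpha>))"
    using A B eq nA(4) nB(3) by (auto intro: stable_functor_comp)
  fix s assume "s \<in> snd (Src (Src2 (hcomp_nat \<beta> \<alpha>)))"
  then have s: "s \<in> snd (Src (Src2 \<alpha>))" by simp
  have [simp]: "s \<in> Arr (SrcC (Src2 \<alpha>))"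
    using s stable_catD(2)[OF stable_functorD(1)[OF A(1)]] by simp
  have Gs: "AMap (Tgt2 \<alpha>) s \<in> snd (Src (Src2 \<beta>))"
    using stable_functorD(4)[OF A(2)] s nA(3,4) eq by simp
  have 1: "pullback (TgtC (Src2 \<beta>)) (Cpt \<beta> (OMap (Tgt2 \<alpha>) (Cod (SrcC (Src2 \<alpha>)) s)))
      (AMap (Tgt2 \<beta>) (AMap (Tgt2 \<alpha>) s)) (AMap (Src2 \<beta>) (AMap (Tgt2 \<alpha>) s))
      (Cpt \<beta> (OMap (Tgt2 \<alpha>) (Dom (SrcC (Src2 \<alpha>)) s)))"
    using B(4)[OF Gs] nA(11,12)[of s] eq by simp
  \<comment> \<open>\<open>AMap (Tgt2 \<alpha>) s\<close> is again in the distinguished class, and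
    so \<open>Src2 \<beta>\<close> preserves the pullback square that \<open>\<alpha>\<close> has at
    \<open>s\<close>. The square of \<open>\<beta>\<close> at that same arrow is pasted to
    it.\<close>
  have 2: "pullback (TgtC (Src2 \<beta>)) (AMap (Src2 \<beta>) (Cpt \<alpha> (Cod (SrcC (Src2 \<alpha>)) s)))
      (AMap (Src2 \<beta>) (AMap (Tgt2 \<alpha>) s)) (AMap (Src2 \<beta>) (AMap (Src2 \<alpha>) s))
      (AMap (Src2 \<beta>) (Cpt \<alpha> (Dom (SrcC (Src2 \<alpha>)) s)))"
    by (rule stable_functorD(5)[OF B(1) Gs]) (use A(4)[OF s] eq in simp)
  show "pullback (TgtC (Src2 (hcomp_nat \<beta> \<alpha>)))
      (Cpt (hcomp_nat \<beta> \<alpha>) (Cod (SrcC (Src2 (hcomp_nat \<beta> \<alpha>))) s))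
      (AMap (Tgt2 (hcomp_nat \<beta> \<alpha>)) s) (AMap (Src2 (hcomp_nat \<beta> \<alpha>)) s)
      (Cpt (hcomp_nat \<beta> \<alpha>) (Dom (SrcC (Src2 (hcomp_nat \<beta> \<alpha>))) s))"
    using pullback_paste[OF _ 1 2] nA(1-3) nB(1) by simp
qed

lemma two_category_StableCat_sub: "two_category (full_sub StableCat P)"
  unfolding StableCat_def full_sub_struct
  by (rule two_category_struct)
    (auto dest: stable_catD(1) stable_functorD stable_natD nat_cell_simps(3,4)
      intro: stable_functor_id stable_functor_comp stable_nat_id stable_nat_vcomp stable_nat_hcomp
      simp: nat_cell_simps(3,4)[OF stable_natD(3)])

section \<open>Restriction categories\<close>

locale restriction =
  fixes X :: "('o, 'm) cat \<times> ('m \<Rightarrow> 'm)"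
  assumes restriction_cat: "restriction_cat X"
begin

abbreviation "C \<equiv> fst X"
abbreviation "rs \<equiv> snd X"
abbreviation cmp (infixr "\<bullet>" 75) where "g \<bullet> f \<equiv> Cmp (fst X) g f"

lemma category_C [simp]: "category C"
  and rs_Arr [simp]: "f \<in> Arr C \<Longrightarrow> rs f \<in> Arr C"
  and rs_Dom [simp]: "f \<in> Arr C \<Longrightarrow> Dom C (rs f) = Dom C f"
  and rs_Cod [simp]: "f \<in> Arr C \<Longrightarrow> Cod C (rs f) = Dom C f"
  and R1 [simp]: "f \<in> Arr C \<Longrightarrow> f \<bullet> rs f = f"
  and R2: "f \<in> Arr C \<Longrightarrow> g \<in> Arr C \<Longrightarrow> Dom C f = Dom C g \<Longrightarrow> rs f \<bullet> rs g = rs g \<bullet> rs f"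
  and R3: "f \<in> Arr C \<Longrightarrow> g \<in> Arr C \<Longrightarrow> Dom C f = Dom C g \<Longrightarrow> rs (g \<bullet> rs f) = rs g \<bullet> rs f"
  and R4: "f \<in> Arr C \<Longrightarrow> g \<in> Arr C \<Longrightarrow> Cod C f = Dom C g \<Longrightarrow> rs g \<bullet> f = f \<bullet> rs (g \<bullet> f)"
  using restriction_cat unfolding restriction_cat_def Let_def hom_def mem_Collect_eq by blast+

section \<open>Restriction idempotents, total morphisms and their restricted inverses\<close>

lemma rs_Idt [simp]: "A \<in> Obj C \<Longrightarrow> rs (Idt C A) = Idt C A"
  using R1[of "Idt C A"] by simp

lemma rs_rs [simp]: "f \<in> Arr C \<Longrightarrow> rs (rs f) = rs f"
  using R3[of f "Idt C (Dom C f)"] by simp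

lemma rs_comp_absorb:
  assumes "f \<in> Arr C" "g \<in> Arr C" "Cod C f = Dom C g"
  shows "rs (g \<bullet> f) \<bullet> rs f = rs (g \<bullet> f)" "rs f \<bullet> rs (g \<bullet> f) = rs (g \<bullet> f)"
  using assms R3[of f "g \<bullet> f"] R2[of f "g \<bullet> f"] by (simp_all add: category_assoc)

text \<open>R4 moves \<open>rs g\<close> across \<open>f\<close>, R3 takes the resulting
  \<open>rs (g f)\<close> out of the restriction, and the remaining \<open>rs f\<close> is
  absorbed.\<close>

lemma rs_comp_rs:
  assumes "f \<in> Arr C" "g \<in> Arr C" "Cod C f = Dom C g"
  shows "rs (rs g \<bullet> f) = rs (g \<bullet> f)"
  using assms R3[of "g \<bullet> f" f] rs_comp_absorb[of f g] R4[of f g] by simp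

lemma total_arrI: "f \<in> Arr C \<Longrightarrow> rs f = Idt C (Dom C f) \<Longrightarrow> total_arr X f"
  by (simp add: total_arr_def)

lemma total_arrD [simp]:
  assumes "total_arr X f"
  shows "f \<in> Arr C" "rs f = Idt C (Dom C f)"
  using assms by (simp_all add: total_arr_def)

lemma rs_total_comp:
  assumes "f \<in> Arr C" "total_arr X g" "Cod C f = Dom C g"
  shows "rs (g \<bullet> f) = rs f"
  using assms rs_comp_rs[of f g] by simp

lemma total_comp: "total_arr X f \<Longrightarrow> total_arr X g \<Longrightarrow> Cod C f = Dom C g \<Longrightarrow> total_arr X (g \<bullet> f)"
  by (rule total_arrI) (simp_all add: rs_total_comp)

lemma total_Idt [simp]: "A \<in> Obj C \<Longrightarrow> total_arr X (Idt C A)"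
  by (rule total_arrI) simp_all

text \<open>A composite \<open>g f\<close> is defined at most where \<open>f\<close> is, in
  equations \<open>rs (g f) rs f = rs (g f)\<close>. For total \<open>g f\<close> the left side is
  \<open>rs f\<close> and the right side an identity.\<close>

lemma total_comp_cancel:
  assumes "total_arr X (g \<bullet> f)" "f \<in> Arr C" "g \<in> Arr C" "Cod C f = Dom C g"
  shows "total_arr X f"
  using assms rs_comp_absorb[of f g] by (intro total_arrI) simp_all

text \<open>The pairs of a total restricted isomorphism \<open>s\<close> and its restricted inverse
  \<open>j\<close>, written as a splitting of the idempotent \<open>rs j\<close>. Totality of
  \<open>s\<close> follows from \<open>j s = 1\<close>. Keeping \<open>j\<close> explicit turns
  conditions on \<open>s\<close> into equations, which functors preserve.\<close>

definition rsec :: "'m \<Rightarrow> 'm \<Rightarrow> bool" where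
  "rsec s j \<longleftrightarrow> s \<in> Arr C \<and> j \<in> Arr C \<and> Dom C j = Cod C s \<and> Cod C j = Dom C s \<and>
     j \<bullet> s = Idt C (Dom C s) \<and> s \<bullet> j = rs j"

lemma rsecD:
  assumes "rsec s j"
  shows "s \<in> Arr C" "j \<in> Arr C" "Dom C j = Cod C s" "Cod C j = Dom C s"
    "j \<bullet> s = Idt C (Dom C s)" "s \<bullet> j = rs j" "total_arr X s"
proof -
  show *: "s \<in> Arr C" "j \<in> Arr C" "Dom C j = Cod C s" "Cod C j = Dom C s"
    "j \<bullet> s = Idt C (Dom C s)" "s \<bullet> j = rs j"
    using assms by (simp_all add: rsec_def)
  show "total_arr X s"
    by (rule total_comp_cancel[of j]) (simp_all add: *)
qed

lemma rsec_comp: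
  assumes "rsec s j" "f \<in> Arr C" "Cod C f = Dom C s"
  shows "j \<bullet> (s \<bullet> f) = f"
  using assms rsecD[OF assms(1)] by (simp flip: category_assoc)

lemma rsec_comp':
  assumes "rsec s j" "f \<in> Arr C" "Cod C f = Cod C s"
  shows "s \<bullet> (j \<bullet> f) = rs j \<bullet> f"
  using assms rsecD[OF assms(1)] by (simp flip: category_assoc)

lemma rsec_iff: "rsec s j \<longleftrightarrow> total_arr X s \<and> restricted_inverse X s j"
proof
  assume s: "rsec s j"
  show "total_arr X s \<and> restricted_inverse X s j"
    using rsecD[OF s] by (simp add: restricted_inverse_def hom_def)
next
  assume "total_arr X s \<and> restricted_inverse X s j"
  then show "rsec s j"
    by (simp add: restricted_inverse_def hom_def Let_def rsec_def)
qed

text \<open>Since \<open>j i = j' i\<close>, inserting \<open>i\<close> gives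
  \<open>j = j' rs j\<close> and \<open>j' = j rs j'\<close>. Hence \<open>j = j rs j' rs j\<close>,
  and after the two idempotents are swapped by R2 this collapses to
  \<open>j rs j' = j'\<close>.\<close>

lemma restricted_inverse_unique:
  assumes i: "restricted_inverse X i j" and i': "restricted_inverse X i j'"
  shows "j = j'"
proof -
  have eq: "i \<in> Arr C" "j \<in> Arr C" "j' \<in> Arr C" "Dom C j = Cod C i" "Cod C j = Dom C i" "Dom C j' = Cod C i"
    "Cod C j' = Dom C i" "j \<bullet> i = rs i" "i \<bullet> j = rs j" "j' \<bullet> i = rs i" "i \<bullet> j' = rs j'"
    using assms by (simp_all add: restricted_inverse_def Let_def hom_def)
  have a: "(x \<bullet> i) \<bullet> y = x \<bullet> (i \<bullet> y)" if "x \<in> {j, j'}" "y \<in> {j, j'}" for x y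
    by (rule category_assoc) (use that eq in auto)
  have "j = j' \<bullet> rs j"
    using a[of j j] a[of j' j] eq by simp
  moreover have "j' = j \<bullet> rs j'"
    using a[of j' j'] a[of j j'] eq by simp
  ultimately have "j = (j \<bullet> rs j') \<bullet> rs j" by simp
  also have "\<dots> = j \<bullet> (rs j \<bullet> rs j')"
    using eq by (simp add: category_assoc R2[of j' j])
  also have "\<dots> = (j \<bullet> rs j) \<bullet> rs j'"
    using eq by (simp only: category_assoc category_C rs_Arr rs_Dom rs_Cod)
  also have "\<dots> = j'" using eq \<open>j' = j \<bullet> rs j'\<close> by simp
  finally show ?thesis .
qed

lemma rinv_eq: "rsec s j \<Longrightarrow> rinv X s = j"
  unfolding rinv_def by (rule the_equality) (auto simp: rsec_iff intro: restricted_inverse_unique)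

lemma rsec_Idt: "A \<in> Obj C \<Longrightarrow> rsec (Idt C A) (Idt C A)"
  by (simp add: rsec_def)

text \<open>The idempotent law \<open>t s j k = rs (j k)\<close> is the point: R4 turns
  \<open>rs j k\<close> into \<open>k rs (j k)\<close>, and \<open>t k = rs k\<close> is then
  absorbed by \<open>rs (j k)\<close>.\<close>

lemma rsec_trans:
  assumes s: "rsec s j" and t: "rsec t k" and eq: "Cod C s = Dom C t"
  shows "rsec (t \<bullet> s) (j \<bullet> k)"
proof -
  note [simp] = rsecD[OF s] rsecD[OF t] eq
  have "t \<bullet> (rs j \<bullet> k) = rs (j \<bullet> k)"
    using R4[of k j] rs_comp_absorb(2)[of k j] rsec_comp'[OF t, of "rs (j \<bullet> k)"] by simp
  then show ?thesis
    unfolding rsec_def by (simp add: category_assoc rsec_comp[OF t] rsec_comp'[OF s])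
qed

subsection \<open>The category of total morphisms\<close>

abbreviation "T \<equiv> total_cat X"

lemma total_cat_simps [simp]:
  "Obj T = Obj C" "f \<in> Arr T \<longleftrightarrow> total_arr X f" "Idt T = Idt C"
  "total_arr X f \<Longrightarrow> Dom T f = Dom C f" "total_arr X f \<Longrightarrow> Cod T f = Cod C f"
  "total_arr X f \<Longrightarrow> total_arr X g \<Longrightarrow> Cod C f = Dom C g \<Longrightarrow> g \<cdot>\<^bsub>T\<^esub> f = g \<bullet> f"
  by (simp_all add: total_cat_def Let_def)

lemma category_total_cat [simp]: "category T"
proof (rule categoryI)
  show "Dom T \<in> extensional (Arr T)" "Cod T \<in> extensional (Arr T)"
    by (simp_all add: total_cat_def Let_def)
  show "Idt T \<in> extensional (Obj T)" using category_extensional(3)[of C] by simp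
  show "g \<cdot>\<^bsub>T\<^esub> f = undefined" if "\<not> (f \<in> Arr T \<and> g \<in> Arr T \<and> Cod T f = Dom T g)" for f g
    using that by (auto simp: total_cat_def Let_def)
qed (auto simp: total_comp category_assoc)

lemma Total0_simps [simp]: "fst (Total0 X) = T" "s \<in> snd (Total0 X) \<longleftrightarrow> (\<exists>j. rsec s j)"
  by (auto simp: Total0_def restricted_iso_def rsec_iff)

text \<open>The retraction \<open>j\<close> need not be total, so \<open>s\<close> need not be a
  split monomorphism in \<open>T\<close>; it is cancelled in the ambient category
  \<open>C\<close>.\<close>

lemma rsec_mono: "rsec s j \<Longrightarrow> mono_arr T s"
  unfolding mono_arr_def
proof (intro conjI ballI impI)
  fix a b assume *: "rsec s j" "a \<in> Arr T" "b \<in> Arr T" "Dom T a = Dom T b \<and> Cod T a = Dom T s \<and>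
    Cod T b = Dom T s \<and> s \<cdot>\<^bsub>T\<^esub> a = s \<cdot>\<^bsub>T\<^esub> b"
  note [simp] = rsecD[OF *(1)]
  have "j \<bullet> (s \<bullet> a) = j \<bullet> (s \<bullet> b)" using * by auto
  with * show "a = b" by (auto simp: rsec_comp)
qed (simp add: rsecD)

text \<open>A commuting square of total morphisms is a pullback along the section \<open>s\<close> iff \<open>s'\<close> splits the
  domain of definition of \<open>j \<bullet> f\<close>. This is an equational condition, hence preserved by every
  restriction functor.\<close>

lemma total_pullbackI:
  assumes f: "total_arr X f" "total_arr X f'" and s: "rsec s j" and s': "rsec s' j'"
    and eq: "Cod C f = Cod C s" "Cod C s' = Dom C f" "Dom C f' = Dom C s'" "Cod C f' = Dom C s"
      "f \<bullet> s' = s \<bullet> f'" "rs j' = rs (j \<bullet> f)"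
  shows "pullback T f s s' f'"
proof (rule pullbackI)
  note [simp] = f s s' eq rsecD[OF s] rsecD[OF s'] rsec_comp[OF s] rsec_comp[OF s'] rsec_comp'[OF s']
  fix a b assume "a \<in> Arr T" "b \<in> Arr T" "Dom T a = Dom T b" "Cod T a = Dom T f" "Cod T b = Dom T s"
    "f \<cdot>\<^bsub>T\<^esub> a = s \<cdot>\<^bsub>T\<^esub> b"
  then have ab [simp]: "total_arr X a" "total_arr X b" "Dom C a = Dom C b" "Cod C a = Dom C f"
    "Cod C b = Dom C s" and fa: "f \<bullet> a = s \<bullet> b" by auto
  have jfa: "j \<bullet> (f \<bullet> a) = b" using fa by simp
  \<comment> \<open>The mediating arrow is \<open>j' a\<close>. From \<open>rs j' = rs (j f)\<close>
    and R4 one gets \<open>s' j' a = rs (j f) a = a rs (j f a) = a rs b = a\<close>, because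
    \<open>b\<close> is total.\<close>
  have 1: "s' \<bullet> (j' \<bullet> a) = a"
    using R4[of a "j \<bullet> f"] jfa by (simp add: category_assoc)
  have "f' \<bullet> (j' \<bullet> a) = j \<bullet> (s \<bullet> (f' \<bullet> (j' \<bullet> a)))"
    by simp
  also have "s \<bullet> (f' \<bullet> (j' \<bullet> a)) = (s \<bullet> f') \<bullet> (j' \<bullet> a)"
    by (rule category_assoc[symmetric]) simp_all
  also have "\<dots> = f \<bullet> (s' \<bullet> (j' \<bullet> a))"
    unfolding eq(5)[symmetric] by (rule category_assoc) simp_all
  finally have 2: "f' \<bullet> (j' \<bullet> a) = b" using 1 jfa by simp
  have 3: "total_arr X (j' \<bullet> a)"
    by (rule total_comp_cancel[of s']) (use 1 in simp_all)
  show "\<exists>u\<in>Arr T. Dom T u = Dom T a \<and> Cod T u = Dom T s' \<and> s' \<cdot>\<^bsub>T\<^esub> u = a \<and> f' \<cdot>\<^bsub>T\<^esub> u = b"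
    by (rule bexI[of _ "j' \<bullet> a"]) (use 1 2 3 in simp_all)
next
  fix u v assume "u \<in> Arr T" "v \<in> Arr T" "Dom T u = Dom T v" "Cod T u = Dom T s'" "Cod T v = Dom T s'"
    "s' \<cdot>\<^bsub>T\<^esub> u = s' \<cdot>\<^bsub>T\<^esub> v"
  then show "u = v" using mono_arrD[OF rsec_mono[OF s'], of u v] by blast
qed (use assms rsecD(7)[OF s] rsecD(7)[OF s'] in auto)

end

section \<open>Pullbacks of total restricted isomorphisms when restriction idempotents split\<close>

locale split_restriction =
  fixes X :: "('o, 'm) cat \<times> ('m \<Rightarrow> 'm)"
  assumes split_restriction_cat: "split_restriction_cat X"

sublocale split_restriction \<subseteq> restriction
  using split_restriction_cat by unfold_locales (simp add: split_restriction_cat_def)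

context split_restriction begin

text \<open>A splitting \<open>m\<close>, \<open>q\<close> of \<open>rs f\<close> has
  \<open>m\<close> total by cancellation of \<open>q\<close>, so
  \<open>rs q = rs (m q) = rs (rs f) = rs f\<close>. Thus it is an \<open>rsec\<close> pair whose
  idempotent is \<open>rs f\<close>.\<close>

lemma rs_split:
  assumes "f \<in> Arr C"
  obtains s j where "rsec s j" "Cod C s = Dom C f" "rs j = rs f"
proof -
  obtain m q where mq: "m \<in> Arr C" "q \<in> Arr C" "Cod C q = Dom C m" "Cod C m = Dom C q"
    "rs f = m \<bullet> q" "q \<bullet> m = Idt C (Dom C m)"
    using split_restriction_cat assms unfolding split_restriction_cat_def Let_def
    by (metis rs_Arr rs_rs)
  have "total_arr X m"
    by (rule total_comp_cancel[of q]) (use mq in simp_all)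
  then have "rs q = rs f"
    using rs_total_comp[of q m] mq assms by simp (metis rs_rs)
  moreover have "Dom C q = Dom C f" using mq assms by (metis rs_Dom category_simps(7) category_C)
  ultimately show thesis using mq by (intro that[of m q]) (simp_all add: rsec_def)
qed

text \<open>The inverse image of \<open>s\<close> under \<open>f\<close> is where \<open>j f\<close>
  is defined, so a splitting \<open>m\<close> of \<open>rs (j f)\<close> is the required pullback of
  \<open>s\<close>. The other projection is \<open>j f m\<close>.\<close>

lemma total_pullback_exists:
  assumes s: "rsec s j" and f: "total_arr X f" "Cod C f = Cod C s"
  obtains s' j' f' where "rsec s' j'" "rs j' = rs (j \<bullet> f)" "pullback T f s s' f'"
proof -
  obtain m q where m: "rsec m q" and eq: "Cod C m = Dom C f" "rs q = rs (j \<bullet> f)"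
    by (rule rs_split[of "j \<bullet> f"]) (use f rsecD[OF s] in auto)
  note [simp] = f s m rsecD[OF s] rsecD[OF m] rsec_comp[OF s] rsec_comp[OF m] rsec_comp'[OF s] eq(1)
  have "rs (j \<bullet> f) \<bullet> m = m"
    using rsec_comp'[OF m, of m] eq(2) by simp
  \<comment> \<open>\<open>f m\<close> lies in the image of \<open>s\<close>: by R4 and
    \<open>rs (j f) m = m\<close>, one has
    \<open>s j f m = rs j f m = f rs (j f) m = f m\<close>.\<close>
  then have 1: "s \<bullet> (j \<bullet> (f \<bullet> m)) = f \<bullet> m"
    using R4[of f j] by simp (simp flip: category_assoc, simp add: category_assoc)
  have "total_arr X (f \<bullet> m)" by (rule total_comp) simp_all
  then have "total_arr X (j \<bullet> (f \<bullet> m))"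
    using total_comp_cancel[of s "j \<bullet> (f \<bullet> m)"] by (simp add: 1)
  then have "pullback T f s m (j \<bullet> (f \<bullet> m))"
    using 1 eq by (intro total_pullbackI[OF _ _ s m]) simp_all
  with m eq show thesis by (intro that[of m q])
qed

text \<open>An arbitrary pullback is isomorphic to the one obtained from a splitting
  \<open>m\<close>, \<open>q\<close> of \<open>rs (j f)\<close>. Along the comparison
  \<open>k\<close> the retraction \<open>q\<close> becomes \<open>k q\<close>, and totality of
  \<open>k\<close> gives \<open>rs (k q) = rs q\<close>.\<close>

lemma total_pullbackE:
  assumes s: "rsec s j" and p: "pullback T f s s' f'"
  obtains j' where "rsec s' j'" "rs j' = rs (j \<bullet> f)"
proof -
  note P = pullbackD[OF p]
  have f: "total_arr X f" "total_arr X s'" using P by simp_all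
  obtain m q g where m: "rsec m q" and eq: "rs q = rs (j \<bullet> f)" and p': "pullback T f s m g"
    by (rule total_pullback_exists[OF s, of f]) (use P f rsecD[OF s] in auto)
  obtain i k where i: "i \<in> Arr T" "Dom T i = Dom T s'" "Cod T i = Dom T m"
    "k \<in> Arr T" "Dom T k = Dom T m" "Cod T k = Dom T s'"
    "k \<cdot>\<^bsub>T\<^esub> i = Idt T (Dom T s')" "i \<cdot>\<^bsub>T\<^esub> k = Idt T (Dom T m)"
    "m \<cdot>\<^bsub>T\<^esub> i = s'" "s' \<cdot>\<^bsub>T\<^esub> k = m"
    by (rule pullback_unique_iso[OF category_total_cat p p']) auto
  note [simp] = f s m rsecD[OF s] rsecD[OF m] rsec_comp[OF m]
  have I: "total_arr X i" "Dom C i = Dom C s'" "Cod C i = Dom C m" "total_arr X k" "Dom C k = Dom C m"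
    "Cod C k = Dom C s'" "k \<bullet> i = Idt C (Dom C s')" "i \<bullet> k = Idt C (Dom C m)" "m \<bullet> i = s'" "s' \<bullet> k = m"
    using i by auto
  note [simp] = I(1-8)
  have [simp]: "Cod C s' = Cod C m" using I(9) by (metis I(1,3) m rsecD(1) category_simps(8) category_C total_arrD(1))
  have "(k \<bullet> q) \<bullet> (m \<bullet> i) = Idt C (Dom C s')" by (simp add: category_assoc)
  then have 1: "(k \<bullet> q) \<bullet> s' = Idt C (Dom C s')" by (simp add: I(9))
  have 2: "s' \<bullet> (k \<bullet> q) = rs q" by (simp add: I(10) flip: category_assoc)
  have "rs (k \<bullet> q) = rs q" by (rule rs_total_comp) simp_all
  with 1 2 eq show thesis by (intro that[of "k \<bullet> q"]) (simp_all add: rsec_def)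
qed

lemma stable_cat_Total0: "stable_cat (Total0 X)"
  unfolding stable_cat_def Let_def
proof (intro conjI ballI allI impI)
  show "snd (Total0 X) \<subseteq> Arr (fst (Total0 X))" by (auto dest: rsecD(7))
  show "f \<in> snd (Total0 X)" if iso: "iso_arr (fst (Total0 X)) f" for f
  proof -
    obtain g where "f \<in> Arr T" "g \<in> Arr T" "Dom T g = Cod T f" "Cod T g = Dom T f"
      "g \<cdot>\<^bsub>T\<^esub> f = Idt T (Dom T f)" "f \<cdot>\<^bsub>T\<^esub> g = Idt T (Cod T f)"
      using iso_arrE[OF iso[unfolded Total0_simps(1)]] by blast
    then have "rsec f g" by (auto simp: rsec_def)
    then show ?thesis by auto
  qed
  note total = rsecD(7)
  show "t \<cdot>\<^bsub>fst (Total0 X)\<^esub> s \<in> snd (Total0 X)"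
    if "s \<in> snd (Total0 X)" "t \<in> snd (Total0 X)" "Cod (fst (Total0 X)) s = Dom (fst (Total0 X)) t" for s t
    using that by (auto simp: total) (metis rsec_trans)
  show "\<exists>s' f'. pullback (fst (Total0 X)) f s s' f'"
    if "s \<in> snd (Total0 X)" "f \<in> Arr (fst (Total0 X))" "Cod (fst (Total0 X)) f = Cod (fst (Total0 X)) s" for s f
    using that by (auto simp: total) (metis total_pullback_exists)
  show "s' \<in> snd (Total0 X)" if "s \<in> snd (Total0 X)" "pullback (fst (Total0 X)) f s s' f'" for s f s' f'
    using that by simp (metis total_pullbackE)
qed simp

end

subsection \<open>Restriction functors and total transformations\<close>

locale restriction_fun =
  fixes F :: "('o, 'm, 'm \<Rightarrow> 'm) onecell"
  assumes restriction_functor: "restriction_functor F"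

sublocale restriction_fun \<subseteq> X: split_restriction "Src F"
  using restriction_functor by unfold_locales (simp add: restriction_functor_def)

sublocale restriction_fun \<subseteq> Y: split_restriction "Tgt F"
  using restriction_functor by unfold_locales (simp add: restriction_functor_def)

context restriction_fun begin

lemma functor_cell [simp]: "functor_cell F"
  and AMap_rs: "f \<in> Arr X.C \<Longrightarrow> AMap F (X.rs f) = Y.rs (AMap F f)"
  using restriction_functor by (simp_all add: restriction_functor_def)

lemma AMap_total [simp]: "total_arr (Src F) f \<Longrightarrow> total_arr (Tgt F) (AMap F f)"
  by (rule Y.total_arrI) (simp_all flip: AMap_rs)

lemma AMap_rsec:
  assumes s: "X.rsec s j"
  shows "Y.rsec (AMap F s) (AMap F j)"
proof -
  note S = X.rsecD[OF s]
  have "AMap F j \<cdot>\<^bsub>Y.C\<^esub> AMap F s = AMap F (j \<cdot>\<^bsub>X.C\<^esub> s)" "AMap F s \<cdot>\<^bsub>Y.C\<^esub> AMap F j = AMap F (s \<cdot>\<^bsub>X.C\<^esub> j)"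
    using S(1-4) by simp_all
  then show ?thesis
    using S(1-4) unfolding Y.rsec_def by (simp add: S(5,6) AMap_rs)
qed

end

lemma restriction_functor_id:
  assumes "split_restriction_cat X"
  shows "restriction_functor (id_cell X)"
proof -
  interpret split_restriction X by unfold_locales fact
  show ?thesis using assms by (simp add: restriction_functor_def functor_cell_id)
qed

lemma restriction_functor_comp:
  assumes F: "restriction_functor F" and G: "restriction_functor G" and eq: "Tgt F = Src G"
  shows "restriction_functor (comp_cell G F)"
proof -
  interpret F: restriction_fun F by unfold_locales fact
  interpret G: restriction_fun G by unfold_locales fact
  have "AMap F f \<in> Arr (SrcC G)" if "f \<in> Arr (SrcC F)" for f
    using functor_cell_simps(4)[OF F.functor_cell that] eq by simp
  then show ?thesis
    using F G eq functor_cell_comp[OF F.functor_cell G.functor_cell eq] F.AMap_rs G.AMap_rs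
    by (simp add: restriction_functor_def)
qed

lemma total_natD:
  assumes "total_nat \<alpha>"
  shows "restriction_functor (Src2 \<alpha>)" "restriction_functor (Tgt2 \<alpha>)" "nat_cell \<alpha>"
    "A \<in> Obj (SrcC (Src2 \<alpha>)) \<Longrightarrow> total_arr (Tgt (Src2 \<alpha>)) (Cpt \<alpha> A)"
  using assms by (simp_all add: total_nat_def)

lemma total_nat_id:
  assumes F: "restriction_functor F"
  shows "total_nat (id_nat F)"
proof -
  interpret F: restriction_fun F by unfold_locales fact
  show ?thesis using F by (simp add: total_nat_def nat_cell_id)
qed

lemma total_nat_vcomp:
  assumes a: "total_nat \<alpha>" and b: "total_nat \<beta>" and eq: "Tgt2 \<alpha> = Src2 \<beta>"
  shows "total_nat (vcomp_nat \<beta> \<alpha>)"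
proof -
  note A = total_natD[OF a] and B = total_natD[OF b]
  interpret F: restriction_fun "Src2 \<alpha>" by unfold_locales (rule A)
  note N = nat_cell_simps[OF A(3)]
  show ?thesis
    using A B N(3,4) eq nat_cell_vcomp[OF A(3) B(3) eq]
      nat_cell_simps[OF A(3)] nat_cell_simps(6,7)[OF B(3)]
    by (auto simp: total_nat_def intro!: F.Y.total_comp)
qed

lemma total_nat_hcomp:
  assumes a: "total_nat \<alpha>" and b: "total_nat \<beta>" and eq: "Tgt (Src2 \<alpha>) = Src (Src2 \<beta>)"
  shows "total_nat (hcomp_nat \<beta> \<alpha>)"
proof -
  note A = total_natD[OF a] and B = total_natD[OF b]
  interpret F: restriction_fun "Src2 \<beta>" by unfold_locales (rule B)
  note N = nat_cell_simps[OF A(3)] nat_cell_simps[OF B(3)]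
  have "total_arr (Tgt (Src2 \<beta>)) (Cpt \<beta> (OMap (Tgt2 \<alpha>) X) \<cdot>\<^bsub>TgtC (Src2 \<beta>)\<^esub> AMap (Src2 \<beta>) (Cpt \<alpha> X))"
    if X: "X \<in> Obj (SrcC (Src2 \<alpha>))" for X
    using X A(4)[OF X] B(4) N eq by (intro F.Y.total_comp) auto
  then show ?thesis
    using A B N(3,4,15) eq nat_cell_hcomp[OF A(3) B(3) eq[symmetric]]
    by (auto simp: total_nat_def intro!: restriction_functor_comp)
qed

lemma restriction_functorD:
  assumes "restriction_functor F"
  shows "functor_cell F" "split_restriction_cat (Src F)" "split_restriction_cat (Tgt F)"
  using assms by (simp_all add: restriction_functor_def)

lemma two_category_SplitRestCat: "two_category SplitRestCat"
  unfolding SplitRestCat_def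
proof (rule two_category_struct, unfold mem_Collect_eq)
  show "category (fst X)" if "split_restriction_cat X" for X :: "('a, 'b) cat \<times> ('b \<Rightarrow> 'b)"
    using that by (simp add: split_restriction_cat_def restriction_cat_def Let_def)
qed (auto intro: restriction_functor_id restriction_functor_comp total_nat_id total_nat_vcomp
    total_nat_hcomp dest: restriction_functorD total_natD)

section \<open>The cells of the monic sub-2-category as predicates\<close>

definition mono_stable :: "('o, 'm) cat \<times> 'm set \<Rightarrow> bool" where
  "mono_stable K \<longleftrightarrow> stable_cat K \<and> (\<forall>s\<in>snd K. mono_arr (fst K) s)"

definition mono_functor :: "('o, 'm, 'm set) onecell \<Rightarrow> bool" where
  "mono_functor F \<longleftrightarrow> stable_functor F \<and> mono_stable (Src F) \<and> mono_stable (Tgt F)"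

definition mono_nat :: "('o, 'm, 'm set) twocell \<Rightarrow> bool" where
  "mono_nat \<alpha> \<longleftrightarrow> stable_nat \<alpha> \<and> mono_stable (Src (Src2 \<alpha>)) \<and> mono_stable (Tgt (Src2 \<alpha>))"

text \<open>This presentation makes the generic lemmas on \<open>struct_twocat\<close> applicable to
  \<open>StableCat_mono\<close>. The predicates demand stability of source and target explicitly,
  which stable functors have anyway.\<close>

lemma StableCat_mono_eq:
  "StableCat_mono = struct_twocat {K. mono_stable K} {F. mono_functor F} {\<alpha>. mono_nat \<alpha>}"
  unfolding StableCat_mono_def StableCat_def full_sub_struct mono_functor_def mono_nat_def mono_stable_def
  by (rule arg_cong3[where f = struct_twocat]) (auto dest: stable_natD(1) stable_functorD(1,2))

lemma two_category_StableCat_mono: "two_category StableCat_mono"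
  unfolding StableCat_mono_def by (rule two_category_StableCat_sub)

section \<open>The 2-functor Total\<close>

lemma (in split_restriction) mono_stable_Total0: "mono_stable (Total0 X)"
  unfolding mono_stable_def using stable_cat_Total0 by (auto intro: rsec_mono)

lemma Total1_Src_Tgt: "Src (Total1 F) = Total0 (Src F)" "Tgt (Total1 F) = Total0 (Tgt F)"
  by (simp_all add: Total1_def)

context restriction_fun begin

lemma Total1_simps [simp]:
  "Src (Total1 F) = Total0 (Src F)" "Tgt (Total1 F) = Total0 (Tgt F)"
  "OMap (Total1 F) = OMap F" "total_arr (Src F) f \<Longrightarrow> AMap (Total1 F) f = AMap F f"
  by (simp_all add: Total1_def)

lemma functor_cell_Total1: "functor_cell (Total1 F)"
proof (rule functor_cellI)
  show "AMap (Total1 F) \<in> extensional (Arr (SrcC (Total1 F)))"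
    by (auto simp: Total1_def extensional_def)
  show "OMap (Total1 F) \<in> extensional (Obj (SrcC (Total1 F)))"
    using functor_cell_simps(9)[OF functor_cell] by simp
qed (auto simp: X.total_comp)

lemma mono_functor_Total1: "mono_functor (Total1 F)"
  unfolding mono_functor_def stable_functor_def
proof (intro conjI ballI allI impI)
  show "functor_cell (Total1 F)" by (rule functor_cell_Total1)
  show "AMap (Total1 F) ` snd (Src (Total1 F)) \<subseteq> snd (Tgt (Total1 F))"
    by (auto simp: X.rsecD(7)) (metis AMap_rsec)
  fix s f s' f'
  assume "s \<in> snd (Src (Total1 F))" and "pullback (SrcC (Total1 F)) f s s' f'"
  then obtain j where s: "X.rsec s j" and p: "pullback X.T f s s' f'" by auto
  \<comment> \<open>The pullback is used through this equation and the commuting square, both of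
    which \<open>F\<close> preserves; they suffice for a pullback in the target.\<close>
  obtain j' where s': "X.rsec s' j'" and eq: "X.rs j' = X.rs (j \<cdot>\<^bsub>X.C\<^esub> f)"
    by (rule X.total_pullbackE[OF s p])
  note S = X.rsecD[OF s] X.rsecD[OF s']
  have P: "total_arr (Src F) f" "total_arr (Src F) f'" "Cod X.C f = Cod X.C s" "Cod X.C s' = Dom X.C f"
    "Dom X.C f' = Dom X.C s'" "Cod X.C f' = Dom X.C s" "f \<cdot>\<^bsub>X.C\<^esub> s' = s \<cdot>\<^bsub>X.C\<^esub> f'"
    using pullbackD[OF p] S by auto
  have "pullback Y.T (AMap F f) (AMap F s) (AMap F s') (AMap F f')"
  proof (rule Y.total_pullbackI[OF _ _ AMap_rsec[OF s] AMap_rsec[OF s']])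
    show "AMap F f \<cdot>\<^bsub>Y.C\<^esub> AMap F s' = AMap F s \<cdot>\<^bsub>Y.C\<^esub> AMap F f'"
      using arg_cong[OF P(7), of "AMap F"] P(1-6) S by simp
    show "Y.rs (AMap F j') = Y.rs (AMap F j \<cdot>\<^bsub>Y.C\<^esub> AMap F f)"
      using arg_cong[OF eq, of "AMap F"] P(1-6) S by (simp add: AMap_rs)
  qed (use P S in auto)
  then show "pullback (TgtC (Total1 F)) (AMap (Total1 F) f) (AMap (Total1 F) s)
      (AMap (Total1 F) s') (AMap (Total1 F) f')"
    using P S by simp
qed (use X.mono_stable_Total0 Y.mono_stable_Total0 in \<open>auto simp: mono_stable_def\<close>)

end

lemma Total2_simps [simp]:
  "Src2 (Total2 \<alpha>) = Total1 (Src2 \<alpha>)" "Tgt2 (Total2 \<alpha>) = Total1 (Tgt2 \<alpha>)" "Cpt (Total2 \<alpha>) = Cpt \<alpha>"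
  by (simp_all add: Total2_def)

lemma mono_nat_Total2:
  assumes a: "total_nat \<alpha>"
  shows "mono_nat (Total2 \<alpha>)"
  unfolding mono_nat_def stable_nat_def Let_def
proof (intro conjI ballI)
  note A = total_natD[OF a]
  note N = nat_cell_simps[OF A(3)]
  interpret F: restriction_fun "Src2 \<alpha>" by unfold_locales (rule A)
  interpret G: restriction_fun "Tgt2 \<alpha>" by unfold_locales (rule A)
  note [simp] = N A(4)
  note [simp] = F.AMap_total G.AMap_total[simplified]
  show "nat_cell (Total2 \<alpha>)"
    by (rule nat_cellI)
      (use nat_cell_natural[OF A(3)] in \<open>auto intro: F.functor_cell_Total1 G.functor_cell_Total1\<close>)
  show "stable_functor (Src2 (Total2 \<alpha>))" "stable_functor (Tgt2 (Total2 \<alpha>))"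
    using F.mono_functor_Total1 G.mono_functor_Total1 by (simp_all add: mono_functor_def)
  show "mono_stable (Src (Src2 (Total2 \<alpha>)))" "mono_stable (Tgt (Src2 (Total2 \<alpha>)))"
    using F.X.mono_stable_Total0 F.Y.mono_stable_Total0 by simp_all
  fix s assume "s \<in> snd (Src (Src2 (Total2 \<alpha>)))"
  then obtain j where s: "F.X.rsec s j" by auto
  note S [simp] = F.X.rsecD[OF s]
  let ?a = "Cpt \<alpha> (Cod F.X.C s)" and ?b = "Cpt \<alpha> (Dom F.X.C s)"
  have Gs: "F.Y.rsec (AMap (Tgt2 \<alpha>) s) (AMap (Tgt2 \<alpha>) j)"
    using G.AMap_rsec[simplified, OF s] .
  \<comment> \<open>Naturality is applied at the partial map \<open>j\<close>. As the component
    \<open>?b\<close> is total, \<open>rs (F j) = rs (?b F j) = rs (G j ?a)\<close>, for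
    \<open>F\<close> and \<open>G\<close> the source and target of \<open>\<alpha>\<close>; this is
    the equation that makes the square at \<open>s\<close> a pullback.\<close>
  have "F.Y.rs (AMap (Src2 \<alpha>) j) = F.Y.rs (?b \<cdot>\<^bsub>F.Y.C\<^esub> AMap (Src2 \<alpha>) j)"
    by (rule F.Y.rs_total_comp[symmetric]) simp_all
  also have "?b \<cdot>\<^bsub>F.Y.C\<^esub> AMap (Src2 \<alpha>) j = AMap (Tgt2 \<alpha>) j \<cdot>\<^bsub>F.Y.C\<^esub> ?a"
    using nat_cell_natural[OF A(3), of j] by simp
  finally have "pullback F.Y.T ?a (AMap (Tgt2 \<alpha>) s) (AMap (Src2 \<alpha>) s) ?b"
    using nat_cell_natural[OF A(3), of s]
    by (intro F.Y.total_pullbackI[OF _ _ Gs F.AMap_rsec[OF s]]) simp_all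
  then show "pullback (TgtC (Src2 (Total2 \<alpha>))) (Cpt (Total2 \<alpha>) (Cod (SrcC (Src2 (Total2 \<alpha>))) s))
      (AMap (Tgt2 (Total2 \<alpha>)) s) (AMap (Src2 (Total2 \<alpha>)) s)
      (Cpt (Total2 \<alpha>) (Dom (SrcC (Src2 (Total2 \<alpha>))) s))"
    by simp
qed

lemma two_functor_Total: "two_functor SplitRestCat StableCat_mono TotalF"
proof -
  have id: "Total1 (id_cell X) = id_cell (Total0 X)" if "split_restriction_cat X"
    for X :: "('a, 'b) cat \<times> ('b \<Rightarrow> 'b)"
  proof -
    interpret split_restriction X by unfold_locales fact
    interpret restriction_fun "id_cell X" by unfold_locales (rule restriction_functor_id[OF that])
    show ?thesis
      by (rule onecell_eqI) (use functor_cell_Total1 in \<open>auto intro: functor_cell_id\<close>)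
  qed
  have comp: "Total1 (comp_cell G F) = comp_cell (Total1 G) (Total1 F)"
    if F: "restriction_functor F" and G: "restriction_functor G" and eq: "Tgt F = Src G"
    for F G :: "('a, 'b, 'b \<Rightarrow> 'b) onecell"
  proof -
    interpret F: restriction_fun F by unfold_locales fact
    interpret G: restriction_fun G by unfold_locales fact
    interpret GF: restriction_fun "comp_cell G F"
      by unfold_locales (rule restriction_functor_comp[OF F G eq])
    show ?thesis
    proof (rule onecell_eqI)
      show "functor_cell (comp_cell (Total1 G) (Total1 F))"
        by (rule functor_cell_comp) (simp_all add: F.functor_cell_Total1 G.functor_cell_Total1 eq)
      fix f assume "f \<in> Arr (SrcC (Total1 (comp_cell G F)))"
      then have f: "total_arr (Src F) f" by simp
      then show "AMap (Total1 (comp_cell G F)) f = AMap (comp_cell (Total1 G) (Total1 F)) f"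
        using F.AMap_total[OF f] eq by simp
    qed (use GF.functor_cell_Total1 in simp_all)
  qed
  have id2: "Total2 (id_nat F) = id_nat (Total1 F)" if "restriction_functor F"
    for F :: "('a, 'b, 'b \<Rightarrow> 'b) onecell"
  proof -
    interpret restriction_fun F by unfold_locales fact
    show ?thesis
      by (rule twocell_eqI)
        (use mono_nat_Total2[OF total_nat_id[OF that]] functor_cell_Total1 in
          \<open>auto simp: mono_nat_def dest: stable_natD(3) intro: nat_cell_id\<close>)
  qed
  have vcomp: "Total2 (vcomp_nat \<beta> \<alpha>) = vcomp_nat (Total2 \<beta>) (Total2 \<alpha>)"
    if a: "total_nat \<alpha>" and b: "total_nat \<beta>" and eq: "Tgt2 \<alpha> = Src2 \<beta>"
    for \<alpha> \<beta> :: "('a, 'b, 'b \<Rightarrow> 'b) twocell"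
  proof (rule twocell_eqI)
    note A = total_natD[OF a] and B = total_natD[OF b]
    note nA = nat_cell_simps[OF A(3)] and nB = nat_cell_simps[OF B(3)]
    interpret F: restriction_fun "Src2 \<alpha>" by unfold_locales (rule A)
    show "nat_cell (Total2 (vcomp_nat \<beta> \<alpha>))"
      using mono_nat_Total2[OF total_nat_vcomp[OF a b eq]] by (simp add: mono_nat_def stable_natD(3))
    show "nat_cell (vcomp_nat (Total2 \<beta>) (Total2 \<alpha>))"
      using mono_nat_Total2[OF a] mono_nat_Total2[OF b] eq
      by (intro nat_cell_vcomp) (simp_all add: mono_nat_def stable_natD(3))
    fix X assume "X \<in> Obj (SrcC (Src2 (Total2 (vcomp_nat \<beta> \<alpha>))))"
    then show "Cpt (Total2 (vcomp_nat \<beta> \<alpha>)) X = Cpt (vcomp_nat (Total2 \<beta>) (Total2 \<alpha>)) X"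
      using A(4) B(4) nA nB eq by simp
  qed simp_all
  have hcomp: "Total2 (hcomp_nat \<beta> \<alpha>) = hcomp_nat (Total2 \<beta>) (Total2 \<alpha>)"
    if a: "total_nat \<alpha>" and b: "total_nat \<beta>" and eq: "Tgt (Src2 \<alpha>) = Src (Src2 \<beta>)"
    for \<alpha> \<beta> :: "('a, 'b, 'b \<Rightarrow> 'b) twocell"
  proof (rule twocell_eqI)
    note A = total_natD[OF a] and B = total_natD[OF b]
    note nA = nat_cell_simps[OF A(3)] and nB = nat_cell_simps[OF B(3)]
    interpret F: restriction_fun "Src2 \<alpha>" by unfold_locales (rule A)
    interpret G: restriction_fun "Src2 \<beta>" by unfold_locales (rule B)
    interpret F': restriction_fun "Tgt2 \<alpha>" by unfold_locales (rule A)
    interpret G': restriction_fun "Tgt2 \<beta>" by unfold_locales (rule B)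
    show "nat_cell (Total2 (hcomp_nat \<beta> \<alpha>))"
      using mono_nat_Total2[OF total_nat_hcomp[OF a b eq]] by (simp add: mono_nat_def stable_natD(3))
    show "nat_cell (hcomp_nat (Total2 \<beta>) (Total2 \<alpha>))"
      using mono_nat_Total2[OF a] mono_nat_Total2[OF b] eq
      by (intro nat_cell_hcomp) (simp_all add: mono_nat_def stable_natD(3))
    show "Src2 (Total2 (hcomp_nat \<beta> \<alpha>)) = Src2 (hcomp_nat (Total2 \<beta>) (Total2 \<alpha>))"
      "Tgt2 (Total2 (hcomp_nat \<beta> \<alpha>)) = Tgt2 (hcomp_nat (Total2 \<beta>) (Total2 \<alpha>))"
      using A B nA(4) nB(3) eq by (simp_all add: comp)
    fix X assume "X \<in> Obj (SrcC (Src2 (Total2 (hcomp_nat \<beta> \<alpha>))))"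
    then have X: "X \<in> Obj (SrcC (Src2 \<alpha>))" by (simp add: Total1_def)
    have c: "total_arr (Src (Src2 \<beta>)) (Cpt \<alpha> X)" using A(4)[OF X] eq by simp
    show "Cpt (Total2 (hcomp_nat \<beta> \<alpha>)) X = Cpt (hcomp_nat (Total2 \<beta>) (Total2 \<alpha>)) X"
      using X A(4)[OF X] B(4) nA(6-9)[OF X] nB eq G.AMap_total[OF c] c
        functor_cell_simps(5,6)[OF nB(1)] by simp
  qed
  show ?thesis
    unfolding two_functor_def SplitRestCat_def StableCat_mono_eq TotalF_def
      composable1_def vcomposable_def hcomposable_def
  proof (simp only: struct_twocat_simps twofun.simps mem_Collect_eq, intro conjI allI ballI impI)
    show "two_category (struct_twocat {X. split_restriction_cat X} {F. restriction_functor F} {\<alpha>. total_nat \<alpha>})"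
      using two_category_SplitRestCat unfolding SplitRestCat_def .
    show "two_category (struct_twocat {K. mono_stable K} {F. mono_functor F} {\<alpha>. mono_nat \<alpha>})"
      using two_category_StableCat_mono unfolding StableCat_mono_eq .
  qed (auto simp: id comp id2 vcomp hcomp Total1_Src_Tgt mono_nat_Total2
      intro: split_restriction.mono_stable_Total0 split_restriction.intro
      restriction_fun.mono_functor_Total1[OF restriction_fun.intro])
qed

section \<open>Spans as partial maps\<close>

text \<open>For monic left legs, a span \<open>(s, f)\<close> is determined up to isomorphism by the partial function
  \<open>s \<cdot> u \<mapsto> f \<cdot> u\<close> that it induces on generalised elements. Under this embedding the composition
  of spans becomes composition of relations, so that the axioms of a restriction category hold
  because they hold for partial functions.\<close>

definition span_graph :: "('o, 'm) cat \<Rightarrow> 'm \<times> 'm \<Rightarrow> ('m \<times> 'm) set" where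
  "span_graph C p =
     {(fst p \<cdot>\<^bsub>C\<^esub> u, snd p \<cdot>\<^bsub>C\<^esub> u) | u. u \<in> Arr C \<and> Cod C u = Dom C (fst p)}"

text \<open>An infinite type is equipotent with its square. This is the point at which infinitude of
  the morphism type enters.\<close>

lemma inj_pair_code:
  assumes "infinite (UNIV :: 'm set)"
  shows "inj (pair_code :: 'm \<times> 'm \<Rightarrow> 'm)"
proof -
  have "\<exists>c :: 'm \<times> 'm \<Rightarrow> 'm. inj c"
    using card_of_Times_same_infinite[OF assms]
    by (auto simp: card_of_ordIso[symmetric] bij_betw_def)
  then show ?thesis unfolding pair_code_def by (rule someI_ex)
qed

locale mono_span =
  fixes K :: "('o, 'm) cat \<times> 'm set"
  assumes mono_stable: "mono_stable K" and infinite: "infinite (UNIV :: 'm set)"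
begin

abbreviation "C \<equiv> fst K"
abbreviation cmp (infixr "\<odot>" 75) where "g \<odot> f \<equiv> Cmp (fst K) g f"
abbreviation "graph \<equiv> span_graph (fst K)"

lemma stable: "stable_cat K" and mono: "s \<in> snd K \<Longrightarrow> mono_arr C s"
  using mono_stable by (simp_all add: mono_stable_def)

lemma category_C [simp]: "category C"
  using stable by (rule stable_catD)

lemma S_Arr [simp]: "s \<in> snd K \<Longrightarrow> s \<in> Arr C"
  using stable by (rule stable_catD)

lemma Idt_S [simp]: "A \<in> Obj C \<Longrightarrow> Idt C A \<in> snd K"
  using stable by (simp add: stable_catD(3) iso_arr_Idt)

lemma mem_spans [simp]: "(s, f) \<in> spans K \<longleftrightarrow> s \<in> snd K \<and> f \<in> Arr C \<and> Dom C s = Dom C f"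
  by (simp add: spans_def)

lemma graphI: "u \<in> Arr C \<Longrightarrow> Cod C u = Dom C s \<Longrightarrow> s \<odot> u = x \<Longrightarrow> f \<odot> u = y \<Longrightarrow> (x, y) \<in> graph (s, f)"
  by (auto simp: span_graph_def)

lemma graphE:
  assumes "(x, y) \<in> graph (s, f)"
  obtains u where "u \<in> Arr C" "Cod C u = Dom C s" "s \<odot> u = x" "f \<odot> u = y"
  using assms by (auto simp: span_graph_def)

lemma graph_self: "(s, f) \<in> spans K \<Longrightarrow> (s, f) \<in> graph (s, f)"
  by (rule graphI[of "Idt C (Dom C s)"]) simp_all

text \<open>Monicity of \<open>s\<close> recovers the generalised element \<open>u\<close> from
  \<open>s u\<close>, and with it \<open>f u\<close>. Without it the graph would merely be a
  relation.\<close>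

lemma graph_single_valued:
  assumes "(s, f) \<in> spans K" "(x, y) \<in> graph (s, f)" "(x, z) \<in> graph (s, f)"
  shows "y = z"
proof -
  obtain u v where u: "u \<in> Arr C" "Cod C u = Dom C s" "s \<odot> u = x" "f \<odot> u = y"
    and v: "v \<in> Arr C" "Cod C v = Dom C s" "s \<odot> v = x" "f \<odot> v = z"
    using assms(2,3) by (auto elim!: graphE)
  have s: "s \<in> snd K" using assms(1) by simp
  have "Dom C (s \<odot> u) = Dom C u" "Dom C (s \<odot> v) = Dom C v"
    using u(1,2) v(1,2) s by simp_all
  then have "u = v"
    using mono_arrD[OF mono[OF s], of u v] u v by simp
  with u v show ?thesis by simp
qed

lemma graph_typing:
  assumes "(s, f) \<in> spans K" "(x, y) \<in> graph (s, f)"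
  shows "x \<in> Arr C" "y \<in> Arr C" "Dom C y = Dom C x" "Cod C x = Cod C s" "Cod C y = Cod C f"
  using assms by (auto elim!: graphE)

lemma graph_mono:
  assumes "span_mor K p x q"
  shows "graph p \<subseteq> graph q"
proof -
  obtain s f t g where [simp]: "p = (s, f)" "q = (t, g)" by (cases p, cases q) auto
  have X: "s \<in> Arr C" "f \<in> Arr C" "Dom C s = Dom C f" "t \<in> Arr C" "g \<in> Arr C" "Dom C t = Dom C g"
    "x \<in> Arr C" "Dom C x = Dom C s" "Cod C x = Dom C t" "t \<odot> x = s" "g \<odot> x = f"
    using assms by (simp_all add: span_mor_def hom_def)
  show ?thesis
  proof clarsimp
    fix y z assume "(y, z) \<in> graph (s, f)"
    then obtain u where u: "u \<in> Arr C" "Cod C u = Dom C s" "s \<odot> u = y" "f \<odot> u = z"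
      by (rule graphE)
    have "t \<odot> (x \<odot> u) = (t \<odot> x) \<odot> u" "g \<odot> (x \<odot> u) = (g \<odot> x) \<odot> u"
      using X(1-9) u(1,2) by (simp_all add: category_assoc)
    then show "(y, z) \<in> graph (t, g)"
      using X u by (intro graphI[of "x \<odot> u"]) simp_all
  qed
qed

text \<open>A Yoneda argument: the legs of a span form a pair in its own graph, at the identity
  element. Equal graphs therefore give span morphisms in both directions, and these are inverse to
  each other because the left legs are monic.\<close>

lemma graph_eq_iff:
  assumes p: "p \<in> spans K" and q: "q \<in> spans K"
  shows "graph p = graph q \<longleftrightarrow> span_iso K p q"
proof
  obtain s f t g where [simp]: "p = (s, f)" "q = (t, g)" by (cases p, cases q) auto
  note pq [simp] = p[simplified] q[simplified]
  have S: "s \<in> snd K" "t \<in> snd K" using pq by blast+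
  {
    assume eq: "graph p = graph q"
    have "(s, f) \<in> graph q" "(t, g) \<in> graph p"
      using graph_self[of s f] graph_self[of t g] pq eq by simp_all
    then obtain u v where u: "u \<in> Arr C" "Cod C u = Dom C t" "t \<odot> u = s" "g \<odot> u = f"
      and v: "v \<in> Arr C" "Cod C v = Dom C s" "s \<odot> v = t" "f \<odot> v = g"
      by (auto elim!: graphE)
    have "Dom C (t \<odot> u) = Dom C u" "Dom C (s \<odot> v) = Dom C v"
      using u(1,2) v(1,2) S by simp_all
    then have d: "Dom C u = Dom C s" "Dom C v = Dom C t" using u(3) v(3) by simp_all
    have "s \<odot> (v \<odot> u) = s" "t \<odot> (u \<odot> v) = t"
      using u v d S by (simp_all flip: category_assoc)
    then have "v \<odot> u = Idt C (Dom C s)" "u \<odot> v = Idt C (Dom C t)"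
      using mono_arrD[OF mono[OF S(1)], of "v \<odot> u" "Idt C (Dom C s)"]
        mono_arrD[OF mono[OF S(2)], of "u \<odot> v" "Idt C (Dom C t)"] S u v d by simp_all
    then have "iso_arr C u" using u v d by (intro iso_arrI[of _ _ v]) simp_all
    then show "span_iso K p q"
      unfolding span_iso_def span_mor_def using u d pq by (auto simp: hom_def)
  next
    assume "span_iso K p q"
    then obtain x where x: "span_mor K p x q" and iso: "iso_arr C x" by (auto simp: span_iso_def)
    obtain y where y: "y \<in> Arr C" "Dom C y = Cod C x" "Cod C y = Dom C x"
      "y \<odot> x = Idt C (Dom C x)" "x \<odot> y = Idt C (Cod C x)"
      using iso_arrE[OF iso] by blast
    have X: "x \<in> Arr C" "Dom C x = Dom C s" "Cod C x = Dom C t" "t \<odot> x = s" "g \<odot> x = f"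
      using x by (simp_all add: span_mor_def hom_def)
    have "(t \<odot> x) \<odot> y = t" "(g \<odot> x) \<odot> y = g"
      using X(1-3) y S pq by (simp_all add: category_assoc)
    then have "span_mor K q y p"
      using X y pq by (simp add: span_mor_def hom_def)
    with x show "graph p = graph q" by (simp add: graph_mono subset_antisym)
  }
qed

lemma span_iso_iff: "span_iso K p q \<longleftrightarrow> p \<in> spans K \<and> q \<in> spans K \<and> graph p = graph q"
  using graph_eq_iff[of p q] by (auto simp: span_iso_def span_mor_def)

text \<open>The pair of legs of \<open>p\<close> lies in the graph of \<open>q\<close>, and the
  endpoints of a span can be read off any pair in its graph.\<close>

lemma span_iso_Cod:
  assumes "span_iso K p q"
  shows "Cod C (fst p) = Cod C (fst q)" "Cod C (snd p) = Cod C (snd q)"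
  using assms graph_self[of "fst p" "snd p"] graph_typing[of "fst q" "snd q" "fst p" "snd p"]
  by (simp_all add: span_iso_iff)

subsection \<open>The category of spans\<close>

abbreviation "arr \<equiv> span_arr span_iso K"
abbreviation "rep \<equiv> span_rep span_iso K"
abbreviation "P \<equiv> span_cat span_iso K"

lemma arr_eq_iff:
  assumes p: "p \<in> spans K" and q: "q \<in> spans K"
  shows "arr p = arr q \<longleftrightarrow> graph p = graph q"
proof
  let ?cl = "\<lambda>p. {q. span_iso K p q}"
  assume "arr p = arr q"
  \<comment> \<open>Equal codes mean equal chosen members, as \<open>pair_code\<close> is injective.
    The common member lies in both classes.\<close>
  then have eq: "(SOME r. r \<in> ?cl p) = (SOME r. r \<in> ?cl q)"
    unfolding span_arr_def class_code_def using inj_pair_code[OF infinite] by (simp add: inj_eq)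
  have mem: "p \<in> ?cl p" "q \<in> ?cl q" using p q by (simp_all add: span_iso_iff)
  have "(SOME r. r \<in> ?cl p) \<in> ?cl p" using mem(1) by (rule someI)
  moreover have "(SOME r. r \<in> ?cl q) \<in> ?cl q" using mem(2) by (rule someI)
  ultimately obtain r where "r \<in> ?cl p" "r \<in> ?cl q" unfolding eq by blast
  then show "graph p = graph q" by (simp add: span_iso_iff)
next
  assume "graph p = graph q"
  then show "arr p = arr q" using p q by (simp add: span_arr_def span_iso_iff)
qed

lemma rep_arr:
  assumes "p \<in> spans K"
  shows "rep (arr p) \<in> spans K" "arr (rep (arr p)) = arr p" "span_iso K (rep (arr p)) p"
proof -
  have "rep (arr p) \<in> spans K \<and> arr (rep (arr p)) = arr p"
    unfolding span_rep_def by (rule someI[of _ p]) (use assms in simp)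
  then show "rep (arr p) \<in> spans K" "arr (rep (arr p)) = arr p" by simp_all
  then show "span_iso K (rep (arr p)) p"
    using assms arr_eq_iff by (simp add: span_iso_iff)
qed

lemma graph_rep_arr [simp]: "p \<in> spans K \<Longrightarrow> graph (rep (arr p)) = graph p"
  using rep_arr(3)[of p] by (simp add: span_iso_iff)

section \<open>Composition of spans as composition of graphs\<close>

lemma span_cat_simps [simp]:
  "Obj P = Obj C" "Arr P = arr ` spans K"
  "A \<in> Obj C \<Longrightarrow> Idt P A = arr (Idt C A, Idt C A)"
  by (simp_all add: span_cat_def Let_def)

lemma Dom_Cod_arr [simp]:
  assumes "p \<in> spans K"
  shows "Dom P (arr p) = Cod C (fst p)" "Cod P (arr p) = Cod C (snd p)"
  using assms span_iso_Cod[OF rep_arr(3)[OF assms]] by (simp_all add: span_cat_def Let_def)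

text \<open>A generalised element \<open>w\<close> of the pullback is the same as a pair
  \<open>u\<close>, \<open>v\<close> with \<open>f u = t v\<close>, and such pairs are the witnesses
  for membership in the composite relation. Note that \<open>O\<close> composes in diagrammatic
  order.\<close>

lemma graph_comp:
  assumes p: "(s, f) \<in> spans K" and q: "(t, g) \<in> spans K" and pb: "pullback C f t t' f'"
  shows "(s \<odot> t', g \<odot> f') \<in> spans K" "graph (s \<odot> t', g \<odot> f') = graph (s, f) O graph (t, g)"
proof -
  note PB = pullbackD[OF pb]
  have t': "t' \<in> snd K" using stable_catD(6)[OF stable _ pb] q by simp
  note [simp] = PB(1-8) category_assoc
  note [simp] = p[simplified] q[simplified]
  show "(s \<odot> t', g \<odot> f') \<in> spans K"
    using stable_catD(4)[OF stable t', of s] by simp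
  show "graph (s \<odot> t', g \<odot> f') = graph (s, f) O graph (t, g)"
  proof (intro set_eqI iffI; clarify)
    fix x z assume "(x, z) \<in> graph (s \<odot> t', g \<odot> f')"
    then obtain w where w: "w \<in> Arr C" "Cod C w = Dom C t'" "s \<odot> (t' \<odot> w) = x" "g \<odot> (f' \<odot> w) = z"
      by (auto elim!: graphE)
    show "(x, z) \<in> graph (s, f) O graph (t, g)"
      by (rule relcompI[of _ "f \<odot> (t' \<odot> w)"])
        (use w pullback_comm_assoc[OF _ pb, of w] in
          \<open>auto intro: graphI[of "t' \<odot> w"] graphI[of "f' \<odot> w"]\<close>)
  next
    fix x y z assume xy: "(x, y) \<in> graph (s, f)" and yz: "(y, z) \<in> graph (t, g)"
    then obtain u v where u: "u \<in> Arr C" "Cod C u = Dom C s" "s \<odot> u = x" "f \<odot> u = y"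
      and v: "v \<in> Arr C" "Cod C v = Dom C t" "t \<odot> v = y" "g \<odot> v = z"
      by (auto elim!: graphE)
    have "Dom C (f \<odot> u) = Dom C u" "Dom C (t \<odot> v) = Dom C v"
      using u(1,2) v(1,2) by simp_all
    then have "Dom C u = Dom C v" using u(4) v(3) by simp
    then obtain w where "w \<in> Arr C" "Cod C w = Dom C t'" "t' \<odot> w = u" "f' \<odot> w = v"
      using pullback_lift[OF pb, of u v] u v by auto
    then show "(x, z) \<in> graph (s \<odot> t', g \<odot> f')"
      using u v by (intro graphI[of w]) auto
  qed
qed

lemma span_comp:
  assumes p: "p \<in> spans K" and q: "q \<in> spans K" and eq: "Cod C (snd p) = Cod C (fst q)"
  shows "span_comp C q p \<in> spans K" "graph (span_comp C q p) = graph p O graph q"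
proof -
  obtain s f t g where [simp]: "p = (s, f)" "q = (t, g)" by (cases p, cases q) auto
  obtain t' f' where sel: "(SOME (t', f'). pullback C f t t' f') = (t', f')" by fastforce
  have "\<exists>x. case x of (t', f') \<Rightarrow> pullback C f t t' f'"
    using stable_catD(5)[OF stable, of t f] p q eq by auto
  from someI_ex[OF this] have pb: "pullback C f t t' f'" by (simp add: sel)
  show "span_comp C q p \<in> spans K" "graph (span_comp C q p) = graph p O graph q"
    using graph_comp[OF _ _ pb, of s g] p q by (simp_all add: span_comp_def sel del: mem_spans)
qed

lemma comp_arr:
  assumes p: "p \<in> spans K" and q: "q \<in> spans K" and eq: "Cod C (snd p) = Cod C (fst q)"
  shows "arr q \<cdot>\<^bsub>P\<^esub> arr p \<in> Arr P" "graph (rep (arr q \<cdot>\<^bsub>P\<^esub> arr p)) = graph p O graph q"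
    "Dom P (arr q \<cdot>\<^bsub>P\<^esub> arr p) = Cod C (fst p)" "Cod P (arr q \<cdot>\<^bsub>P\<^esub> arr p) = Cod C (snd q)"
proof -
  note rp = rep_arr[OF p] and rq = rep_arr[OF q]
  note c = span_iso_Cod[OF rp(3)] span_iso_Cod[OF rq(3)]
  have "arr q \<cdot>\<^bsub>P\<^esub> arr p = arr (span_comp C (rep (arr q)) (rep (arr p)))"
    using p q eq c by (simp add: span_cat_def Let_def)
  moreover have sc: "span_comp C (rep (arr q)) (rep (arr p)) \<in> spans K"
    "graph (span_comp C (rep (arr q)) (rep (arr p))) = graph p O graph q"
    using span_comp[OF rp(1) rq(1)] p q eq c by simp_all
  moreover obtain s f t g where r: "rep (arr p) = (s, f)" "rep (arr q) = (t, g)"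
    by (cases "rep (arr p)", cases "rep (arr q)") auto
  \<comment> \<open>The pullback chosen in \<open>span_comp\<close> is opaque, so the endpoints of
    the composite are read off its graph, which contains the pair of its legs.\<close>
  obtain x y where xy: "span_comp C (t, g) (s, f) = (x, y)" by fastforce
  note sc = sc[unfolded r xy]
  have "(x, y) \<in> graph (x, y)"
    using graph_self[of x y] sc(1) by blast
  then have "(x, y) \<in> graph (s, f) O graph (t, g)"
    using sc(2) graph_rep_arr[OF p] graph_rep_arr[OF q] unfolding r by simp
  then obtain w where w: "(x, w) \<in> graph (s, f)" "(w, y) \<in> graph (t, g)" by blast
  have "Cod C x = Cod C s" "Cod C y = Cod C g"
    using graph_typing(4)[OF rp(1)[unfolded r] w(1)] graph_typing(5)[OF rq(1)[unfolded r] w(2)] .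
  ultimately show "arr q \<cdot>\<^bsub>P\<^esub> arr p \<in> Arr P" "graph (rep (arr q \<cdot>\<^bsub>P\<^esub> arr p)) = graph p O graph q"
    "Dom P (arr q \<cdot>\<^bsub>P\<^esub> arr p) = Cod C (fst p)" "Cod P (arr q \<cdot>\<^bsub>P\<^esub> arr p) = Cod C (snd q)"
    using c by (simp_all add: xy r del: mem_spans)
qed

lemma Arr_P_eqI:
  assumes "m \<in> Arr P" "n \<in> Arr P" "graph (rep m) = graph (rep n)"
  shows "m = n"
  using assms by (auto simp: arr_eq_iff)

text \<open>The graph of a composite does not depend on the chosen pullback. Hence any pullback at
  hand may be used to compute a composite, and explicit calculations in \<open>P\<close> go through
  this rule.\<close>

lemma comp_arr_pullback:
  assumes p: "(s, f) \<in> spans K" and q: "(t, g) \<in> spans K" and pb: "pullback C f t t' f'"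
  shows "arr (t, g) \<cdot>\<^bsub>P\<^esub> arr (s, f) = arr (s \<odot> t', g \<odot> f')"
  by (rule Arr_P_eqI)
    (use comp_arr[OF p q] graph_comp[OF p q pb] pullbackD(5)[OF pb] in \<open>simp_all del: mem_spans\<close>)

lemma comp_P:
  assumes "m \<in> Arr P" "n \<in> Arr P" "Cod P m = Dom P n"
  shows "n \<cdot>\<^bsub>P\<^esub> m \<in> Arr P" "graph (rep (n \<cdot>\<^bsub>P\<^esub> m)) = graph (rep m) O graph (rep n)"
    "Dom P (n \<cdot>\<^bsub>P\<^esub> m) = Dom P m" "Cod P (n \<cdot>\<^bsub>P\<^esub> m) = Cod P n"
proof -
  obtain p q where "p \<in> spans K" "m = arr p" "q \<in> spans K" "n = arr q"
    using assms(1,2) by auto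
  then show "n \<cdot>\<^bsub>P\<^esub> m \<in> Arr P" "graph (rep (n \<cdot>\<^bsub>P\<^esub> m)) = graph (rep m) O graph (rep n)"
    "Dom P (n \<cdot>\<^bsub>P\<^esub> m) = Dom P m" "Cod P (n \<cdot>\<^bsub>P\<^esub> m) = Cod P n"
    using comp_arr[of p q] assms(3) by simp_all
qed

lemma graph_Idt: "A \<in> Obj C \<Longrightarrow> graph (Idt C A, Idt C A) = Id_on {x \<in> Arr C. Cod C x = A}"
  by (auto simp: Id_on_iff elim!: graphE intro: graphI)

lemma graph_rep_typing:
  assumes "m \<in> Arr P" "(x, y) \<in> graph (rep m)"
  shows "x \<in> Arr C" "Cod C x = Dom P m" "y \<in> Arr C" "Cod C y = Cod P m"
proof -
  obtain s f where sf: "(s, f) \<in> spans K" "m = arr (s, f)" using assms(1) by auto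
  then have "(x, y) \<in> graph (s, f)" using assms(2) by simp
  from graph_typing[OF sf(1) this] sf
  show "x \<in> Arr C" "Cod C x = Dom P m" "y \<in> Arr C" "Cod C y = Cod P m" by simp_all
qed

lemma graph_rep_single_valued:
  assumes "m \<in> Arr P" "(x, y) \<in> graph (rep m)" "(x, z) \<in> graph (rep m)"
  shows "y = z"
proof -
  obtain s f where sf: "(s, f) \<in> spans K" "m = arr (s, f)" using assms(1) by auto
  then show ?thesis using graph_single_valued[OF sf(1), of x y z] assms(2,3) by simp
qed

lemma Obj_P_typing [simp]: "m \<in> Arr P \<Longrightarrow> Dom P m \<in> Obj C" "m \<in> Arr P \<Longrightarrow> Cod P m \<in> Obj C"
  by auto

lemma category_P [simp]: "category P"
proof (rule categoryI)
  show "Dom P \<in> extensional (Arr P)" "Cod P \<in> extensional (Arr P)" "Idt P \<in> extensional (Obj P)"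
    by (simp_all add: span_cat_def Let_def)
  show "n \<cdot>\<^bsub>P\<^esub> m = undefined" if "\<not> (m \<in> Arr P \<and> n \<in> Arr P \<and> Cod P m = Dom P n)" for m n
    using that by (auto simp: span_cat_def Let_def)
  show "m \<cdot>\<^bsub>P\<^esub> Idt P (Dom P m) = m" "Idt P (Cod P m) \<cdot>\<^bsub>P\<^esub> m = m" if m: "m \<in> Arr P" for m
  proof -
    note [simp] = Obj_P_typing[OF m] m
    have i: "Idt P A \<in> Arr P" "Dom P (Idt P A) = A" "Cod P (Idt P A) = A"
      "graph (rep (Idt P A)) = Id_on {x \<in> Arr C. Cod C x = A}" if "A \<in> Obj C" for A
      using that by (simp_all add: graph_Idt)
    note t = graph_rep_typing[OF m]
    show "m \<cdot>\<^bsub>P\<^esub> Idt P (Dom P m) = m"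
    proof (rule Arr_P_eqI[OF comp_P(1) m])
      show "graph (rep (m \<cdot>\<^bsub>P\<^esub> Idt P (Dom P m))) = graph (rep m)"
        using comp_P(2)[OF i(1) m i(3)] t by (auto simp: i(4) relcomp_unfold Id_on_iff simp del: span_cat_simps)
    qed (use i in \<open>simp_all del: span_cat_simps\<close>)
    show "Idt P (Cod P m) \<cdot>\<^bsub>P\<^esub> m = m"
    proof (rule Arr_P_eqI[OF comp_P(1) m])
      show "graph (rep (Idt P (Cod P m) \<cdot>\<^bsub>P\<^esub> m)) = graph (rep m)"
        using comp_P(2)[OF m i(1) i(2)[symmetric]] t by (auto simp: i(4) relcomp_unfold Id_on_iff simp del: span_cat_simps)
    qed (use i in \<open>simp_all del: span_cat_simps\<close>)
  qed
  show "h \<cdot>\<^bsub>P\<^esub> (g \<cdot>\<^bsub>P\<^esub> f) = (h \<cdot>\<^bsub>P\<^esub> g) \<cdot>\<^bsub>P\<^esub> f"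
    if "f \<in> Arr P" "g \<in> Arr P" "h \<in> Arr P" "Cod P f = Dom P g" "Cod P g = Dom P h" for f g h
    by (rule Arr_P_eqI) (use that in \<open>simp_all add: comp_P O_assoc del: span_cat_simps\<close>)
  show "Idt P A \<in> Arr P" if "A \<in> Obj P" for A using that by simp
qed (use comp_P in \<open>auto simp del: span_cat_simps(2)\<close>)

section \<open>The restriction structure on spans and its splittings\<close>

abbreviation "rest \<equiv> snd (SpanQ0 span_iso K)"

lemma fst_SpanQ0 [simp]: "fst (SpanQ0 span_iso K) = P"
  by (simp add: SpanQ0_def)

lemma graph_rs:
  assumes "(s, f) \<in> spans K"
  shows "graph (s, s) = Id_on (Domain (graph (s, f)))"
  using assms by (auto simp: Id_on_iff Domain_iff elim!: graphE intro: graphI)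

lemma rest_arr [simp]:
  assumes p: "(s, f) \<in> spans K"
  shows "rest (arr (s, f)) = arr (s, s)"
proof -
  obtain t g where tg: "rep (arr (s, f)) = (t, g)" by fastforce
  have q: "(t, g) \<in> spans K" using rep_arr(1)[OF p] unfolding tg .
  have "graph (t, g) = graph (s, f)" using graph_rep_arr[OF p] unfolding tg .
  then have "graph (t, t) = graph (s, s)" using graph_rs[OF p] graph_rs[OF q] by simp
  moreover have "rest (arr (s, f)) = arr (t, t)"
    using p by (simp add: SpanQ0_def tg del: mem_spans)
  ultimately show ?thesis using p q arr_eq_iff[of "(t, t)" "(s, s)"] by simp
qed

lemma rest_P:
  assumes "m \<in> Arr P"
  shows "rest m \<in> Arr P" "graph (rep (rest m)) = Id_on (Domain (graph (rep m)))"
    "Dom P (rest m) = Dom P m" "Cod P (rest m) = Dom P m"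
proof -
  obtain s f where sf: "(s, f) \<in> spans K" "m = arr (s, f)" using assms by auto
  then show "rest m \<in> Arr P" "graph (rep (rest m)) = Id_on (Domain (graph (rep m)))"
    "Dom P (rest m) = Dom P m" "Cod P (rest m) = Dom P m"
    using graph_rs[OF sf(1)] by auto
qed

lemma restriction_cat_SpanQ0: "restriction_cat (SpanQ0 span_iso K)"
  unfolding restriction_cat_def Let_def hom_def fst_SpanQ0
proof (intro conjI ballI impI)
  note [simp del] = span_cat_simps(2)
  note simps = comp_P rest_P
  show "rest \<in> extensional (Arr P)" by (simp add: SpanQ0_def)
  fix f assume f: "f \<in> Arr P"
  show "rest f \<in> {h \<in> Arr P. Dom P h = Dom P f \<and> Cod P h = Dom P f}"
    using f by (simp add: simps)
  show "f \<cdot>\<^bsub>P\<^esub> rest f = f"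
    by (rule Arr_P_eqI) (use f in \<open>auto simp: simps relcomp_unfold Id_on_iff\<close>)
  fix g assume g: "g \<in> Arr P"
  show "rest f \<cdot>\<^bsub>P\<^esub> rest g = rest g \<cdot>\<^bsub>P\<^esub> rest f" if "Dom P f = Dom P g"
    by (rule Arr_P_eqI) (use f g that in \<open>auto simp: simps relcomp_unfold Id_on_iff\<close>)
  show "rest (g \<cdot>\<^bsub>P\<^esub> rest f) = rest g \<cdot>\<^bsub>P\<^esub> rest f" if "Dom P f = Dom P g"
    by (rule Arr_P_eqI) (use f g that in \<open>auto simp: simps relcomp_unfold Id_on_iff\<close>)
  show "rest g \<cdot>\<^bsub>P\<^esub> f = f \<cdot>\<^bsub>P\<^esub> rest (g \<cdot>\<^bsub>P\<^esub> f)" if "Cod P f = Dom P g"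
  proof (rule Arr_P_eqI)
    \<comment> \<open>R4 fails for general relations: an \<open>x\<close> related to some
      \<open>y\<close> in the domain of \<open>g\<close> may also be related to a \<open>z\<close>
      outside it. Single-valuedness excludes this.\<close>
    have "graph (rep f) O Id_on (Domain (graph (rep g))) =
        Id_on (Domain (graph (rep f) O graph (rep g))) O graph (rep f)"
      using graph_rep_single_valued[OF f] by (auto simp: relcomp_unfold Id_on_iff Domain_iff)
    then show "graph (rep (rest g \<cdot>\<^bsub>P\<^esub> f)) = graph (rep (f \<cdot>\<^bsub>P\<^esub> rest (g \<cdot>\<^bsub>P\<^esub> f)))"
      using f g that by (simp add: simps)
  qed (use f g that in \<open>simp_all add: simps\<close>)
qed simp

text \<open>Every partial map is a total map after the restricted inverse of a total one. The
  pullback involved is that of two identities.\<close>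

lemma arr_factor:
  assumes "(s, f) \<in> spans K"
  shows "arr (Idt C (Dom C f), f) \<cdot>\<^bsub>P\<^esub> arr (s, Idt C (Dom C s)) = arr (s, f)"
  using comp_arr_pullback[of s "Idt C (Dom C s)" "Idt C (Dom C f)" f "Idt C (Dom C s)" "Idt C (Dom C s)"]
    pullback_Idt_left[of C "Idt C (Dom C s)"] assms by simp

text \<open>\<open>[s, 1]\<close> is the restricted inverse of \<open>[1, s]\<close>. The first
  equation is the trivial kernel pair of the monomorphism \<open>s\<close>, the second an instance
  of \<open>arr_factor\<close>.\<close>

lemma arr_section:
  assumes s: "s \<in> snd K"
  shows "arr (s, Idt C (Dom C s)) \<cdot>\<^bsub>P\<^esub> arr (Idt C (Dom C s), s) = Idt P (Dom C s)"
    "arr (Idt C (Dom C s), s) \<cdot>\<^bsub>P\<^esub> arr (s, Idt C (Dom C s)) = arr (s, s)"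
  using comp_arr_pullback[OF _ _ pullback_mono[OF category_C mono[OF s]], of "Idt C (Dom C s)" "Idt C (Dom C s)"]
    arr_factor[of s s] s by simp_all

lemma split_restriction_cat_SpanQ0: "split_restriction_cat (SpanQ0 span_iso K)"
  unfolding split_restriction_cat_def Let_def fst_SpanQ0
proof (intro conjI restriction_cat_SpanQ0 ballI impI)
  fix e assume "e \<in> Arr P" and e: "rest e = e"
  then obtain s f where s: "(s, f) \<in> spans K" and "e = arr (s, f)" by auto
  then have "e = arr (s, s)" using e by simp
  with s arr_section[of s] show "\<exists>m\<in>Arr P. \<exists>q\<in>Arr P. Cod P q = Dom P m \<and> Cod P m = Dom P q \<and>
      e = m \<cdot>\<^bsub>P\<^esub> q \<and> q \<cdot>\<^bsub>P\<^esub> m = Idt P (Dom P m)"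
    by (intro bexI[of _ "arr (Idt C (Dom C s), s)"] bexI[of _ "arr (s, Idt C (Dom C s))"]) auto
qed

section \<open>Maps of the base category as total maps of spans\<close>

lemma comp_arr_Idt:
  assumes "f \<in> Arr C" "g \<in> Arr C" "Cod C f = Dom C g"
  shows "arr (Idt C (Dom C g), g) \<cdot>\<^bsub>P\<^esub> arr (Idt C (Dom C f), f) = arr (Idt C (Dom C f), g \<odot> f)"
  using comp_arr_pullback[of "Idt C (Dom C f)" f "Idt C (Dom C g)" g "Idt C (Dom C f)" f]
    pullback_Idt_right[of C f] assms by simp

text \<open>The pair \<open>(1, f)\<close> lies in the graph of \<open>(1, f)\<close>, hence in that
  of \<open>(1, g)\<close>; the element producing it there is an identity.\<close>

lemma arr_Idt_inject:
  assumes "f \<in> Arr C" "g \<in> Arr C" "Dom C f = Dom C g"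
    "arr (Idt C (Dom C f), f) = arr (Idt C (Dom C g), g)"
  shows "f = g"
proof -
  have "graph (Idt C (Dom C f), f) = graph (Idt C (Dom C g), g)"
    using assms arr_eq_iff by simp
  then have "(Idt C (Dom C f), f) \<in> graph (Idt C (Dom C g), g)"
    using graph_self[of "Idt C (Dom C f)" f] assms by simp
  then obtain u where "u \<in> Arr C" "Cod C u = Dom C g" "Idt C (Dom C g) \<odot> u = Idt C (Dom C f)" "g \<odot> u = f"
    by (rule graphE) (use assms(2) in simp)
  then show ?thesis using assms by simp
qed

text \<open>For a total \<open>[s, f]\<close> the graph is defined at the identity of the codomain
  of \<open>s\<close>, which yields \<open>u\<close> with \<open>s u = 1\<close>. A monomorphism
  with a right inverse is invertible, so \<open>u\<close> is an isomorphism of spans from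
  \<open>(1, f u)\<close> to \<open>(s, f)\<close>.\<close>

lemma total_arr_SpanQ0:
  "total_arr (SpanQ0 span_iso K) m \<longleftrightarrow> (\<exists>f\<in>Arr C. m = arr (Idt C (Dom C f), f))"
proof
  assume m: "total_arr (SpanQ0 span_iso K) m"
  then have "m \<in> Arr P" by (simp add: total_arr_def)
  then obtain s f where sf: "(s, f) \<in> spans K" "m = arr (s, f)" by auto
  let ?A = "Cod C s"
  have "arr (s, s) = arr (Idt C ?A, Idt C ?A)"
    using m sf by (simp add: total_arr_def)
  then have eq: "Id_on (Domain (graph (s, f))) = Id_on {x \<in> Arr C. Cod C x = ?A}"
    using sf arr_eq_iff[of "(s, s)" "(Idt C ?A, Idt C ?A)"] graph_rs[OF sf(1)] by (simp add: graph_Idt)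
  have "(Idt C ?A, Idt C ?A) \<in> Id_on (Domain (graph (s, f)))"
    unfolding eq using sf by (simp add: Id_on_iff)
  then obtain y u where u: "u \<in> Arr C" "Cod C u = Dom C s" "s \<odot> u = Idt C ?A" "f \<odot> u = y"
    by (auto simp: Id_on_iff elim!: graphE)
  have d: "Dom C u = ?A" using arg_cong[OF u(3), of "Dom C"] u(1,2) sf by simp
  have "graph (s, f) = graph (Idt C ?A, f \<odot> u)"
  proof -
    have "s \<odot> (u \<odot> s) = (s \<odot> u) \<odot> s" using u(1,2) d sf by (intro category_assoc[symmetric]) simp_all
    then have us: "u \<odot> s = Idt C (Dom C s)"
      using mono_arrD[OF mono, of s "u \<odot> s" "Idt C (Dom C s)"] u(1-3) d sf by simp
    have "span_mor K (Idt C ?A, f \<odot> u) u (s, f)"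
      using u(1-3) d sf by (simp add: span_mor_def hom_def)
    moreover have "iso_arr C u" by (rule iso_arrI[where g = s]) (use u(1-3) d us sf in simp_all)
    ultimately have "span_iso K (Idt C ?A, f \<odot> u) (s, f)" by (auto simp: span_iso_def)
    then show ?thesis by (simp add: span_iso_iff)
  qed
  then have "m = arr (Idt C (Dom C (f \<odot> u)), f \<odot> u)"
    using arr_eq_iff[of "(s, f)" "(Idt C ?A, f \<odot> u)"] u(1-3) d sf by simp
  then show "\<exists>f\<in>Arr C. m = arr (Idt C (Dom C f), f)"
    using u(1-3) d sf by (intro bexI[of _ "f \<odot> u"]) simp_all
next
  assume "\<exists>f\<in>Arr C. m = arr (Idt C (Dom C f), f)"
  then show "total_arr (SpanQ0 span_iso K) m" by (auto simp: total_arr_def)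
qed

end

subsection \<open>The 2-functor Span\<close>

lemma SpanQ1_simps [simp]:
  "Src (SpanQ1 R F) = SpanQ0 R (Src F)" "Tgt (SpanQ1 R F) = SpanQ0 R (Tgt F)" "OMap (SpanQ1 R F) = OMap F"
  by (simp_all add: SpanQ1_def)

lemma SpanQ2_simps [simp]:
  "Src2 (SpanQ2 R \<alpha>) = SpanQ1 R (Src2 \<alpha>)" "Tgt2 (SpanQ2 R \<alpha>) = SpanQ1 R (Tgt2 \<alpha>)"
  "A \<in> Obj (SrcC (Src2 \<alpha>)) \<Longrightarrow> Cpt (SpanQ2 R \<alpha>) A =
    span_arr R (Tgt (Src2 \<alpha>)) (Idt (TgtC (Src2 \<alpha>)) (OMap (Src2 \<alpha>) A), Cpt \<alpha> A)"
  by (simp_all add: SpanQ2_def)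

locale mono_fun =
  fixes F :: "('o, 'm, 'm set) onecell"
  assumes mono_functor: "mono_functor F" and infinite: "infinite (UNIV :: 'm set)"

sublocale mono_fun \<subseteq> A: mono_span "Src F"
  using mono_functor infinite by unfold_locales (simp_all add: mono_functor_def)

sublocale mono_fun \<subseteq> B: mono_span "Tgt F"
  using mono_functor infinite by unfold_locales (simp_all add: mono_functor_def)

context mono_fun begin

lemma stable_functor: "stable_functor F"
  using mono_functor by (simp add: mono_functor_def)

lemma functor_cell [simp]: "functor_cell F"
  using stable_functor by (rule stable_functorD)

lemma AMap_S [simp]: "s \<in> snd (Src F) \<Longrightarrow> AMap F s \<in> snd (Tgt F)"
  using stable_functor by (rule stable_functorD)

text \<open>The definition evaluates at the chosen representative. Functors carry isomorphisms of
  spans to isomorphisms of spans, so any other representative gives the same class.\<close>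

lemma SpanQ1_arr [simp]:
  assumes p: "(s, f) \<in> spans (Src F)"
  shows "AMap (SpanQ1 span_iso F) (A.arr (s, f)) = B.arr (AMap F s, AMap F f)"
proof -
  obtain t g where tg: "A.rep (A.arr (s, f)) = (t, g)" by fastforce
  have q: "(t, g) \<in> spans (Src F)" using A.rep_arr(1)[OF p] unfolding tg .
  obtain x where x: "span_mor (Src F) (t, g) x (s, f)" and iso: "iso_arr A.C x"
    using A.rep_arr(3)[OF p] unfolding tg by (auto simp: span_iso_def)
  have X: "x \<in> Arr A.C" "Dom A.C x = Dom A.C t" "Cod A.C x = Dom A.C s"
    "s \<cdot>\<^bsub>A.C\<^esub> x = t" "f \<cdot>\<^bsub>A.C\<^esub> x = g"
    using x by (simp_all add: span_mor_def hom_def)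
  have "AMap F s \<cdot>\<^bsub>B.C\<^esub> AMap F x = AMap F t" "AMap F f \<cdot>\<^bsub>B.C\<^esub> AMap F x = AMap F g"
    using arg_cong[OF X(4), of "AMap F"] arg_cong[OF X(5), of "AMap F"] X(1-3) p by simp_all
  then have "span_mor (Tgt F) (AMap F t, AMap F g) (AMap F x) (AMap F s, AMap F f)"
    using X(1-3) p q by (simp add: span_mor_def hom_def)
  moreover have "iso_arr B.C (AMap F x)"
    using functor_cell iso unfolding functor_cell_def by (rule is_functor_iso_arr)
  ultimately have "span_iso (Tgt F) (AMap F t, AMap F g) (AMap F s, AMap F f)"
    by (auto simp: span_iso_def)
  then have "B.arr (AMap F t, AMap F g) = B.arr (AMap F s, AMap F f)"
    using B.arr_eq_iff B.span_iso_iff by blast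
  then show ?thesis using p by (simp add: SpanQ1_def tg)
qed

lemma functor_cell_SpanQ1: "functor_cell (SpanQ1 span_iso F)"
proof (rule functor_cellI)
  let ?G = "SpanQ1 span_iso F"
  show "AMap ?G \<in> extensional (Arr (SrcC ?G))"
    by (simp add: SpanQ1_def del: A.span_cat_simps)
  show "OMap ?G \<in> extensional (Obj (SrcC ?G))"
    using functor_cell_simps(9)[OF functor_cell] by simp
  fix m assume "m \<in> Arr (SrcC ?G)"
  then obtain s f where m: "(s, f) \<in> spans (Src F)" "m = A.arr (s, f)" by auto
  then show "AMap ?G m \<in> Arr (TgtC ?G)"
    "Dom (TgtC ?G) (AMap ?G m) = OMap ?G (Dom (SrcC ?G) m)"
    "Cod (TgtC ?G) (AMap ?G m) = OMap ?G (Cod (SrcC ?G) m)"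
    by simp_all
  fix n assume n: "n \<in> Arr (SrcC ?G)" and eq: "Cod (SrcC ?G) m = Dom (SrcC ?G) n"
  obtain t g where n: "(t, g) \<in> spans (Src F)" "n = A.arr (t, g)" using n by auto
  have "Cod A.C f = Cod A.C t" using m n eq by simp
  then obtain t' f' where pb: "pullback A.C f t t' f'"
    using stable_catD(5)[OF A.stable, of t f] m n by auto
  have t: "t \<in> snd (Src F)" using n by simp
  \<comment> \<open>Preservation of pullbacks along arrows of the class sends the square that
    computes the composite to one that computes the composite of the images.\<close>
  have pb': "pullback B.C (AMap F f) (AMap F t) (AMap F t') (AMap F f')"
    by (rule stable_functorD(5)[OF stable_functor t pb])
  have Fm: "(AMap F s, AMap F f) \<in> spans (Tgt F)" "(AMap F t, AMap F g) \<in> spans (Tgt F)"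
    using m n by simp_all
  note [simp] = pullbackD(1-8)[OF pb]
  show "AMap ?G (n \<cdot>\<^bsub>SrcC ?G\<^esub> m) = AMap ?G n \<cdot>\<^bsub>TgtC ?G\<^esub> AMap ?G m"
    using A.comp_arr_pullback[OF m(1) n(1) pb] B.comp_arr_pullback[OF Fm pb']
      A.graph_comp(1)[OF m(1) n(1) pb] m n by simp
qed simp_all

lemma restriction_functor_SpanQ1: "restriction_functor (SpanQ1 span_iso F)"
  unfolding restriction_functor_def
  using functor_cell_SpanQ1 A.split_restriction_cat_SpanQ0 B.split_restriction_cat_SpanQ0 by auto

end

lemma total_nat_SpanQ2:
  fixes \<alpha> :: "('o, 'm, 'm set) twocell"
  assumes a: "mono_nat \<alpha>" and inf: "infinite (UNIV :: 'm set)"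
  shows "total_nat (SpanQ2 span_iso \<alpha>)"
proof -
  have st: "stable_nat \<alpha>" using a by (simp add: mono_nat_def)
  note A = stable_natD[OF st]
  note N = nat_cell_simps[OF A(3)]
  interpret F: mono_fun "Src2 \<alpha>"
    using a A inf by unfold_locales (simp_all add: mono_nat_def mono_functor_def)
  interpret G: mono_fun "Tgt2 \<alpha>"
    using a A inf N(3,4) by unfold_locales (simp_all add: mono_nat_def mono_functor_def)
  note [simp] = N
  note G = G.SpanQ1_arr[simplified] G.AMap_S[simplified]
  note [simp] = G
  have "nat_cell (SpanQ2 span_iso \<alpha>)"
  proof (rule nat_cellI)
    let ?\<beta> = "SpanQ2 span_iso \<alpha>"
    show "functor_cell (Src2 ?\<beta>)" "functor_cell (Tgt2 ?\<beta>)"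
      using F.functor_cell_SpanQ1 G.functor_cell_SpanQ1 by simp_all
    show "Cpt ?\<beta> \<in> extensional (Obj (SrcC (Src2 ?\<beta>)))"
      by (simp add: SpanQ2_def)
    fix m assume "m \<in> Arr (SrcC (Src2 ?\<beta>))"
    then obtain s f where m: "(s, f) \<in> spans (Src (Src2 \<alpha>))" "m = F.A.arr (s, f)" by auto
    note [simp] = m(1)[simplified]
    let ?F = "Src2 \<alpha>" and ?G = "Tgt2 \<alpha>"
    let ?a = "Cpt \<alpha> (Cod F.A.C s)" and ?b = "Cpt \<alpha> (Dom F.A.C s)" and ?c = "Cpt \<alpha> (Cod F.A.C f)"
    \<comment> \<open>Both composites have left leg \<open>AMap ?F s\<close>. For the one through
      \<open>[1, ?a]\<close> the pullback is the naturality square of \<open>\<alpha>\<close> at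
      \<open>s\<close>, so stability of \<open>\<alpha>\<close> is what makes its image
      natural.\<close>
    have pb: "pullback F.B.C ?a (AMap ?G s) (AMap ?F s) ?b" using A(4)[of s] by simp
    have Fs: "(AMap ?F s, AMap ?F f) \<in> spans (Tgt ?F)" "(AMap ?G s, AMap ?G f) \<in> spans (Tgt ?F)"
      "(Idt F.B.C (OMap ?F (Cod F.A.C f)), ?c) \<in> spans (Tgt ?F)"
      "(Idt F.B.C (OMap ?F (Cod F.A.C s)), ?a) \<in> spans (Tgt ?F)"
      by simp_all
    have "F.B.arr (Idt F.B.C (OMap ?F (Cod F.A.C f)), ?c) \<cdot>\<^bsub>F.B.P\<^esub> F.B.arr (AMap ?F s, AMap ?F f)
        = F.B.arr (AMap ?F s, ?c \<cdot>\<^bsub>F.B.C\<^esub> AMap ?F f)"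
      using F.B.comp_arr_pullback[OF Fs(1,3), of "Idt F.B.C (OMap ?F (Dom F.A.C s))" "AMap ?F f"]
        pullback_Idt_right[of F.B.C "AMap ?F f"] by simp
    moreover have "F.B.arr (AMap ?G s, AMap ?G f) \<cdot>\<^bsub>F.B.P\<^esub> F.B.arr (Idt F.B.C (OMap ?F (Cod F.A.C s)), ?a)
        = F.B.arr (AMap ?F s, AMap ?G f \<cdot>\<^bsub>F.B.C\<^esub> ?b)"
      using F.B.comp_arr_pullback[OF Fs(4,2) pb] by simp
    ultimately show "Cpt ?\<beta> (Cod (SrcC (Src2 ?\<beta>)) m) \<cdot>\<^bsub>TgtC (Src2 ?\<beta>)\<^esub> AMap (Src2 ?\<beta>) m =
        AMap (Tgt2 ?\<beta>) m \<cdot>\<^bsub>TgtC (Src2 ?\<beta>)\<^esub> Cpt ?\<beta> (Dom (SrcC (Src2 ?\<beta>)) m)"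
      using m nat_cell_natural[OF A(3), of f] by simp
  qed auto
  moreover have "total_arr (SpanQ0 span_iso (Tgt (Src2 \<alpha>))) (Cpt (SpanQ2 span_iso \<alpha>) A)"
    if "A \<in> Obj (SrcC (Src2 \<alpha>))" for A
    using that by (auto simp: F.B.total_arr_SpanQ0 intro!: bexI[of _ "Cpt \<alpha> A"])
  ultimately show ?thesis
    using F.restriction_functor_SpanQ1 G.restriction_functor_SpanQ1 by (simp add: total_nat_def)
qed

lemma two_functor_Span:
  assumes inf: "infinite (UNIV :: 'm set)"
  shows "two_functor (StableCat_mono :: ('o, 'm, 'm set) struct_2cat) SplitRestCat SpanF"
proof -
  have span: "mono_span K" if "mono_stable K" for K :: "('o, 'm) cat \<times> 'm set"
    using that inf by unfold_locales
  have func: "mono_fun F" if "mono_functor F" for F :: "('o, 'm, 'm set) onecell"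
    using that inf by unfold_locales
  have nat_fun: "mono_functor (Src2 \<alpha>)" "mono_functor (Tgt2 \<alpha>)" "nat_cell \<alpha>"
    if "mono_nat \<alpha>" for \<alpha> :: "('o, 'm, 'm set) twocell"
    using that stable_natD[of \<alpha>] nat_cell_simps(3,4)[of \<alpha>] by (simp_all add: mono_nat_def mono_functor_def)
  have nat_span: "nat_cell (SpanQ2 span_iso \<alpha>)" if "mono_nat \<alpha>" for \<alpha> :: "('o, 'm, 'm set) twocell"
    using total_natD(3)[OF total_nat_SpanQ2[OF that inf]] .
  have id: "SpanQ1 span_iso (id_cell K) = id_cell (SpanQ0 span_iso K)" if "mono_stable K"
    for K :: "('o, 'm) cat \<times> 'm set"
  proof -
    interpret mono_span K by (rule span[OF that])
    interpret i: mono_fun "id_cell K"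
      using that inf stable_functor_id[OF stable] by unfold_locales (simp add: mono_functor_def)
    show ?thesis
      by (rule onecell_eqI)
        (use i.functor_cell_SpanQ1 i.SpanQ1_arr in \<open>auto intro: functor_cell_id\<close>)
  qed
  have comp: "SpanQ1 span_iso (comp_cell G F) = comp_cell (SpanQ1 span_iso G) (SpanQ1 span_iso F)"
    if F: "mono_functor F" and G: "mono_functor G" and eq: "Tgt F = Src G"
    for F G :: "('o, 'm, 'm set) onecell"
  proof -
    interpret F: mono_fun F by (rule func[OF F])
    interpret G: mono_fun G by (rule func[OF G])
    interpret GF: mono_fun "comp_cell G F"
      using F G inf stable_functor_comp[OF F.stable_functor G.stable_functor eq]
      by unfold_locales (simp_all add: mono_functor_def)
    show ?thesis
    proof (rule onecell_eqI)
      show "functor_cell (comp_cell (SpanQ1 span_iso G) (SpanQ1 span_iso F))"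
        by (rule functor_cell_comp) (simp_all add: F.functor_cell_SpanQ1 G.functor_cell_SpanQ1 eq)
      fix m assume "m \<in> Arr (SrcC (SpanQ1 span_iso (comp_cell G F)))"
      then obtain s f where m: "(s, f) \<in> spans (Src F)" "m = F.A.arr (s, f)" by auto
      have "(AMap F s, AMap F f) \<in> spans (Src G)"
        using m by (simp flip: eq)
      then show "AMap (SpanQ1 span_iso (comp_cell G F)) m =
          AMap (comp_cell (SpanQ1 span_iso G) (SpanQ1 span_iso F)) m"
        using m GF.SpanQ1_arr[of s f] F.SpanQ1_arr[of s f] G.SpanQ1_arr eq by simp
    qed (use GF.functor_cell_SpanQ1 in simp_all)
  qed
  have id2: "SpanQ2 span_iso (id_nat F) = id_nat (SpanQ1 span_iso F)" if F: "mono_functor F"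
    for F :: "('o, 'm, 'm set) onecell"
  proof -
    interpret F: mono_fun F by (rule func[OF F])
    have "mono_nat (id_nat F)"
      using F stable_nat_id[OF F.stable_functor] by (simp add: mono_nat_def mono_functor_def)
    then show ?thesis
      by (intro twocell_eqI) (use nat_span F.functor_cell_SpanQ1 in \<open>auto intro: nat_cell_id\<close>)
  qed
  have vcomp: "SpanQ2 span_iso (vcomp_nat \<beta> \<alpha>) = vcomp_nat (SpanQ2 span_iso \<beta>) (SpanQ2 span_iso \<alpha>)"
    if a: "mono_nat \<alpha>" and b: "mono_nat \<beta>" and eq: "Tgt2 \<alpha> = Src2 \<beta>"
    for \<alpha> \<beta> :: "('o, 'm, 'm set) twocell"
  proof (rule twocell_eqI)
    note A = nat_fun[OF a] and B = nat_fun[OF b]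
    note nA = nat_cell_simps[OF A(3)] and nB = nat_cell_simps[OF B(3)]
    interpret F: mono_fun "Src2 \<alpha>" by (rule func[OF A(1)])
    have "mono_nat (vcomp_nat \<beta> \<alpha>)"
      using a b eq stable_nat_vcomp by (auto simp: mono_nat_def)
    then show "nat_cell (SpanQ2 span_iso (vcomp_nat \<beta> \<alpha>))" by (rule nat_span)
    show "nat_cell (vcomp_nat (SpanQ2 span_iso \<beta>) (SpanQ2 span_iso \<alpha>))"
      using nat_span[OF a] nat_span[OF b] eq by (intro nat_cell_vcomp) simp_all
    fix X assume "X \<in> Obj (SrcC (Src2 (SpanQ2 span_iso (vcomp_nat \<beta> \<alpha>))))"
    then show "Cpt (SpanQ2 span_iso (vcomp_nat \<beta> \<alpha>)) X =
        Cpt (vcomp_nat (SpanQ2 span_iso \<beta>) (SpanQ2 span_iso \<alpha>)) X"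
      using F.B.comp_arr_Idt[of "Cpt \<alpha> X" "Cpt \<beta> X"] nA(3-8) nB(3-8) eq by simp
  qed simp_all
  have hcomp: "SpanQ2 span_iso (hcomp_nat \<beta> \<alpha>) = hcomp_nat (SpanQ2 span_iso \<beta>) (SpanQ2 span_iso \<alpha>)"
    if a: "mono_nat \<alpha>" and b: "mono_nat \<beta>" and eq: "Tgt (Src2 \<alpha>) = Src (Src2 \<beta>)"
    for \<alpha> \<beta> :: "('o, 'm, 'm set) twocell"
  proof (rule twocell_eqI)
    note A = nat_fun[OF a] and B = nat_fun[OF b]
    note nA = nat_cell_simps[OF A(3)] and nB = nat_cell_simps[OF B(3)]
    interpret F: mono_fun "Src2 \<alpha>" by (rule func[OF A(1)])
    interpret G: mono_fun "Src2 \<beta>" by (rule func[OF B(1)])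
    have "mono_nat (hcomp_nat \<beta> \<alpha>)"
      using a b eq stable_nat_hcomp by (auto simp: mono_nat_def)
    then show "nat_cell (SpanQ2 span_iso (hcomp_nat \<beta> \<alpha>))" by (rule nat_span)
    show "nat_cell (hcomp_nat (SpanQ2 span_iso \<beta>) (SpanQ2 span_iso \<alpha>))"
      using nat_span[OF a] nat_span[OF b] eq by (intro nat_cell_hcomp) simp_all
    show "Src2 (SpanQ2 span_iso (hcomp_nat \<beta> \<alpha>)) = Src2 (hcomp_nat (SpanQ2 span_iso \<beta>) (SpanQ2 span_iso \<alpha>))"
      "Tgt2 (SpanQ2 span_iso (hcomp_nat \<beta> \<alpha>)) = Tgt2 (hcomp_nat (SpanQ2 span_iso \<beta>) (SpanQ2 span_iso \<alpha>))"
      using A B nA(4) nB(3) eq by (simp_all add: comp)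
    fix X assume "X \<in> Obj (SrcC (Src2 (SpanQ2 span_iso (hcomp_nat \<beta> \<alpha>))))"
    then have X: "X \<in> Obj F.A.C" by simp
    let ?c = "Cpt \<alpha> X" and ?d = "Cpt \<beta> (OMap (Tgt2 \<alpha>) X)"
    have c: "?c \<in> Arr G.A.C" "Dom G.A.C ?c = OMap (Src2 \<alpha>) X" "Cod G.A.C ?c = OMap (Tgt2 \<alpha>) X"
      "OMap (Src2 \<alpha>) X \<in> Obj G.A.C" "OMap (Tgt2 \<alpha>) X \<in> Obj G.A.C"
      using nA(6-9)[OF X] functor_cell_simps(3)[OF nA(1) X] eq by simp_all
    have sp: "(Idt G.A.C (OMap (Src2 \<alpha>) X), ?c) \<in> spans (Src (Src2 \<beta>))" using c by simp
    show "Cpt (SpanQ2 span_iso (hcomp_nat \<beta> \<alpha>)) X =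
        Cpt (hcomp_nat (SpanQ2 span_iso \<beta>) (SpanQ2 span_iso \<alpha>)) X"
      using G.B.comp_arr_Idt[of "AMap (Src2 \<beta>) ?c" ?d] X c G.SpanQ1_arr[OF sp]
        nB(6-8)[OF c(5)] eq by simp
  qed
  show ?thesis
    unfolding two_functor_def SplitRestCat_def StableCat_mono_eq SpanF_def SpanQF_def
      composable1_def vcomposable_def hcomposable_def
  proof (simp only: struct_twocat_simps twofun.simps mem_Collect_eq, intro conjI allI ballI impI)
    show "two_category (struct_twocat {X. split_restriction_cat X} {F. restriction_functor F} {\<alpha>. total_nat \<alpha>})"
      using two_category_SplitRestCat unfolding SplitRestCat_def .
    show "two_category (struct_twocat {K. mono_stable K} {F. mono_functor F} {\<alpha>. mono_nat \<alpha>})"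
      using two_category_StableCat_mono unfolding StableCat_mono_eq .
  qed (auto simp: id comp id2 vcomp hcomp total_nat_SpanQ2[OF _ inf]
      intro: mono_span.split_restriction_cat_SpanQ0[OF span] mono_fun.restriction_functor_SpanQ1[OF func])
qed

section \<open>Comparison of the two congruences on spans\<close>

text \<open>With \<open>w\<close> the inverse of \<open>u\<close>, the inverse \<open>y\<close> of
  \<open>x\<close> is the lift of the cone formed by the identity and \<open>w h\<close>. That
  \<open>y x\<close> is an identity is tested on both projections.\<close>

lemma pullback_of_iso:
  assumes [simp]: "category C" and p: "pullback C h u x k" and u: "iso_arr C u"
  shows "iso_arr C x"
proof -
  note P [simp] = pullbackD(1-8)[OF p]
  obtain w where w: "w \<in> Arr C" "Dom C w = Cod C u" "Cod C w = Dom C u"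
    "w \<cdot>\<^bsub>C\<^esub> u = Idt C (Dom C u)" "u \<cdot>\<^bsub>C\<^esub> w = Idt C (Cod C u)"
    using iso_arrE[OF u] by blast
  have "u \<cdot>\<^bsub>C\<^esub> (w \<cdot>\<^bsub>C\<^esub> h) = h"
    using w by (simp flip: category_assoc)
  then obtain y where y: "y \<in> Arr C" "Dom C y = Dom C h" "Cod C y = Dom C x"
    "x \<cdot>\<^bsub>C\<^esub> y = Idt C (Dom C h)" "k \<cdot>\<^bsub>C\<^esub> y = w \<cdot>\<^bsub>C\<^esub> h"
    using pullback_lift[OF p, of "Idt C (Dom C h)" "w \<cdot>\<^bsub>C\<^esub> h"] w by auto
  have "w \<cdot>\<^bsub>C\<^esub> (h \<cdot>\<^bsub>C\<^esub> x) = k"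
    unfolding pullbackD(9)[OF p] using w by (simp flip: category_assoc)
  then have "k \<cdot>\<^bsub>C\<^esub> (y \<cdot>\<^bsub>C\<^esub> x) = k"
    using y(1-3) w(1-3) by (simp add: y(5) category_assoc flip: category_assoc[of C x y k])
  moreover have "x \<cdot>\<^bsub>C\<^esub> (y \<cdot>\<^bsub>C\<^esub> x) = x"
    using y(1-3) by (simp add: y(4) flip: category_assoc)
  ultimately have "y \<cdot>\<^bsub>C\<^esub> x = Idt C (Dom C x)"
    using y(1-3) by (intro pullback_joint_mono[OF _ p, of "y \<cdot>\<^bsub>C\<^esub> x" "Idt C (Dom C x)"]) simp_all
  then show ?thesis using y by (intro iso_arrI[where g = y]) simp_all
qed

text \<open>For monic \<open>v\<close> the equations \<open>v f a = v s b\<close> and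
  \<open>f a = s b\<close> are equivalent, so the cospans \<open>(f, s)\<close> and
  \<open>(g, t)\<close> have the same cones and hence the same pullbacks. The conjugate is the
  comparison of two such pullbacks.\<close>

lemma conjugate_iso:
  assumes [simp]: "category (fst K)" and v: "mono_arr (fst K) v" and u: "conjugate K v u"
    and S: "snd K \<subseteq> Arr (fst K)"
  shows "iso_arr (fst K) u"
proof -
  let ?C = "fst K"
  obtain f s g t s' f' t' g' where c: "cospan_mor K f s v g t" and p: "pullback ?C f s s' f'"
    and q: "pullback ?C g t t' g'" and u: "u \<in> hom ?C (Dom ?C s') (Dom ?C t')"
    and ut: "t' \<cdot>\<^bsub>?C\<^esub> u = s'" "g' \<cdot>\<^bsub>?C\<^esub> u = f'"
    using u unfolding conjugate_def Let_def by blast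
  note P [simp] = pullbackD(1-8)[OF p] and Q = pullbackD(1-8)[OF q]
  have v' [simp]: "v \<in> Arr ?C" "Dom ?C v = Cod ?C s" "Cod ?C v = Cod ?C t"
    and vf: "v \<cdot>\<^bsub>?C\<^esub> f = g" and vs: "v \<cdot>\<^bsub>?C\<^esub> s = t"
    using c by (simp_all add: cospan_mor_def hom_def Let_def)
  have D: "Dom ?C g = Dom ?C f" "Dom ?C t = Dom ?C s" using vf vs by (metis P v' category_simps(7) assms(1))+
  note [simp] = Q(1-4) Q(6-8) D
  have u' [simp]: "u \<in> Arr ?C" "Dom ?C u = Dom ?C s'" "Cod ?C u = Dom ?C t'"
    using u by (simp_all add: hom_def)
  have "v \<cdot>\<^bsub>?C\<^esub> (f \<cdot>\<^bsub>?C\<^esub> t') = v \<cdot>\<^bsub>?C\<^esub> (s \<cdot>\<^bsub>?C\<^esub> g')"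
    using pullbackD(9)[OF q] by (simp add: vf vs flip: category_assoc)
  then have "f \<cdot>\<^bsub>?C\<^esub> t' = s \<cdot>\<^bsub>?C\<^esub> g'"
    using mono_arrD[OF v, of "f \<cdot>\<^bsub>?C\<^esub> t'" "s \<cdot>\<^bsub>?C\<^esub> g'"] by simp
  then obtain w where w [simp]: "w \<in> Arr ?C" "Dom ?C w = Dom ?C t'" "Cod ?C w = Dom ?C s'"
    and wt: "s' \<cdot>\<^bsub>?C\<^esub> w = t'" "f' \<cdot>\<^bsub>?C\<^esub> w = g'"
    using pullback_lift[OF p, of t' g'] by auto
  have "t' \<cdot>\<^bsub>?C\<^esub> (u \<cdot>\<^bsub>?C\<^esub> w) = t'" "g' \<cdot>\<^bsub>?C\<^esub> (u \<cdot>\<^bsub>?C\<^esub> w) = g'"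
    "s' \<cdot>\<^bsub>?C\<^esub> (w \<cdot>\<^bsub>?C\<^esub> u) = s'" "f' \<cdot>\<^bsub>?C\<^esub> (w \<cdot>\<^bsub>?C\<^esub> u) = f'"
    using ut wt by (simp_all flip: category_assoc)
  then have "u \<cdot>\<^bsub>?C\<^esub> w = Idt ?C (Dom ?C t')" "w \<cdot>\<^bsub>?C\<^esub> u = Idt ?C (Dom ?C s')"
    using pullback_joint_mono[OF _ q, of "u \<cdot>\<^bsub>?C\<^esub> w" "Idt ?C (Dom ?C t')"]
      pullback_joint_mono[OF _ p, of "w \<cdot>\<^bsub>?C\<^esub> u" "Idt ?C (Dom ?C s')"] by simp_all
  then show ?thesis by (intro iso_arrI[where g = w]) simp_all
qed

text \<open>The identity is a morphism from the cospan of two identities to itself. With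
  \<open>(x, x)\<close> as pullback of the source and \<open>(1, 1)\<close> as pullback of the
  target its conjugate is \<open>x\<close>, which is a pullback of itself along an identity.\<close>

lemma iso_in_Sstar:
  assumes K: "stable_cat K" and x: "iso_arr (fst K) x"
  shows "x \<in> Sstar K"
proof -
  let ?C = "fst K"
  have [simp]: "category ?C" using K by (rule stable_catD)
  obtain y where xy [simp]: "x \<in> Arr ?C" "y \<in> Arr ?C" "Dom ?C y = Cod ?C x" "Cod ?C y = Dom ?C x"
    and yx: "y \<cdot>\<^bsub>?C\<^esub> x = Idt ?C (Dom ?C x)" "x \<cdot>\<^bsub>?C\<^esub> y = Idt ?C (Cod ?C x)"
    using iso_arrE[OF x] by blast
  let ?I = "Idt ?C (Cod ?C x)"
  have 1: "?I \<in> snd K" by (simp add: stable_catD(3)[OF K] iso_arr_Idt)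
  have "pullback ?C ?I ?I x x"
  proof (rule pullbackI)
    fix a b assume "a \<in> Arr ?C" "b \<in> Arr ?C" "Cod ?C a = Dom ?C ?I" "Cod ?C b = Dom ?C ?I"
      "?I \<cdot>\<^bsub>?C\<^esub> a = ?I \<cdot>\<^bsub>?C\<^esub> b"
    then show "\<exists>u\<in>Arr ?C. Dom ?C u = Dom ?C a \<and> Cod ?C u = Dom ?C x \<and> x \<cdot>\<^bsub>?C\<^esub> u = a \<and> x \<cdot>\<^bsub>?C\<^esub> u = b"
      by (intro bexI[of _ "y \<cdot>\<^bsub>?C\<^esub> a"]) (simp_all add: yx flip: category_assoc)
  next
    fix u v assume uv: "u \<in> Arr ?C" "v \<in> Arr ?C" "Cod ?C u = Dom ?C x" "Cod ?C v = Dom ?C x"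
      "x \<cdot>\<^bsub>?C\<^esub> u = x \<cdot>\<^bsub>?C\<^esub> v"
    have "u = (y \<cdot>\<^bsub>?C\<^esub> x) \<cdot>\<^bsub>?C\<^esub> u" "v = (y \<cdot>\<^bsub>?C\<^esub> x) \<cdot>\<^bsub>?C\<^esub> v" using uv(1-4) yx by simp_all
    with uv show "u = v" by (metis category_assoc \<open>category ?C\<close> xy)
  qed simp_all
  moreover have "pullback ?C ?I ?I ?I ?I" using pullback_Idt_left[of ?C ?I] by simp
  ultimately have "conjugate K ?I x"
    unfolding conjugate_def cospan_mor_def Let_def
    by (intro exI[of _ ?I] exI[of _ x] conjI) (use 1 in \<open>simp_all add: hom_def\<close>)
  then show ?thesis
    unfolding Sstar_def using 1 pullback_Idt_left[of ?C x] by auto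
qed

text \<open>Symmetry and transitivity are settled by the description of \<open>span_iso\<close> as
  equality of graphs. What remains is the comparison of generators: arrows of \<open>Sstar\<close>
  with isomorphisms, in both directions.\<close>

lemma (in mono_span) zeq_eq_span_iso: "zeq K = span_iso K"
proof (intro ext iffI)
  have star: "iso_arr C x" if "x \<in> Sstar K" for x
    using that conjugate_iso[OF category_C mono] pullback_of_iso[OF category_C] S_Arr
    unfolding Sstar_def by blast
  fix p q
  show "span_iso K p q" if "zeq K p q"
    using that
  proof induction
    case (base p x q)
    then show ?case using star by (auto simp: span_iso_def)
  qed (simp_all add: span_iso_iff)
  show "zeq K p q" if "span_iso K p q"
    using that iso_in_Sstar[OF stable] unfolding span_iso_def by (auto intro: zeq.base)
qed

text \<open>The constructions consult \<open>R\<close> at the structured category in question alone.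
  Equality of the two relations there gives literally equal categories, restrictions and codes, not
  just isomorphic ones.\<close>

lemma SpanQ_cong:
  assumes "R K = R' K"
  shows "span_arr R K = span_arr R' K" "span_rep R K = span_rep R' K" "span_cat R K = span_cat R' K"
    "SpanQ0 R K = SpanQ0 R' K"
proof -
  show *: "span_arr R K = span_arr R' K"
    by (intro ext) (simp add: span_arr_def assms)
  show **: "span_rep R K = span_rep R' K"
    by (intro ext) (simp add: span_rep_def *)
  show ***: "span_cat R K = span_cat R' K" by (simp only: span_cat_def * **)
  show "SpanQ0 R K = SpanQ0 R' K" by (simp only: SpanQ0_def * ** ***)
qed

lemmas (in mono_span) zeq_cong = SpanQ_cong[where R = zeq and R' = span_iso, OF zeq_eq_span_iso]

lemma (in mono_fun) SpanQ1_zeq: "SpanQ1 zeq F = SpanQ1 span_iso F"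
  by (simp add: SpanQ1_def A.zeq_cong B.zeq_cong)

lemma SpanQ2_zeq:
  fixes \<alpha> :: "('o, 'm, 'm set) twocell"
  assumes a: "mono_nat \<alpha>" and inf: "infinite (UNIV :: 'm set)"
  shows "SpanQ2 zeq \<alpha> = SpanQ2 span_iso \<alpha>"
proof -
  have st: "stable_nat \<alpha>" using a by (simp add: mono_nat_def)
  note A = stable_natD[OF st] and N = nat_cell_simps(3,4)[OF stable_natD(3)[OF st]]
  interpret F: mono_fun "Src2 \<alpha>"
    using a A inf by unfold_locales (simp_all add: mono_nat_def mono_functor_def)
  interpret G: mono_fun "Tgt2 \<alpha>"
    using a A inf N by unfold_locales (simp_all add: mono_nat_def mono_functor_def)
  show ?thesis by (simp add: SpanQ2_def F.SpanQ1_zeq G.SpanQ1_zeq F.B.zeq_cong)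
qed

section \<open>Agreement of Par with Span over monic classes\<close>

lemma ParF_simps [simp]: "on0 ParF = SpanQ0 zeq" "on1 ParF = SpanQ1 zeq" "on2 ParF = SpanQ2 zeq"
  and SpanF_simps [simp]: "on0 SpanF = SpanQ0 span_iso" "on1 SpanF = SpanQ1 span_iso" "on2 SpanF = SpanQ2 span_iso"
  and TotalF_simps [simp]: "on0 TotalF = Total0" "on1 TotalF = Total1" "on2 TotalF = Total2"
  and comp_twofun_simps [simp]: "on0 (comp_twofun G F) = on0 G \<circ> on0 F" "on1 (comp_twofun G F) = on1 G \<circ> on1 F"
    "on2 (comp_twofun G F) = on2 G \<circ> on2 F"
  and id_twofun_simps [simp]: "on0 id_twofun = id" "on1 id_twofun = id" "on2 id_twofun = id"
  by (simp_all add: ParF_def SpanF_def SpanQF_def TotalF_def comp_twofun_def id_twofun_def)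

lemma Cells_StableCat_mono [simp]: "Cells0 StableCat_mono = {K. mono_stable K}"
  "Cells1 StableCat_mono = {F. mono_functor F}" "Cells2 StableCat_mono = {\<alpha>. mono_nat \<alpha>}"
  by (simp_all add: StableCat_mono_eq)

lemma SpanF_eq_ParF:
  assumes inf: "infinite (UNIV :: 'm set)"
  shows "K \<in> Cells0 (StableCat_mono :: ('o, 'm, 'm set) struct_2cat) \<Longrightarrow> on0 ParF K = on0 SpanF K"
    "F \<in> Cells1 (StableCat_mono :: ('o, 'm, 'm set) struct_2cat) \<Longrightarrow> on1 ParF F = on1 SpanF F"
    "\<alpha> \<in> Cells2 (StableCat_mono :: ('o, 'm, 'm set) struct_2cat) \<Longrightarrow> on2 ParF \<alpha> = on2 SpanF \<alpha>"
  using mono_span.zeq_cong(4)[of K] mono_fun.SpanQ1_zeq[of F] SpanQ2_zeq[of \<alpha>] inf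
  by (simp_all add: mono_span_def mono_fun_def)

lemma two_functor_Par:
  assumes inf: "infinite (UNIV :: 'm set)"
  shows "two_functor (StableCat_mono :: ('o, 'm, 'm set) struct_2cat) SplitRestCat ParF"
  by (rule two_functor_cong[OF two_functor_Span[OF inf]]) (use SpanF_eq_ParF[OF inf] in auto)

lemma two_natural_iso_span_to_par:
  assumes inf: "infinite (UNIV :: 'm set)"
  shows "two_natural_iso (StableCat_mono :: ('o, 'm, 'm set) struct_2cat) SplitRestCat SpanF ParF span_to_par"
proof (rule two_natural_iso_one1[OF two_functor_Span[OF inf]])
  fix K :: "('o, 'm) cat \<times> 'm set"
  assume "K \<in> Cells0 StableCat_mono"
  then interpret mono_span K using inf by unfold_locales simp
  \<comment> \<open>Choosing a representative and taking its class again returns the same code, so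
    the comparison is the identity 1-cell.\<close>
  have "restrict (\<lambda>m. arr (rep m)) (arr ` spans K) = restrict (\<lambda>m. m) (arr ` spans K)"
    by (rule restrict_ext) (auto simp: rep_arr(2) simp del: mem_spans)
  then show "span_to_par K = one1 SplitRestCat (on0 SpanF K)"
    by (simp add: span_to_par_def id_cell_def SplitRestCat_def zeq_cong)
qed (use SpanF_eq_ParF[OF inf] in auto)

section \<open>The unit\<close>

text \<open>The lift \<open>u\<close> of the cone \<open>(1, a)\<close> is at once a span morphism
  from \<open>(1, a)\<close> to \<open>(t', g')\<close> and a conjugate of \<open>s\<close>. The
  target depends on \<open>a\<close> only through \<open>s a\<close>.\<close>

lemma zeq_pullback:
  assumes K: "stable_cat K" and s: "s \<in> snd K" and a: "a \<in> Arr (fst K)" "Cod (fst K) a = Dom (fst K) s"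
    and p: "pullback (fst K) (s \<cdot>\<^bsub>fst K\<^esub> a) s t' g'"
  shows "zeq K (Idt (fst K) (Dom (fst K) a), a) (t', g')"
proof -
  let ?C = "fst K" and ?I = "Idt (fst K) (Dom (fst K) a)" and ?J = "Idt (fst K) (Dom (fst K) s)"
  have [simp]: "category ?C" using K by (rule stable_catD)
  have sA [simp]: "s \<in> Arr ?C" using K s by (rule stable_catD)
  note P [simp] = pullbackD(1-4,6-8)[OF p]
  note [simp] = a
  obtain u where u: "u \<in> Arr ?C" "Dom ?C u = Dom ?C a" "Cod ?C u = Dom ?C t'"
    "t' \<cdot>\<^bsub>?C\<^esub> u = ?I" "g' \<cdot>\<^bsub>?C\<^esub> u = a"
    by (rule pullback_lift[OF p, of ?I a]) auto
  have S: "t' \<in> snd K" "?I \<in> snd K" "?J \<in> snd K"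
    using stable_catD(6)[OF K s p] stable_catD(3)[OF K] iso_arr_Idt[of ?C] by auto
  \<comment> \<open>The morphism \<open>s\<close> leads from the cospan \<open>(a, 1)\<close>, whose
    pullback is the pair \<open>(1, a)\<close>, to \<open>(s a, s)\<close>, whose pullback is
    \<open>(t', g')\<close>.\<close>
  have "cospan_mor K a ?J s (s \<cdot>\<^bsub>?C\<^esub> a) s"
    using s S by (simp add: cospan_mor_def hom_def Let_def)
  moreover have "pullback ?C a ?J ?I a"
    using pullback_Idt_right[of ?C a] by simp
  moreover have "u \<in> hom ?C (Dom ?C ?I) (Dom ?C t')" using u by (simp add: hom_def)
  ultimately have "conjugate K s u"
    unfolding conjugate_def Let_def using p u(4,5) by blast
  \<comment> \<open>A conjugate is a pullback of itself along an identity, hence in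
    \<open>Sstar\<close>.\<close>
  then have "u \<in> Sstar K"
    unfolding Sstar_def using s pullback_Idt_left[OF \<open>category ?C\<close> u(1)] by blast
  moreover have "span_mor K (?I, a) u (t', g')"
    using S u by (simp add: span_mor_def spans_def hom_def)
  ultimately show ?thesis by (intro zeq.base)
qed

lemma par_unit_iso_imp_mono:
  assumes K: "stable_cat K" and iso: "iso1 StableCat (par_unit K)" and s: "s \<in> snd K"
  shows "mono_arr (fst K) s"
  unfolding mono_arr_def
proof (intro conjI ballI impI)
  let ?C = "fst K"
  show sA: "s \<in> Arr ?C" using K s by (rule stable_catD)
  have C: "category ?C" using K by (rule stable_catD)
  fix a b assume ab: "a \<in> Arr ?C" "b \<in> Arr ?C"
    "Dom ?C a = Dom ?C b \<and> Cod ?C a = Dom ?C s \<and> Cod ?C b = Dom ?C s \<and> s \<cdot>\<^bsub>?C\<^esub> a = s \<cdot>\<^bsub>?C\<^esub> b"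
  obtain t' g' where p: "pullback ?C (s \<cdot>\<^bsub>?C\<^esub> a) s t' g'"
    using stable_catD(5)[OF K s, of "s \<cdot>\<^bsub>?C\<^esub> a"] C sA ab by auto
  have "zeq K (Idt ?C (Dom ?C a), a) (t', g')" and "zeq K (Idt ?C (Dom ?C b), b) (t', g')"
    using zeq_pullback[OF K s, of a t' g'] zeq_pullback[OF K s, of b t' g'] p ab by simp_all
  then have e: "zeq K (Idt ?C (Dom ?C a), a) (Idt ?C (Dom ?C b), b)"
    by (rule zeq.trans[OF _ zeq.sym])
  have "{q. zeq K (Idt ?C (Dom ?C a), a) q} = {q. zeq K (Idt ?C (Dom ?C b), b) q}"
    by (intro Collect_cong iffI) (erule zeq.trans[OF zeq.sym[OF e]] zeq.trans[OF e])+
  then have "span_arr zeq K (Idt ?C (Dom ?C a), a) = span_arr zeq K (Idt ?C (Dom ?C b), b)"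
    unfolding span_arr_def by (rule arg_cong)
  then have eq: "AMap (par_unit K) a = AMap (par_unit K) b"
    using ab by (simp add: par_unit_def)
  \<comment> \<open>A left inverse already makes the unit injective on arrows, and injectivity is
    the property that \<open>a\<close> and \<open>b\<close> are played against.\<close>
  obtain g where "comp_cell g (par_unit K) = id_cell K"
    using iso by (auto simp: iso1_def StableCat_def par_unit_def)
  then have "AMap g (AMap (par_unit K) x) = x" if "x \<in> Arr ?C" for x
    using that arg_cong[of _ _ "\<lambda>F. AMap F x"] comp_cell_simps(4)[of x "par_unit K" g]
    by (auto simp: par_unit_def)
  with eq ab show "a = b" by metis
qed

text \<open>An isomorphism of categories and its inverse preserve pullbacks. Between stably
  structured categories it remains to match the two classes, and equality of
  \<open>snd (Tgt F)\<close> with the image of \<open>snd (Src F)\<close> serves both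
  directions.\<close>

lemma stable_functor_iso_cell:
  assumes F: "iso_cell F" and st: "stable_cat (Src F)" "stable_cat (Tgt F)"
    and S: "AMap F ` snd (Src F) = snd (Tgt F)"
  shows "stable_functor F" "stable_functor (inverse_cell F)"
proof -
  note I = inverse_cell_simps[OF F]
  show "stable_functor F"
    unfolding stable_functor_def using st S I(1) inverse_cell_pullback[OF F] by auto
  have "AMap (inverse_cell F) ` snd (Tgt F) \<subseteq> snd (Src F)"
    using S I(4) stable_catD(2)[OF st(1)] by force
  then show "stable_functor (inverse_cell F)"
    unfolding stable_functor_def
    using st I functor_cell_inverse[OF F] inverse_cell_pullback[OF iso_cell_inverse[OF F]] by simp
qed

section \<open>Invertibility of the unit at a monic class\<close>

context mono_span begin

lemma par_unit_simps [simp]: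
  "Src (par_unit K) = K" "Tgt (par_unit K) = Total0 (SpanQ0 span_iso K)"
  "A \<in> Obj C \<Longrightarrow> OMap (par_unit K) A = A" "f \<in> Arr C \<Longrightarrow> AMap (par_unit K) f = arr (Idt C (Dom C f), f)"
  by (simp_all add: par_unit_def zeq_cong)

lemma split_restriction_SpanQ0: "split_restriction (SpanQ0 span_iso K)"
  by unfold_locales (rule split_restriction_cat_SpanQ0)

lemma rsec_arr:
  assumes s: "s \<in> snd K"
  shows "restriction.rsec (SpanQ0 span_iso K) (arr (Idt C (Dom C s), s)) (arr (s, Idt C (Dom C s)))"
proof -
  interpret Q: split_restriction "SpanQ0 span_iso K" by (rule split_restriction_SpanQ0)
  show ?thesis unfolding Q.rsec_def using s arr_section[OF s] by simp
qed

text \<open>Let \<open>m = [1, f]\<close> have restricted inverse \<open>j = [t, g]\<close>. The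
  equation \<open>j m = 1\<close> gives \<open>u\<close> with \<open>t u = f\<close> and
  \<open>g u = 1\<close>, and \<open>m j = rs j\<close> gives \<open>f g = t\<close>. Hence
  \<open>t u g = t\<close>, so \<open>u\<close> is inverse to \<open>g\<close> by monicity of
  \<open>t\<close>, and \<open>f = t u\<close> is an isomorphism followed by a member of the
  class.\<close>

lemma rsec_arrE:
  assumes m: "restriction.rsec (SpanQ0 span_iso K) m j"
  obtains s where "s \<in> snd K" "m = arr (Idt C (Dom C s), s)"
proof -
  interpret Q: split_restriction "SpanQ0 span_iso K" by (rule split_restriction_SpanQ0)
  note M = Q.rsecD[OF m, unfolded fst_SpanQ0]
  obtain f where f: "f \<in> Arr C" "m = arr (Idt C (Dom C f), f)"
    using M(7) unfolding total_arr_SpanQ0 by blast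
  obtain t g where tg: "(t, g) \<in> spans K" "j = arr (t, g)" using M(2) by auto
  have D: "Cod C t = Cod C f" "Cod C g = Dom C f" using M(3,4) f tg by simp_all
  have 1: "graph (Idt C (Dom C f), f) O graph (t, g) = Id_on {x \<in> Arr C. Cod C x = Dom C f}"
    using comp_arr(2)[of "(Idt C (Dom C f), f)" "(t, g)"] M(5) f tg D by (simp add: graph_Idt)
  have 2: "graph (t, g) O graph (Idt C (Dom C f), f) = graph (t, t)"
    using comp_arr(2)[of "(t, g)" "(Idt C (Dom C f), f)"] M(6) f tg D by simp
  have "(Idt C (Dom C f), Idt C (Dom C f)) \<in> graph (Idt C (Dom C f), f) O graph (t, g)"
    unfolding 1 using f by (simp add: Id_on_iff)
  then obtain y where y: "(Idt C (Dom C f), y) \<in> graph (Idt C (Dom C f), f)" "(y, Idt C (Dom C f)) \<in> graph (t, g)"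
    by blast
  obtain w where w: "w \<in> Arr C" "Cod C w = Dom C (Idt C (Dom C f))"
    "Idt C (Dom C f) \<odot> w = Idt C (Dom C f)" "f \<odot> w = y"
    using y(1) by (rule graphE)
  have "y = f" using w f by simp
  then obtain u where u: "u \<in> Arr C" "Cod C u = Dom C t" "t \<odot> u = f" "g \<odot> u = Idt C (Dom C f)"
    using y(2) by (auto elim: graphE)
  have "(g, f \<odot> g) \<in> graph (Idt C (Dom C f), f)"
    using f tg D by (intro graphI[of g]) simp_all
  moreover have "(t, g) \<in> graph (t, g)" using graph_self[OF tg(1)] .
  ultimately have "(t, f \<odot> g) \<in> graph (t, t)" unfolding 2[symmetric] by blast
  moreover have tt: "(t, t) \<in> spans K" using tg by simp
  ultimately have fg: "f \<odot> g = t" using graph_single_valued[OF tt _ graph_self[OF tt]] by blast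
  have du: "Dom C u = Dom C f" using arg_cong[OF u(3), of "Dom C"] u(1,2) tg by simp
  have t: "t \<in> snd K" "g \<in> Arr C" "Dom C g = Dom C t" using tg by simp_all
  have "t \<odot> (u \<odot> g) = (t \<odot> u) \<odot> g"
    using u(1,2) du t D by (intro category_assoc[symmetric]) simp_all
  then have "t \<odot> (u \<odot> g) = t" using u(3) fg by simp
  then have ug: "u \<odot> g = Idt C (Dom C t)"
    using mono_arrD[OF mono[OF t(1)], of "u \<odot> g" "Idt C (Dom C t)"] u(1,2) du t D by simp
  have "iso_arr C u"
    by (rule iso_arrI[where g = g]) (use u(1,2,4) du t D ug in simp_all)
  then have "f \<in> snd K"
    using stable_catD(4)[OF stable stable_catD(3)[OF stable] t(1), of u] u(2,3) by simp
  then show thesis using f(2) by (rule that)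
qed

lemma iso_cell_par_unit: "iso_cell (par_unit K)"
  unfolding iso_cell_def
proof (intro conjI)
  interpret Q: split_restriction "SpanQ0 span_iso K" by (rule split_restriction_SpanQ0)
  have tot: "total_arr (SpanQ0 span_iso K) (arr (Idt C (Dom C f), f))" if "f \<in> Arr C" for f
    using that by (auto simp: total_arr_SpanQ0)
  show "functor_cell (par_unit K)"
  proof (rule functor_cellI)
    show "OMap (par_unit K) \<in> extensional (Obj (SrcC (par_unit K)))"
      "AMap (par_unit K) \<in> extensional (Arr (SrcC (par_unit K)))"
      by (simp_all add: par_unit_def)
    show "AMap (par_unit K) (g \<cdot>\<^bsub>SrcC (par_unit K)\<^esub> f) =
        AMap (par_unit K) g \<cdot>\<^bsub>TgtC (par_unit K)\<^esub> AMap (par_unit K) f"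
      if "f \<in> Arr (SrcC (par_unit K))" "g \<in> Arr (SrcC (par_unit K))"
        "Cod (SrcC (par_unit K)) f = Dom (SrcC (par_unit K)) g" for f g
      using that tot[of f] tot[of g] comp_arr_Idt[of f g] by simp
  qed (use tot in simp_all)
  show "bij_betw (AMap (par_unit K)) (Arr (SrcC (par_unit K))) (Arr (TgtC (par_unit K)))"
  proof (rule bij_betw_imageI)
    show "inj_on (AMap (par_unit K)) (Arr (SrcC (par_unit K)))"
    proof (rule inj_onI)
      fix f g assume "f \<in> Arr (SrcC (par_unit K))" "g \<in> Arr (SrcC (par_unit K))"
        and eq: "AMap (par_unit K) f = AMap (par_unit K) g"
      then have fg: "f \<in> Arr C" "g \<in> Arr C" by simp_all
      with eq have "arr (Idt C (Dom C f), f) = arr (Idt C (Dom C g), g)" by simp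
      \<comment> \<open>The domains have to be recovered from the codes, since equality of the two
        spans is not yet known to be one of parallel arrows.\<close>
      moreover from this have "Dom C f = Dom C g"
        using Dom_Cod_arr(1)[of "(Idt C (Dom C f), f)"] Dom_Cod_arr(1)[of "(Idt C (Dom C g), g)"] fg by simp
      ultimately show "f = g" using arr_Idt_inject[OF fg] by blast
    qed
    show "AMap (par_unit K) ` Arr (SrcC (par_unit K)) = Arr (TgtC (par_unit K))"
      by (auto simp: total_arr_SpanQ0 image_iff)
  qed
  show "Obj (TgtC (par_unit K)) = Obj (SrcC (par_unit K))"
    "\<forall>A\<in>Obj (SrcC (par_unit K)). OMap (par_unit K) A = A"
    by simp_all
qed

lemma par_unit_sections: "AMap (par_unit K) ` snd K = snd (Total0 (SpanQ0 span_iso K))"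
proof -
  interpret Q: split_restriction "SpanQ0 span_iso K" by (rule split_restriction_SpanQ0)
  show ?thesis
  proof (intro set_eqI iffI)
    fix m assume "m \<in> AMap (par_unit K) ` snd K"
    then show "m \<in> snd (Total0 (SpanQ0 span_iso K))" using rsec_arr by auto
  next
    fix m assume "m \<in> snd (Total0 (SpanQ0 span_iso K))"
    then obtain j where "Q.rsec m j" by auto
    then obtain s where "s \<in> snd K" "m = arr (Idt C (Dom C s), s)" by (rule rsec_arrE)
    then show "m \<in> AMap (par_unit K) ` snd K" by (auto simp: image_iff)
  qed
qed

lemma mono_functor_par_unit: "mono_functor (par_unit K)" "mono_functor (inverse_cell (par_unit K))"
  and iso1_par_unit: "iso1 StableCat (par_unit K)" "iso1 StableCat_mono (par_unit K)"
proof -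
  interpret Q: split_restriction "SpanQ0 span_iso K" by (rule split_restriction_SpanQ0)
  have "stable_functor (par_unit K)" "stable_functor (inverse_cell (par_unit K))"
    using stable_functor_iso_cell[OF iso_cell_par_unit] par_unit_sections stable Q.stable_cat_Total0 by simp_all
  then show "mono_functor (par_unit K)" "mono_functor (inverse_cell (par_unit K))"
    and "iso1 StableCat (par_unit K)" "iso1 StableCat_mono (par_unit K)"
    using mono_stable Q.mono_stable_Total0 inverse_cell_simps(2,3)[OF iso_cell_par_unit]
      iso1_struct[OF iso_cell_par_unit]
    by (simp_all add: mono_functor_def StableCat_def StableCat_mono_eq)
qed

end

section \<open>The counit\<close>

locale split_restriction_inf = split_restriction X for X :: "('o, 'm) cat \<times> ('m \<Rightarrow> 'm)" +
  assumes infinite: "infinite (UNIV :: 'm set)"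

sublocale split_restriction_inf \<subseteq> M: mono_span "Total0 X"
  using mono_stable_Total0 infinite by unfold_locales

context split_restriction_inf begin

lemma par_counit_simps [simp]:
  "Src (par_counit X) = SpanQ0 span_iso (Total0 X)" "Tgt (par_counit X) = X"
  "A \<in> Obj C \<Longrightarrow> OMap (par_counit X) A = A"
  by (simp_all add: par_counit_def M.zeq_cong)

lemma spans_Total0_iff:
  "(s, f) \<in> spans (Total0 X) \<longleftrightarrow> (\<exists>j. rsec s j) \<and> total_arr X f \<and> Dom C s = Dom C f"
  by (auto simp: rsecD(7))

text \<open>Independence of the representative: if an isomorphism \<open>x\<close> with inverse
  \<open>y\<close> leads from \<open>(t, g)\<close> to \<open>(s, f)\<close>, then
  \<open>t = s x\<close> has restricted inverse \<open>y j\<close>, and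
  \<open>g y j = f x y j = f j\<close>.\<close>

lemma par_counit_arr:
  assumes s: "rsec s j" and f: "total_arr X f" "Dom C s = Dom C f"
  shows "AMap (par_counit X) (M.arr (s, f)) = f \<bullet> j"
proof -
  have p: "(s, f) \<in> spans (Total0 X)" using s f unfolding spans_Total0_iff by blast
  obtain t g where tg: "M.rep (M.arr (s, f)) = (t, g)" by fastforce
  have q: "(t, g) \<in> spans (Total0 X)" using M.rep_arr(1)[OF p] unfolding tg .
  obtain x where x: "span_mor (Total0 X) (t, g) x (s, f)" and iso: "iso_arr T x"
    using M.rep_arr(3)[OF p] unfolding tg by (auto simp: span_iso_def)
  have tT: "total_arr X t" using q rsecD(7) unfolding spans_Total0_iff by blast
  note S = rsecD[OF s]
  have X: "total_arr X x" "Dom C x = Dom C t" "Cod C x = Dom C s" "s \<bullet> x = t" "f \<bullet> x = g"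
    using x tT S f by (auto simp: span_mor_def hom_def)
  obtain y where y: "y \<in> Arr T" "Dom T y = Cod T x" "Cod T y = Dom T x"
    "y \<cdot>\<^bsub>T\<^esub> x = Idt T (Dom T x)" "x \<cdot>\<^bsub>T\<^esub> y = Idt T (Cod T x)"
    using iso_arrE[OF iso] by blast
  have xy: "rsec x y" and y': "x \<bullet> y = Idt C (Dom C s)" "total_arr X y" "Dom C y = Dom C s" "Cod C y = Dom C x"
    using y X(1,3) by (auto simp: rsec_def)
  have "rsec t (y \<bullet> j)" using rsec_trans[OF xy s X(3)] X(4) by simp
  then have "rinv X t = y \<bullet> j" by (rule rinv_eq)
  moreover have "g \<bullet> (y \<bullet> j) = f \<bullet> j"
  proof -
    have "g \<bullet> (y \<bullet> j) = (f \<bullet> x) \<bullet> (y \<bullet> j)" using X(5) by simp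
    also have "\<dots> = f \<bullet> ((x \<bullet> y) \<bullet> j)"
      using X(1-3) y'(2-4) S f by (simp add: category_assoc)
    finally show ?thesis using y'(1) S by simp
  qed
  moreover have "M.arr (s, f) \<in> Arr M.P" using p by simp
  ultimately show ?thesis by (simp add: par_counit_def M.zeq_cong tg del: M.span_cat_simps)
qed

section \<open>The counit as an invertible restriction functor\<close>

lemma Arr_Par_TotalE:
  assumes "m \<in> Arr M.P"
  obtains s f j where "rsec s j" "total_arr X f" "Dom C s = Dom C f" "m = M.arr (s, f)"
    "(s, f) \<in> spans (Total0 X)"
proof -
  obtain s f where "(s, f) \<in> spans (Total0 X)" "m = M.arr (s, f)" using assms by auto
  then show thesis using that unfolding spans_Total0_iff by blast
qed

lemma functor_cell_par_counit: "functor_cell (par_counit X)"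
proof (rule functor_cellI)
  let ?E = "par_counit X"
  show "OMap ?E \<in> extensional (Obj (SrcC ?E))" "AMap ?E \<in> extensional (Arr (SrcC ?E))"
    by (simp_all add: par_counit_def M.zeq_cong del: M.span_cat_simps(2))
  show "AMap ?E (Idt (SrcC ?E) A) = Idt (TgtC ?E) (OMap ?E A)" if "A \<in> Obj (SrcC ?E)" for A
    using that par_counit_arr[OF rsec_Idt, of A "Idt C A"] by simp
  fix m assume "m \<in> Arr (SrcC ?E)"
  then obtain s f j where s: "rsec s j" and f: "total_arr X f" "Dom C s = Dom C f" and m: "m = M.arr (s, f)"
    and p: "(s, f) \<in> spans (Total0 X)"
    by (auto elim: Arr_Par_TotalE simp del: M.span_cat_simps)
  note S = rsecD[OF s]
  have Em: "AMap ?E m = f \<bullet> j" using par_counit_arr[OF s f] m by simp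
  have Pm: "Dom M.P m = Cod C s" "Cod M.P m = Cod C f"
    using m p S f M.Dom_Cod_arr[OF p] by simp_all
  show "AMap ?E m \<in> Arr (TgtC ?E)" "Dom (TgtC ?E) (AMap ?E m) = OMap ?E (Dom (SrcC ?E) m)"
    "Cod (TgtC ?E) (AMap ?E m) = OMap ?E (Cod (SrcC ?E) m)"
    using Em Pm S f by simp_all
  fix n assume "n \<in> Arr (SrcC ?E)" and eq: "Cod (SrcC ?E) m = Dom (SrcC ?E) n"
  then obtain t g k where t: "rsec t k" and g: "total_arr X g" "Dom C t = Dom C g" and n: "n = M.arr (t, g)"
    and q: "(t, g) \<in> spans (Total0 X)"
    by (auto elim: Arr_Par_TotalE simp del: M.span_cat_simps)
  note U = rsecD[OF t]
  have En: "AMap ?E n = g \<bullet> k" using par_counit_arr[OF t g] n by simp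
  have D: "Cod C f = Cod C t" using eq Pm n q U M.Dom_Cod_arr(1)[OF q] by simp
  obtain t' j' f' where t': "rsec t' j'" and rj: "rs j' = rs (k \<bullet> f)" and pb: "pullback T f t t' f'"
    by (rule total_pullback_exists[OF t f(1) D])
  note U' = rsecD[OF t']
  have F: "total_arr X f'" "Dom C f' = Dom C t'" "Cod C t' = Dom C f" "Cod C f' = Dom C t" "f \<bullet> t' = t \<bullet> f'"
    using pullbackD[OF pb] U U' by auto
  have "n \<cdot>\<^bsub>M.P\<^esub> m = M.arr (s \<cdot>\<^bsub>T\<^esub> t', g \<cdot>\<^bsub>T\<^esub> f')"
    using M.comp_arr_pullback[OF p q, of t' f'] pb m n by simp
  also have "\<dots> = M.arr (s \<bullet> t', g \<bullet> f')" using S U' F f g by simp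
  finally have nm: "AMap ?E (n \<cdot>\<^bsub>M.P\<^esub> m) = (g \<bullet> f') \<bullet> (j' \<bullet> j)"
    using par_counit_arr[OF rsec_trans[OF t' s] total_comp[OF F(1) g(1)]] F f g S U' by simp
  \<comment> \<open>Functoriality rests on the exchange law \<open>k f = f' j'\<close> for the
    pullback square. As \<open>rs (k f) = rs j' = t' j'\<close>, one has
    \<open>k f = k f t' j' = k t f' j' = f' j'\<close>.\<close>
  have "k \<bullet> f = (k \<bullet> f) \<bullet> rs (k \<bullet> f)" using R1[of "k \<bullet> f"] U f D by simp
  also have "\<dots> = (k \<bullet> f) \<bullet> (t' \<bullet> j')" using rj U' by simp
  also have "\<dots> = (k \<bullet> (f \<bullet> t')) \<bullet> j'" using U U' f D F(3) by (simp add: category_assoc del: U'(5,6))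
  also have "\<dots> = f' \<bullet> j'" unfolding F(5) using rsec_comp[OF t] F by simp
  finally have kf: "k \<bullet> f = f' \<bullet> j'" .
  have "(g \<bullet> f') \<bullet> (j' \<bullet> j) = g \<bullet> ((f' \<bullet> j') \<bullet> j)"
    using F g S U U' f by (simp add: category_assoc)
  also have "\<dots> = (g \<bullet> k) \<bullet> (f \<bullet> j)"
    unfolding kf[symmetric] using g S U f D by (simp add: category_assoc)
  finally show "AMap ?E (n \<cdot>\<^bsub>SrcC ?E\<^esub> m) = AMap ?E n \<cdot>\<^bsub>TgtC ?E\<^esub> AMap ?E m"
    using nm Em En by simp
qed (simp_all)

lemma iso_cell_par_counit: "iso_cell (par_counit X)"
  unfolding iso_cell_def
proof (intro conjI)
  let ?E = "par_counit X"
  show "functor_cell ?E" by (rule functor_cell_par_counit)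
  show "bij_betw (AMap ?E) (Arr (SrcC ?E)) (Arr (TgtC ?E))"
  proof (rule bij_betw_imageI)
    show "inj_on (AMap ?E) (Arr (SrcC ?E))"
    proof (rule inj_onI)
      fix m n assume "m \<in> Arr (SrcC ?E)" "n \<in> Arr (SrcC ?E)" and eq: "AMap ?E m = AMap ?E n"
      then have mn: "m \<in> Arr M.P" "n \<in> Arr M.P" by (simp_all del: M.span_cat_simps)
      obtain s f j where s: "rsec s j" and f: "total_arr X f" "Dom C s = Dom C f" and m: "m = M.arr (s, f)"
        and p: "(s, f) \<in> spans (Total0 X)" using mn(1) by (rule Arr_Par_TotalE)
      obtain t g k where t: "rsec t k" and g: "total_arr X g" "Dom C t = Dom C g" and n: "n = M.arr (t, g)"
        and q: "(t, g) \<in> spans (Total0 X)" using mn(2) by (rule Arr_Par_TotalE)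
      note S = rsecD[OF s] and U = rsecD[OF t]
      have fj: "f \<bullet> j = g \<bullet> k" using eq par_counit_arr[OF s f] par_counit_arr[OF t g] m n by simp
      have D: "Cod C s = Cod C t"
        using arg_cong[OF fj, of "Dom C"] S U f g by simp
      have rjk: "rs j = rs k"
        using arg_cong[OF fj, of rs] rs_total_comp[of j f] rs_total_comp[of k g] S U f g by simp
      \<comment> \<open>Since \<open>f\<close> and \<open>g\<close> are total,
        \<open>f j = g k\<close> forces \<open>rs j = rs k\<close>: both sections split the same
        idempotent. The comparisons \<open>k s\<close> and \<open>j t\<close> are then inverse to
        each other and relate the two spans.\<close>
      have ts: "t \<bullet> (k \<bullet> s) = s" and st: "s \<bullet> (j \<bullet> t) = t"
        using rsec_comp'[OF t, of s] rsec_comp'[OF s, of t] rsec_comp'[OF s, of s] rsec_comp'[OF t, of t]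
          rsec_comp[OF s, of "Idt C (Dom C s)"] rsec_comp[OF t, of "Idt C (Dom C t)"] S U D rjk by simp_all
      have x: "total_arr X (k \<bullet> s)" and y: "total_arr X (j \<bullet> t)"
        using total_comp_cancel[of t "k \<bullet> s"] total_comp_cancel[of s "j \<bullet> t"] ts st S U D by simp_all
      have gx: "g \<bullet> (k \<bullet> s) = f"
      proof -
        have "g \<bullet> (k \<bullet> s) = (f \<bullet> j) \<bullet> s" unfolding fj using S U g D by (simp add: category_assoc)
        also have "\<dots> = f \<bullet> (j \<bullet> s)" using S f by (intro category_assoc) simp_all
        finally show ?thesis using S f by simp
      qed
      have "(j \<bullet> t) \<bullet> (k \<bullet> s) = j \<bullet> (t \<bullet> (k \<bullet> s))" "(k \<bullet> s) \<bullet> (j \<bullet> t) = k \<bullet> (s \<bullet> (j \<bullet> t))"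
        using S U D by (simp_all add: category_assoc)
      then have inv: "(j \<bullet> t) \<bullet> (k \<bullet> s) = Idt C (Dom C s)" "(k \<bullet> s) \<bullet> (j \<bullet> t) = Idt C (Dom C t)"
        unfolding ts st using S(5) U(5) by simp_all
      have "span_mor (Total0 X) (s, f) (k \<bullet> s) (t, g)"
        using p q x ts gx S U D f g unfolding span_mor_def by (simp add: hom_def)
      moreover have "iso_arr T (k \<bullet> s)"
        by (rule iso_arrI[where g = "j \<bullet> t"]) (use x y inv S U D in simp_all)
      ultimately have "span_iso (Total0 X) (s, f) (t, g)" by (auto simp: span_iso_def)
      then show "m = n" unfolding m n using M.arr_eq_iff M.span_iso_iff by blast
    qed
    show "AMap ?E ` Arr (SrcC ?E) = Arr (TgtC ?E)"
    proof (intro set_eqI iffI)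
      fix h assume "h \<in> AMap ?E ` Arr (SrcC ?E)"
      then show "h \<in> Arr (TgtC ?E)" using functor_cell_simps(4)[OF functor_cell_par_counit] by blast
    next
      fix h assume "h \<in> Arr (TgtC ?E)"
      then have h: "h \<in> Arr C" by simp
      obtain s j where s: "rsec s j" and D: "Cod C s = Dom C h" and rj: "rs j = rs h"
        using h by (rule rs_split)
      note S = rsecD[OF s]
      \<comment> \<open>Totality of \<open>h s\<close>: since \<open>rs h = rs j = s j\<close>, the
        idempotent \<open>rs h\<close> fixes \<open>s\<close>, and R4 rewrites this as
        \<open>s = s rs (h s)\<close>. Cancelling \<open>s\<close> leaves
        \<open>rs (h s) = 1\<close>.\<close>
      have "rs h \<bullet> s = s" using rsec_comp'[OF s, of s] S rj by simp
      then have "s = s \<bullet> rs (h \<bullet> s)" using R4[of s h] S h D by simp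
      then have "j \<bullet> s = j \<bullet> (s \<bullet> rs (h \<bullet> s))" by simp
      then have tot: "total_arr X (h \<bullet> s)"
        using rsec_comp[OF s, of "rs (h \<bullet> s)"] S h D by (intro total_arrI) simp_all
      have "(h \<bullet> s) \<bullet> j = h"
        using S h D rj by (simp add: category_assoc)
      then have "AMap ?E (M.arr (s, h \<bullet> s)) = h"
        using tot par_counit_arr[OF s, of "h \<bullet> s"] S h D by simp
      moreover have "(s, h \<bullet> s) \<in> spans (Total0 X)"
        unfolding spans_Total0_iff using s tot S h D by auto
      then have "M.arr (s, h \<bullet> s) \<in> Arr M.P" unfolding M.span_cat_simps by (rule imageI)
      ultimately      show "h \<in> AMap ?E ` Arr (SrcC ?E)" by (metis imageI fst_conv M.fst_SpanQ0 par_counit_simps(1))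
    qed
  qed
qed simp_all

lemma restriction_functor_par_counit: "restriction_functor (par_counit X)"
  unfolding restriction_functor_def
proof (intro conjI ballI)
  let ?E = "par_counit X"
  show "functor_cell ?E" by (rule functor_cell_par_counit)
  show "split_restriction_cat (Src ?E)" using M.split_restriction_cat_SpanQ0 by simp
  show "split_restriction_cat (Tgt ?E)" using split_restriction_cat by simp
  fix m assume "m \<in> Arr (SrcC ?E)"
  then obtain s f j where s: "rsec s j" and f: "total_arr X f" "Dom C s = Dom C f" and m: "m = M.arr (s, f)"
    and p: "(s, f) \<in> spans (Total0 X)"
    by (auto elim: Arr_Par_TotalE simp del: M.span_cat_simps)
  note S = rsecD[OF s]
  show "AMap ?E (snd (Src ?E) m) = snd (Tgt ?E) (AMap ?E m)"
    using M.rest_arr[OF p] par_counit_arr[OF s f] par_counit_arr[OF s S(7)] rs_total_comp[of j f] m S f by simp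
qed

end

lemma restriction_functor_inverse:
  assumes F: "iso_cell F" and r: "restriction_functor F"
  shows "restriction_functor (inverse_cell F)"
  unfolding restriction_functor_def
proof (intro conjI ballI)
  interpret restriction_fun F by unfold_locales (rule r)
  note I = inverse_cell_simps[OF F]
  show "functor_cell (inverse_cell F)" using F by (rule functor_cell_inverse)
  show "split_restriction_cat (Src (inverse_cell F))" "split_restriction_cat (Tgt (inverse_cell F))"
    using restriction_functorD[OF r] I by simp_all
  fix f assume f: "f \<in> Arr (SrcC (inverse_cell F))"
  let ?g = "AMap (inverse_cell F) f"
  have g: "?g \<in> Arr X.C" "AMap F ?g = f" using I f by simp_all
  have "AMap (inverse_cell F) (Y.rs f) = AMap (inverse_cell F) (AMap F (X.rs ?g))"
    using AMap_rs[OF g(1)] g(2) by simp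
  also have "\<dots> = X.rs ?g" using I(4) g by simp
  finally show "AMap (inverse_cell F) (snd (Src (inverse_cell F)) f) = snd (Tgt (inverse_cell F)) ?g"
    using I by simp
qed

lemma (in split_restriction_inf) iso1_par_counit: "iso1 SplitRestCat (par_counit X)"
  unfolding SplitRestCat_def
  using iso1_struct[OF iso_cell_par_counit] restriction_functor_par_counit
    restriction_functor_inverse[OF iso_cell_par_counit] by simp

section \<open>The adjoint equivalence\<close>

lemma two_natural_par_unit:
  assumes inf: "infinite (UNIV :: 'm set)"
  shows "two_natural (StableCat_mono :: ('o, 'm, 'm set) struct_2cat) StableCat_mono
    id_twofun (comp_twofun TotalF ParF) par_unit"
proof -
  have span: "mono_span K" if "mono_stable K" for K :: "('o, 'm) cat \<times> 'm set"
    using that inf by unfold_locales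
  let ?M = "struct_twocat {K. mono_stable K} {F. mono_functor F} {\<alpha>. mono_nat \<alpha>} :: ('o, 'm, 'm set) struct_2cat"
  show ?thesis
    unfolding StableCat_mono_eq
  proof (rule two_natural_structI)
    show "two_functor ?M ?M id_twofun"
      using two_functor_id[OF two_category_StableCat_mono] unfolding StableCat_mono_eq .
    show "two_functor ?M ?M (comp_twofun TotalF (ParF :: ('o, 'm) span_twofun))"
      using two_functor_comp[OF two_functor_Par[OF inf] two_functor_Total] unfolding StableCat_mono_eq .
    show "functor_cell F" if "F \<in> {F. mono_functor F}" for F :: "('o, 'm, 'm set) onecell"
      using that by (simp add: mono_functor_def stable_functorD(3))
    show "nat_cell \<alpha>" if "\<alpha> \<in> {\<alpha>. mono_nat \<alpha>}" for \<alpha> :: "('o, 'm, 'm set) twocell"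
      using that by (simp add: mono_nat_def stable_natD(3))
    fix K :: "('o, 'm) cat \<times> 'm set" assume "K \<in> {K. mono_stable K}"
    then interpret K: mono_span K by (intro span) simp
    show "par_unit K \<in> {F. mono_functor F}" "Src (par_unit K) = on0 id_twofun K"
      "Tgt (par_unit K) = on0 (comp_twofun TotalF ParF) K"
      using K.mono_functor_par_unit by (simp_all add: K.zeq_cong)
  next
    fix F :: "('o, 'm, 'm set) onecell" assume "F \<in> {F. mono_functor F}"
    then interpret F: mono_fun F using inf by unfold_locales simp
    interpret R: restriction_fun "SpanQ1 span_iso F"
      by unfold_locales (rule F.restriction_functor_SpanQ1)
    show "OMap (on1 (comp_twofun TotalF ParF) F) (OMap (par_unit (Src F)) A) =
        OMap (par_unit (Tgt F)) (OMap (on1 id_twofun F) A)" if "A \<in> Obj (fst (on0 id_twofun (Src F)))" for A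
      using that by (simp add: F.SpanQ1_zeq)
    show "AMap (on1 (comp_twofun TotalF ParF) F) (AMap (par_unit (Src F)) a) =
        AMap (par_unit (Tgt F)) (AMap (on1 id_twofun F) a)" if "a \<in> Arr (fst (on0 id_twofun (Src F)))" for a
    proof -
      have a: "a \<in> Arr F.A.C" using that by simp
      then have "total_arr (SpanQ0 span_iso (Src F)) (F.A.arr (Idt F.A.C (Dom F.A.C a), a))"
        by (auto simp: F.A.total_arr_SpanQ0)
      then show ?thesis using a F.SpanQ1_arr[of "Idt F.A.C (Dom F.A.C a)" a] by (simp add: F.SpanQ1_zeq)
    qed
  next
    fix \<alpha> :: "('o, 'm, 'm set) twocell" and A
    assume "\<alpha> \<in> {\<alpha>. mono_nat \<alpha>}" and A: "A \<in> Obj (fst (on0 id_twofun (Src (Src2 \<alpha>))))"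
    then have a: "mono_nat \<alpha>" by simp
    then have st: "stable_nat \<alpha>" "mono_functor (Src2 \<alpha>)"
      using stable_natD(1)[of \<alpha>] by (simp_all add: mono_nat_def mono_functor_def)
    interpret F: mono_fun "Src2 \<alpha>" using st inf by unfold_locales
    show "Cpt (on2 (comp_twofun TotalF ParF) \<alpha>) (OMap (par_unit (Src (Src2 \<alpha>))) A) =
        AMap (par_unit (Tgt (Src2 \<alpha>))) (Cpt (on2 id_twofun \<alpha>) A)"
      using A nat_cell_simps(6,7)[OF stable_natD(3)[OF st(1)], of A] by (simp add: SpanQ2_zeq[OF a inf])
  qed
qed

lemma two_natural_par_counit:
  assumes inf: "infinite (UNIV :: 'm set)"
  shows "two_natural (SplitRestCat :: ('o, 'm, 'm \<Rightarrow> 'm) struct_2cat) SplitRestCat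
    (comp_twofun ParF TotalF) id_twofun par_counit"
proof -
  have split: "split_restriction_inf X" if "split_restriction_cat X" for X :: "('o, 'm) cat \<times> ('m \<Rightarrow> 'm)"
    using that inf by unfold_locales
  let ?L = "struct_twocat {X. split_restriction_cat X} {F. restriction_functor F} {\<alpha>. total_nat \<alpha>} :: ('o, 'm, 'm \<Rightarrow> 'm) struct_2cat"
  show ?thesis
    unfolding SplitRestCat_def
  proof (rule two_natural_structI)
    show "two_functor ?L ?L id_twofun"
      using two_functor_id[OF two_category_SplitRestCat] unfolding SplitRestCat_def .
    show "two_functor ?L ?L (comp_twofun ParF (TotalF :: ('o, 'm) total_twofun))"
      using two_functor_comp[OF two_functor_Total two_functor_Par[OF inf]] unfolding SplitRestCat_def .
    show "functor_cell F" if "F \<in> {F. restriction_functor F}" for F :: "('o, 'm, 'm \<Rightarrow> 'm) onecell"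
      using that by (simp add: restriction_functorD(1))
    show "nat_cell \<alpha>" if "\<alpha> \<in> {\<alpha>. total_nat \<alpha>}" for \<alpha> :: "('o, 'm, 'm \<Rightarrow> 'm) twocell"
      using that by (simp add: total_natD(3))
    fix X :: "('o, 'm) cat \<times> ('m \<Rightarrow> 'm)" assume "X \<in> {X. split_restriction_cat X}"
    then interpret X: split_restriction_inf X by (intro split) simp
    show "par_counit X \<in> {F. restriction_functor F}" "Src (par_counit X) = on0 (comp_twofun ParF TotalF) X"
      "Tgt (par_counit X) = on0 id_twofun X"
      using X.restriction_functor_par_counit by (simp_all add: X.M.zeq_cong)
  next
    fix F :: "('o, 'm, 'm \<Rightarrow> 'm) onecell" assume "F \<in> {F. restriction_functor F}"
    then have r: "restriction_functor F" by simp
    interpret F: restriction_fun F by unfold_locales (rule r)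
    interpret X: split_restriction_inf "Src F" by (rule split) (rule F.X.split_restriction_cat)
    interpret Y: split_restriction_inf "Tgt F" by (rule split) (rule F.Y.split_restriction_cat)
    interpret TF: mono_fun "Total1 F" using F.mono_functor_Total1 inf by unfold_locales
    show "OMap (on1 id_twofun F) (OMap (par_counit (Src F)) A) =
        OMap (par_counit (Tgt F)) (OMap (on1 (comp_twofun ParF TotalF) F) A)"
      if "A \<in> Obj (fst (on0 (comp_twofun ParF TotalF) (Src F)))" for A
      using that by (simp add: TF.SpanQ1_zeq X.M.zeq_cong)
    show "AMap (on1 id_twofun F) (AMap (par_counit (Src F)) m) =
        AMap (par_counit (Tgt F)) (AMap (on1 (comp_twofun ParF TotalF) F) m)"
      if "m \<in> Arr (fst (on0 (comp_twofun ParF TotalF) (Src F)))" for m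
    proof -
      have "m \<in> Arr X.M.P" using that by (simp add: X.M.zeq_cong del: X.M.span_cat_simps)
      then obtain s f j where s: "F.X.rsec s j" and f: "total_arr (Src F) f" "Dom F.X.C s = Dom F.X.C f"
        and m: "m = X.M.arr (s, f)" and p: "(s, f) \<in> spans (Total0 (Src F))"
        by (rule X.Arr_Par_TotalE)
      note S = F.X.rsecD[OF s]
      \<comment> \<open>Both ways around the naturality square give \<open>F f\<close> after
        \<open>F j\<close>, because \<open>F\<close> sends the restricted inverse of
        \<open>s\<close> to that of \<open>F s\<close>.\<close>
      have "AMap (SpanQ1 span_iso (Total1 F)) m = Y.M.arr (AMap F s, AMap F f)"
        using TF.SpanQ1_arr[of s f] p m f S by simp
      moreover have "AMap (par_counit (Tgt F)) (Y.M.arr (AMap F s, AMap F f)) = AMap F f \<cdot>\<^bsub>F.Y.C\<^esub> AMap F j"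
        by (rule Y.par_counit_arr[OF F.AMap_rsec[OF s]]) (use f S in simp_all)
      moreover have "AMap F (AMap (par_counit (Src F)) m) = AMap F f \<cdot>\<^bsub>F.Y.C\<^esub> AMap F j"
        using X.par_counit_arr[OF s f] m f S by simp
      ultimately show ?thesis by (simp add: TF.SpanQ1_zeq)
    qed
  next
    fix \<alpha> :: "('o, 'm, 'm \<Rightarrow> 'm) twocell" and A
    assume "\<alpha> \<in> {\<alpha>. total_nat \<alpha>}" and A: "A \<in> Obj (fst (on0 (comp_twofun ParF TotalF) (Src (Src2 \<alpha>))))"
    then have a: "total_nat \<alpha>" by simp
    note D = total_natD[OF a]
    interpret F: restriction_fun "Src2 \<alpha>" by unfold_locales (rule D)
    interpret X: split_restriction_inf "Src (Src2 \<alpha>)" by (rule split) (rule F.X.split_restriction_cat)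
    interpret Y: split_restriction_inf "Tgt (Src2 \<alpha>)" by (rule split) (rule F.Y.split_restriction_cat)
    have A: "A \<in> Obj F.X.C" using A by (simp add: X.M.zeq_cong)
    note N = nat_cell_simps(6-8)[OF D(3) A]
    have "AMap (par_counit (Tgt (Src2 \<alpha>))) (Y.M.arr (Idt F.Y.C (OMap (Src2 \<alpha>) A), Cpt \<alpha> A)) =
        Cpt \<alpha> A \<cdot>\<^bsub>F.Y.C\<^esub> Idt F.Y.C (OMap (Src2 \<alpha>) A)"
      by (rule Y.par_counit_arr[OF F.Y.rsec_Idt]) (use N D(4)[OF A] A in simp_all)
    also have "\<dots> = Cpt \<alpha> A" using N by simp
    finally show "Cpt (on2 id_twofun \<alpha>) (OMap (par_counit (Src (Src2 \<alpha>))) A) =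
        AMap (par_counit (Tgt (Src2 \<alpha>))) (Cpt (on2 (comp_twofun ParF TotalF) \<alpha>) A)"
      using A by (simp add: SpanQ2_zeq[OF mono_nat_Total2[OF a] inf] Total1_Src_Tgt)
  qed
qed

text \<open>Par of the unit sends \<open>[s, f]\<close> to the span with legs \<open>[1, s]\<close>
  and \<open>[1, f]\<close>, and the counit composes \<open>[1, f]\<close> with the restricted
  inverse \<open>[s, 1]\<close> of \<open>[1, s]\<close>. The result is \<open>[s, f]\<close> by
  \<open>arr_factor\<close>.\<close>

lemma triangle_Par:
  fixes K :: "('o, 'm) cat \<times> 'm set"
  assumes K: "mono_stable K" and inf: "infinite (UNIV :: 'm set)"
  shows "comp_cell (par_counit (SpanQ0 zeq K)) (SpanQ1 zeq (par_unit K)) = id_cell (SpanQ0 zeq K)"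
proof -
  interpret K: mono_span K using K inf by unfold_locales
  interpret U: mono_fun "par_unit K" using K.mono_functor_par_unit inf by unfold_locales
  interpret E: split_restriction_inf "SpanQ0 span_iso K"
    using K.split_restriction_cat_SpanQ0 inf by unfold_locales
  have "comp_cell (par_counit (SpanQ0 span_iso K)) (SpanQ1 span_iso (par_unit K)) = id_cell (SpanQ0 span_iso K)"
  proof (rule onecell_eqI)
    show "functor_cell (comp_cell (par_counit (SpanQ0 span_iso K)) (SpanQ1 span_iso (par_unit K)))"
      by (rule functor_cell_comp) (simp_all add: U.functor_cell_SpanQ1 E.functor_cell_par_counit)
    show "functor_cell (id_cell (SpanQ0 span_iso K))" by (simp add: functor_cell_id)
    fix m assume "m \<in> Arr (SrcC (comp_cell (par_counit (SpanQ0 span_iso K)) (SpanQ1 span_iso (par_unit K))))"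
    then obtain s f where m: "(s, f) \<in> spans K" "m = K.arr (s, f)" by auto
    have s: "s \<in> snd K" and f: "f \<in> Arr K.C" "Dom K.C s = Dom K.C f" using m by simp_all
    let ?s = "K.arr (Idt K.C (Dom K.C s), s)" and ?f = "K.arr (Idt K.C (Dom K.C f), f)"
      and ?j = "K.arr (s, Idt K.C (Dom K.C s))"
    have "AMap (SpanQ1 span_iso (par_unit K)) m = E.M.arr (?s, ?f)"
      using U.SpanQ1_arr[of s f] m s f by simp
    moreover have "AMap (par_counit (SpanQ0 span_iso K)) (E.M.arr (?s, ?f)) = ?f \<cdot>\<^bsub>fst (SpanQ0 span_iso K)\<^esub> ?j"
    proof (rule E.par_counit_arr[OF K.rsec_arr[OF s]])
      show "total_arr (SpanQ0 span_iso K) ?f" using f by (auto simp: K.total_arr_SpanQ0)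
    qed (use s f in simp)
    ultimately show "AMap (comp_cell (par_counit (SpanQ0 span_iso K)) (SpanQ1 span_iso (par_unit K))) m =
        AMap (id_cell (SpanQ0 span_iso K)) m"
      using K.arr_factor[OF m(1)] m by simp
  qed simp_all
  then show ?thesis by (simp add: K.zeq_cong U.SpanQ1_zeq)
qed

text \<open>The counit sends \<open>[1, f]\<close> to \<open>f\<close> after the restricted inverse
  of an identity, which is that identity.\<close>

lemma triangle_Total:
  fixes X :: "('o, 'm) cat \<times> ('m \<Rightarrow> 'm)"
  assumes X: "split_restriction_cat X" and inf: "infinite (UNIV :: 'm set)"
  shows "comp_cell (Total1 (par_counit X)) (par_unit (Total0 X)) = id_cell (Total0 X)"
proof -
  interpret X: split_restriction_inf X using X inf by unfold_locales
  interpret E: restriction_fun "par_counit X" by unfold_locales (rule X.restriction_functor_par_counit)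
  show ?thesis
  proof (rule onecell_eqI)
    show "functor_cell (comp_cell (Total1 (par_counit X)) (par_unit (Total0 X)))"
      using X.M.mono_functor_par_unit(1) E.functor_cell_Total1
      by (intro functor_cell_comp) (simp_all add: mono_functor_def stable_functorD(3))
    show "functor_cell (id_cell (Total0 X))" by (simp add: functor_cell_id)
    fix f assume "f \<in> Arr (SrcC (comp_cell (Total1 (par_counit X)) (par_unit (Total0 X))))"
    then have f: "total_arr X f" by simp
    have "total_arr (SpanQ0 span_iso (Total0 X)) (X.M.arr (Idt X.C (Dom X.C f), f))"
      using f by (auto simp: X.M.total_arr_SpanQ0 intro!: bexI[of _ f])
    then show "AMap (comp_cell (Total1 (par_counit X)) (par_unit (Total0 X))) f = AMap (id_cell (Total0 X)) f"
      using f X.par_counit_arr[OF X.rsec_Idt, of "Dom X.C f" f] by simp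
  qed simp_all
qed

theorem corollary6:
  assumes "infinite (UNIV :: 'm set)"
  shows
    "(\<forall>X\<in>Cells0 (SplitRestCat :: ('o, 'm, 'm \<Rightarrow> 'm) struct_2cat).
        iso1 SplitRestCat (par_counit X)) \<and>
     (\<forall>(C, S)\<in>Cells0 (StableCat :: ('o, 'm, 'm set) struct_2cat).
        iso1 StableCat (par_unit (C, S)) \<longleftrightarrow> (\<forall>s\<in>S. mono_arr C s)) \<and>
     two_adjunction (StableCat_mono :: ('o, 'm, 'm set) struct_2cat) SplitRestCat
       ParF TotalF par_unit par_counit \<and>
     two_equivalence (StableCat_mono :: ('o, 'm, 'm set) struct_2cat) SplitRestCat
       ParF TotalF par_unit par_counit \<and>
     two_natural_iso (StableCat_mono :: ('o, 'm, 'm set) struct_2cat) SplitRestCat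
       SpanF ParF span_to_par"
proof -
  have counit: "iso1 SplitRestCat (par_counit X)"
    if "X \<in> Cells0 SplitRestCat" for X :: "('o, 'm) cat \<times> ('m \<Rightarrow> 'm)"
  proof -
    interpret split_restriction_inf X
      using that assms by unfold_locales (simp_all add: SplitRestCat_def)
    show ?thesis by (rule iso1_par_counit)
  qed
  \<comment> \<open>Invertibility is recorded in both 2-categories: in \<open>StableCat\<close> for
    the description of the fixed objects, in \<open>StableCat_mono\<close> for the
    equivalence.\<close>
  have unit: "iso1 StableCat (par_unit K)" "iso1 StableCat_mono (par_unit K)"
    if "mono_stable K" for K :: "('o, 'm) cat \<times> 'm set"
    using mono_span.iso1_par_unit[of K] that assms by (simp_all add: mono_span_def)
  have unit_iff: "iso1 StableCat (par_unit (C, S)) \<longleftrightarrow> (\<forall>s\<in>S. mono_arr C s)"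
    if "(C, S) \<in> Cells0 StableCat" for C :: "('o, 'm) cat" and S
    using that par_unit_iso_imp_mono[of "(C, S)"] unit(1)[of "(C, S)"]
    by (auto simp: StableCat_def mono_stable_def)
  note functors = two_functor_Par[OF assms] two_functor_Total
    two_natural_par_unit[OF assms] two_natural_par_counit[OF assms]
  have "two_adjunction (StableCat_mono :: ('o, 'm, 'm set) struct_2cat) SplitRestCat
       ParF TotalF par_unit par_counit"
    unfolding two_adjunction_def
  proof (intro conjI ballI functors)
    show "comp1 SplitRestCat (par_counit (on0 ParF K)) (on1 ParF (par_unit K)) = one1 SplitRestCat (on0 ParF K)"
      if "K \<in> Cells0 StableCat_mono" for K :: "('o, 'm) cat \<times> 'm set"
      using that triangle_Par[of K] assms by (simp add: SplitRestCat_def)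
    show "comp1 StableCat_mono (on1 TotalF (par_counit X)) (par_unit (on0 TotalF X)) =
        one1 StableCat_mono (on0 TotalF X)"
      if "X \<in> Cells0 SplitRestCat" for X :: "('o, 'm) cat \<times> ('m \<Rightarrow> 'm)"
      using that triangle_Total[of X] assms by (simp add: SplitRestCat_def StableCat_mono_eq)
  qed
  moreover have "two_equivalence (StableCat_mono :: ('o, 'm, 'm set) struct_2cat) SplitRestCat
       ParF TotalF par_unit par_counit"
    unfolding two_equivalence_def two_natural_iso_def using functors unit(2) counit by simp
  ultimately show ?thesis
    using counit unit_iff two_natural_iso_span_to_par[OF assms] by auto
qed

end
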